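(* Let $B$ be a $\mathbf{k}$-hereditary left regular band with a finite group $G$ acting by semigroup automorphisms, where $\mathbf{k}$ is a field with $\mathrm{char}(\mathbf{k})\nmid|G|$. Fix a $G$-invariant standardly indexed cfpoi $\{E_X\}$ of $\mathbf{k} B$. Let $X<Y$ in $\Lambda(B)$, and for each $Z$ with $X<Z\le Y$ fix $b_Z\in B$ with $\sigma(b_Z)=Z$. Then, as $G_X\cap G_Y$-representations, \[E_Y\cdot\mathbf{k} B\cdot E_X\cong\bigoplus_{m\ge1}\ \bigoplus_{\substack{G_X\cap G_Y\text{-orbits}\\ [X=X_0<X_1<\cdots<X_m=Y]}}\Big(\bigotimes_{i=1}^m\widetilde{H}_0\big(\widetilde{B^{<b_{X_i}}_{\ge X_{i-1}}};\mathbf{k}\big)\Big)\Big\uparrow_{\bigcap_iG_{X_i}}^{G_X\cap G_Y},\] where for each orbit a representative chain is chosen.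
   Context: A left regular band (LRB) is a finite semigroup $B$ with $x^2=x$, $xyx=xy$. For $b\in B$, $\sigma(b)=Bb$; $\Lambda(B)$ (principal left ideals ordered by inclusion) is the support semilattice; $G$ acts on it by $g(Bb)=Bg(b)$; $G_X$ is the stabilizer of $X$. Semigroup order: $x\le y$ iff $yx=x$; $B$ is connected if each $B_{\ge X}=\{b:\sigma(b)\ge X\}$ has connected Hasse diagram. $B$ is $\mathbf{k}$-hereditary if it is connected and $\mathbf{k} B$ is a hereditary algebra (every left ideal is projective). For $W<Z$ in $\Lambda(B)$ and $\sigma(b)=Z$, $B^{<b}_{\ge W}=\{a\in B:a<b,\ \sigma(a)\ge W\}$, on which any subgroup of $G_W\cap G_Z$ acts via $g\ast a=b\cdot g(a)$; the tilde denotes this action, and $\widetilde H_0$ is reduced $0$-th homology of the order complex. Each factor is restricted to $\bigcap_iG_{X_i}$ and the tensor product is over $\mathbf{k}$ with diagonal action. The simple $M_X$ is one-dimensional with $b$ acting by $1$ if $\sigma(b)\ge X$, else $0$; a cfpoi $\{E_X\}$ is standardly indexed if $\mathbf{k} BE_X/\mathrm{rad}(\mathbf{k} B)E_X\cong M_X$ and $G$-invariant if $g(E_X)=E_{g(X)}$. *)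

theory Defs
  imports Complex_Main "HOL-Algebra.Group_Action" "HOL-Library.Poly_Mapping"
begin

section \<open>Left regular bands\<close>

class left_regular_band = finite + semigroup_mult +
  assumes lrb_idem: "x * x = x"
    and lrb_regular: "x * y * x = x * y"

definition lrb_le :: "'b::left_regular_band \<Rightarrow> 'b \<Rightarrow> bool" where
  "lrb_le x y \<longleftrightarrow> y * x = x"

definition lrb_less :: "'b::left_regular_band \<Rightarrow> 'b \<Rightarrow> bool" where
  "lrb_less x y \<longleftrightarrow> lrb_le x y \<and> x \<noteq> y"

definition supp :: "'b::left_regular_band \<Rightarrow> 'b set" where
  "supp b = {a * b | a. True}"

definition supports :: "'b::left_regular_band set set" where
  "supports = range supp"

text \<open>A group of automorphisms acts on supports by taking images, i.e. \<open>g(Bb) = Bg(b)\<close>:\<close>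

lemma image_supp:
  fixes f :: "'b::left_regular_band \<Rightarrow> 'b"
  assumes "bij f" and "\<And>x y. f (x * y) = f x * f y"
  shows "f ` supp b = supp (f b)"
proof -
  have "f ` supp b = (\<lambda>a. f a * f b) ` UNIV"
    unfolding supp_def by (auto simp flip: assms(2))
  also have "\<dots> = (\<lambda>a. a * f b) ` (f ` UNIV)"
    by (simp add: image_image)
  also have "\<dots> = supp (f b)"
    using assms(1) by (auto simp: supp_def bij_def)
  finally show ?thesis .
qed

definition up_part :: "'b::left_regular_band set \<Rightarrow> 'b set" where
  "up_part X = {b. X \<subseteq> supp b}"

definition covers_in :: "'b::left_regular_band set \<Rightarrow> ('b \<times> 'b) set" where
  "covers_in P = {(x, y). x \<in> P \<and> y \<in> P \<and> lrb_less x y \<and>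
     \<not> (\<exists>z\<in>P. lrb_less x z \<and> lrb_less z y)}"

definition connected_hasse :: "'b::left_regular_band set \<Rightarrow> bool" where
  "connected_hasse P \<longleftrightarrow> (\<forall>x\<in>P. \<forall>y\<in>P. (x, y) \<in> (covers_in P \<union> (covers_in P)\<inverse>)\<^sup>*)"

definition connected_lrb :: "'b::left_regular_band itself \<Rightarrow> bool" where
  "connected_lrb _ \<longleftrightarrow> (\<forall>X\<in>(supports :: 'b set set). connected_hasse (up_part X))"


section \<open>The semigroup algebra\<close>

text \<open>The library's convolution product on finitely supported functions needs a monoid
  of exponents (written additively), whereas a left regular band need not have an identity.
  As only finite semigroups occur, elements are arbitrary coefficient functions.\<close>

typedef ('b, 'k) semigroup_algebra = "UNIV :: ('b \<Rightarrow> 'k) set"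
  morphisms coeff of_coeff
  by simp

lemma coeff_of_coeff [simp]: "coeff (of_coeff f) = f"
  by (simp add: of_coeff_inverse)

lemma semigroup_algebra_eqI: "(\<And>b. coeff x b = coeff y b) \<Longrightarrow> x = y"
  by (metis coeff_inject ext)

instantiation semigroup_algebra :: ("{finite, semigroup_mult}", ring) ring
begin

definition "0 = of_coeff (\<lambda>_. 0)"
definition "x + y = of_coeff (\<lambda>b. coeff x b + coeff y b)"
definition "x - y = of_coeff (\<lambda>b. coeff x b - coeff y b)"
definition "- x = of_coeff (\<lambda>b. - coeff x b)"
definition "x * y = of_coeff (\<lambda>c. \<Sum>(a, b) | a * b = c. coeff x a * coeff y b)"

instance
proof
  fix x y z :: "('a, 'b) semigroup_algebra"
  have double: "coeff (u * v) c = (\<Sum>a\<in>UNIV. \<Sum>b\<in>UNIV. if a * b = c then coeff u a * coeff v b else 0)"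
    for u v :: "('a, 'b) semigroup_algebra" and c
  proof -
    have "coeff (u * v) c = (\<Sum>p | fst p * snd p = c. coeff u (fst p) * coeff v (snd p))"
      by (simp add: times_semigroup_algebra_def case_prod_unfold)
    also have "\<dots> = (\<Sum>p\<in>UNIV. if fst p * snd p = c then coeff u (fst p) * coeff v (snd p) else 0)"
      by (simp add: sum.If_cases)
    also have "\<dots> = (\<Sum>p\<in>UNIV \<times> UNIV. case p of (a, b) \<Rightarrow>
        if a * b = c then coeff u a * coeff v b else 0)"
      by (simp add: case_prod_unfold)
    finally show ?thesis
      by (simp only: sum.cartesian_product)
  qed
  show "x * y * z = x * (y * z)"
  proof (rule semigroup_algebra_eqI)
    fix d
    have "coeff (x * y * z) d =
        (\<Sum>e\<in>UNIV. \<Sum>c\<in>UNIV. if e * c = d then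
           (\<Sum>a\<in>UNIV. \<Sum>b\<in>UNIV. if a * b = e then coeff x a * coeff y b else 0) * coeff z c else 0)"
      by (simp only: double)
    also have "\<dots> = (\<Sum>e\<in>UNIV. \<Sum>c\<in>UNIV. \<Sum>a\<in>UNIV. \<Sum>b\<in>UNIV. if e = a * b then
           (if e * c = d then coeff x a * coeff y b * coeff z c else 0) else 0)"
      by (intro sum.cong refl) (auto simp: sum_distrib_right intro!: sum.cong sum.neutral[symmetric] sum.neutral)
    also have "\<dots> = (\<Sum>c\<in>UNIV. \<Sum>a\<in>UNIV. \<Sum>b\<in>UNIV. \<Sum>e\<in>UNIV. if e = a * b then
           (if e * c = d then coeff x a * coeff y b * coeff z c else 0) else 0)"
      by (rule trans[OF sum.swap], rule sum.cong[OF refl], rule trans[OF sum.swap], rule sum.cong[OF refl], rule sum.swap)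
    also have "\<dots> = (\<Sum>c\<in>UNIV. \<Sum>a\<in>UNIV. \<Sum>b\<in>UNIV.
        if a * b * c = d then coeff x a * coeff y b * coeff z c else 0)"
      by (simp add: sum.delta)
    finally have L: "coeff (x * y * z) d = \<dots>" .
    have "coeff (x * (y * z)) d =
        (\<Sum>a\<in>UNIV. \<Sum>e\<in>UNIV. if a * e = d then coeff x a *
           (\<Sum>b\<in>UNIV. \<Sum>c\<in>UNIV. if b * c = e then coeff y b * coeff z c else 0) else 0)"
      by (simp only: double)
    also have "\<dots> = (\<Sum>a\<in>UNIV. \<Sum>e\<in>UNIV. \<Sum>b\<in>UNIV. \<Sum>c\<in>UNIV. if e = b * c then
           (if a * e = d then coeff x a * coeff y b * coeff z c else 0) else 0)"
      by (intro sum.cong refl) (auto simp: sum_distrib_left mult.assoc intro!: sum.cong sum.neutral[symmetric] sum.neutral)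
    also have "\<dots> = (\<Sum>a\<in>UNIV. \<Sum>b\<in>UNIV. \<Sum>c\<in>UNIV. \<Sum>e\<in>UNIV. if e = b * c then
           (if a * e = d then coeff x a * coeff y b * coeff z c else 0) else 0)"
      by (rule sum.cong[OF refl], rule trans[OF sum.swap], rule sum.cong[OF refl], rule sum.swap)
    also have "\<dots> = (\<Sum>a\<in>UNIV. \<Sum>b\<in>UNIV. \<Sum>c\<in>UNIV.
        if a * b * c = d then coeff x a * coeff y b * coeff z c else 0)"
      by (simp add: sum.delta mult.assoc)
    also have "\<dots> = (\<Sum>c\<in>UNIV. \<Sum>a\<in>UNIV. \<Sum>b\<in>UNIV.
        if a * b * c = d then coeff x a * coeff y b * coeff z c else 0)"
      by (rule trans[OF sum.cong[OF refl sum.swap]], rule sum.swap)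
    finally show "coeff (x * y * z) d = coeff (x * (y * z)) d"
      using L by simp
  qed
  show "(x + y) * z = x * z + y * z"
    by (rule semigroup_algebra_eqI)
      (simp add: plus_semigroup_algebra_def times_semigroup_algebra_def case_prod_unfold
        distrib_right sum.distrib)
  show "x * (y + z) = x * y + x * z"
    by (rule semigroup_algebra_eqI)
      (simp add: plus_semigroup_algebra_def times_semigroup_algebra_def case_prod_unfold
        distrib_left sum.distrib)
qed (simp_all add: zero_semigroup_algebra_def plus_semigroup_algebra_def
    minus_semigroup_algebra_def uminus_semigroup_algebra_def of_coeff_inject coeff_inverse
    ac_simps)

end

definition alg_scale :: "'k::field \<Rightarrow> ('b, 'k) semigroup_algebra \<Rightarrow> ('b, 'k) semigroup_algebra" where
  "alg_scale c x = of_coeff (\<lambda>b. c * coeff x b)"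

interpretation alg_space: vector_space
  "alg_scale :: 'k::field \<Rightarrow> ('b::{finite, semigroup_mult}, 'k) semigroup_algebra \<Rightarrow> ('b, 'k) semigroup_algebra"
  by unfold_locales
    (auto intro!: semigroup_algebra_eqI
      simp: alg_scale_def plus_semigroup_algebra_def distrib_left distrib_right mult.assoc)

definition alg_map :: "('b \<Rightarrow> 'b) \<Rightarrow> ('b::finite, 'k::field) semigroup_algebra \<Rightarrow> ('b, 'k) semigroup_algebra"
  where "alg_map h x = of_coeff (\<lambda>b. \<Sum>a | h a = b. coeff x a)"


section \<open>Vector spaces with operators\<close>

text \<open>A vector space over \<open>'k\<close> on an explicit carrier, with operators indexed by \<open>'r\<close>.
  This covers both representations of a group (\<open>'r\<close> its elements) and left modules
  over a \<open>'k\<close>-algebra (\<open>'r\<close> the algebra). Operators outside the acting set named in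
  \<open>rep_iso\<close> carry no meaning, so restriction to a subgroup is implicit.\<close>

record ('r, 'k, 'v) rep = "'v partial_object" +
  vadd :: "'v \<Rightarrow> 'v \<Rightarrow> 'v"
  vzero :: 'v
  vscale :: "'k \<Rightarrow> 'v \<Rightarrow> 'v"
  act :: "'r \<Rightarrow> 'v \<Rightarrow> 'v"

definition rep_hom :: "'r set \<Rightarrow> ('r, 'k, 'v) rep \<Rightarrow> ('r, 'k, 'w) rep \<Rightarrow> ('v \<Rightarrow> 'w) set" where
  "rep_hom S V W = {f. f \<in> carrier V \<rightarrow> carrier W \<and>
     (\<forall>x\<in>carrier V. \<forall>y\<in>carrier V. f (vadd V x y) = vadd W (f x) (f y)) \<and>
     (\<forall>c. \<forall>x\<in>carrier V. f (vscale V c x) = vscale W c (f x)) \<and>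
     (\<forall>g\<in>S. \<forall>x\<in>carrier V. f (act V g x) = act W g (f x))}"

definition rep_iso :: "'r set \<Rightarrow> ('r, 'k, 'v) rep \<Rightarrow> ('r, 'k, 'w) rep \<Rightarrow> bool" where
  "rep_iso S V W \<longleftrightarrow> (\<exists>f\<in>rep_hom S V W. bij_betw f (carrier V) (carrier W))"

definition vcoset :: "('r, 'k, 'v) rep \<Rightarrow> 'v set \<Rightarrow> 'v \<Rightarrow> 'v set" where
  "vcoset V N x = vadd V x ` N"

definition quotient_rep :: "('r, 'k, 'v) rep \<Rightarrow> 'v set \<Rightarrow> ('r, 'k, 'v set) rep" where
  "quotient_rep V N = \<lparr>
     carrier = vcoset V N ` carrier V,
     vadd = (\<lambda>A B. \<Union>a\<in>A. \<Union>b\<in>B. vcoset V N (vadd V a b)),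
     vzero = vcoset V N (vzero V),
     vscale = (\<lambda>c A. \<Union>a\<in>A. vcoset V N (vscale V c a)),
     act = (\<lambda>g A. \<Union>a\<in>A. vcoset V N (act V g a))\<rparr>"

definition direct_sum :: "'i set \<Rightarrow> ('i \<Rightarrow> ('r, 'k, 'v) rep) \<Rightarrow> ('r, 'k, 'i \<Rightarrow> 'v) rep" where
  "direct_sum I V = \<lparr>
     carrier = {x \<in> (\<Pi>\<^sub>E i\<in>I. carrier (V i)). finite {i\<in>I. x i \<noteq> vzero (V i)}},
     vadd = (\<lambda>x y. \<lambda>i\<in>I. vadd (V i) (x i) (y i)),
     vzero = (\<lambda>i\<in>I. vzero (V i)),
     vscale = (\<lambda>c x. \<lambda>i\<in>I. vscale (V i) c (x i)),
     act = (\<lambda>g x. \<lambda>i\<in>I. act (V i) g (x i))\<rparr>"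

text \<open>The vector space with basis \<open>S\<close>, operators being extended linearly from \<open>S\<close>.\<close>

definition free_scale :: "'k::field \<Rightarrow> ('s \<Rightarrow>\<^sub>0 'k) \<Rightarrow> ('s \<Rightarrow>\<^sub>0 'k)" where
  "free_scale c f = Poly_Mapping.map ((*) c) f"

lemma lookup_free_scale [simp]: "Poly_Mapping.lookup (free_scale c f) s = c * Poly_Mapping.lookup f s"
  by (simp add: free_scale_def Poly_Mapping.map.rep_eq when_def)

interpretation free_space: vector_space
  "free_scale :: 'k::field \<Rightarrow> ('s \<Rightarrow>\<^sub>0 'k) \<Rightarrow> ('s \<Rightarrow>\<^sub>0 'k)"
  by unfold_locales
    (auto intro!: poly_mapping_eqI simp: lookup_add distrib_left distrib_right mult.assoc)

definition free_rep :: "'s set \<Rightarrow> ('r \<Rightarrow> 's \<Rightarrow> 's) \<Rightarrow> ('r, 'k::field, 's \<Rightarrow>\<^sub>0 'k) rep" where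
  "free_rep S \<alpha> = \<lparr>
     carrier = {f. Poly_Mapping.keys f \<subseteq> S},
     vadd = (+),
     vzero = 0,
     vscale = free_scale,
     act = (\<lambda>g f. \<Sum>s\<in>Poly_Mapping.keys f. Poly_Mapping.single (\<alpha> g s) (Poly_Mapping.lookup f s))\<rparr>"

text \<open>Tensor product over \<open>'k\<close> of a list of representations, with diagonal action:
  the free space on tuples of vectors modulo the multilinearity relations.\<close>

definition tensor_relations :: "('r, 'k::field, 'v) rep list \<Rightarrow> ('v list \<Rightarrow>\<^sub>0 'k) set" where
  "tensor_relations Vs =
     {Poly_Mapping.single (vs[i := vadd (Vs ! i) v w]) 1
        - Poly_Mapping.single (vs[i := v]) 1 - Poly_Mapping.single (vs[i := w]) 1 | vs i v w.
        vs \<in> listset (map carrier Vs) \<and> i < length Vs \<and>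
        v \<in> carrier (Vs ! i) \<and> w \<in> carrier (Vs ! i)}
   \<union> {Poly_Mapping.single (vs[i := vscale (Vs ! i) c v]) 1
        - Poly_Mapping.single (vs[i := v]) c | vs i c v.
        vs \<in> listset (map carrier Vs) \<and> i < length Vs \<and> v \<in> carrier (Vs ! i)}"

definition tensor_rep :: "('r, 'k::field, 'v) rep list \<Rightarrow> ('r, 'k, ('v list \<Rightarrow>\<^sub>0 'k) set) rep" where
  "tensor_rep Vs =
     quotient_rep (free_rep (listset (map carrier Vs)) (\<lambda>g. map2 (\<lambda>V. act V g) Vs))
       (free_space.span (tensor_relations Vs))"

text \<open>The induced representation \<open>V\<up>\<^sub>H\<^sup>K = kK \<otimes>\<^bsub>kH\<^esub> V\<close> for subgroups \<open>H \<subseteq> K\<close> of \<open>G\<close>.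
  The generator \<open>(x, v)\<close> stands for \<open>x \<otimes> v\<close>; as the group elements form a basis of \<open>kK\<close>,
  linearity in the first factor needs no relations.\<close>

definition induction_relations ::
  "('g, 'm) monoid_scheme \<Rightarrow> 'g set \<Rightarrow> 'g set \<Rightarrow> ('g, 'k::field, 'v) rep \<Rightarrow> ('g \<times> 'v \<Rightarrow>\<^sub>0 'k) set" where
  "induction_relations G H K V =
     {Poly_Mapping.single (x, vadd V v w) 1
        - Poly_Mapping.single (x, v) 1 - Poly_Mapping.single (x, w) 1 | x v w.
        x \<in> K \<and> v \<in> carrier V \<and> w \<in> carrier V}
   \<union> {Poly_Mapping.single (x, vscale V c v) 1 - Poly_Mapping.single (x, v) c | x c v.
        x \<in> K \<and> v \<in> carrier V}
   \<union> {Poly_Mapping.single (x \<otimes>\<^bsub>G\<^esub> h, v) 1 - Poly_Mapping.single (x, act V h v) 1 | x h v.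
        x \<in> K \<and> h \<in> H \<and> v \<in> carrier V}"

definition induced_rep ::
  "('g, 'm) monoid_scheme \<Rightarrow> 'g set \<Rightarrow> 'g set \<Rightarrow> ('g, 'k::field, 'v) rep
     \<Rightarrow> ('g, 'k, ('g \<times> 'v \<Rightarrow>\<^sub>0 'k) set) rep" where
  "induced_rep G H K V =
     quotient_rep (free_rep (K \<times> carrier V) (\<lambda>g (x, v). (g \<otimes>\<^bsub>G\<^esub> x, v)))
       (free_space.span (induction_relations G H K V))"


section \<open>Hereditary algebras and primitive idempotents\<close>

definition regular_rep ::
  "(('b::{finite, semigroup_mult}, 'k::field) semigroup_algebra, 'k, ('b, 'k) semigroup_algebra) rep" where
  "regular_rep = \<lparr>carrier = UNIV, vadd = (+), vzero = 0, vscale = alg_scale, act = (*)\<rparr>"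

definition left_ideal :: "('b::{finite, semigroup_mult}, 'k::field) semigroup_algebra set \<Rightarrow> bool" where
  "left_ideal L \<longleftrightarrow> alg_space.subspace L \<and> (\<forall>a. \<forall>x\<in>L. a * x \<in> L)"

text \<open>Projective: a direct summand of a free module. Every module is a quotient of the free
  module on its own elements, so free modules on subsets of \<open>'v\<close> suffice.\<close>

definition projective ::
  "(('b::{finite, semigroup_mult}, 'k::field) semigroup_algebra, 'k, 'v) rep \<Rightarrow> bool" where
  "projective P \<longleftrightarrow> (\<exists>I :: 'v set. \<exists>f g.
     f \<in> rep_hom UNIV P (direct_sum I (\<lambda>_. regular_rep)) \<and>
     g \<in> rep_hom UNIV (direct_sum I (\<lambda>_. regular_rep)) P \<and>
     (\<forall>x\<in>carrier P. g (f x) = x))"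

definition hereditary_algebra :: "'b::{finite, semigroup_mult} itself \<Rightarrow> 'k::field itself \<Rightarrow> bool" where
  "hereditary_algebra _ _ \<longleftrightarrow>
     (\<forall>L :: ('b, 'k) semigroup_algebra set. left_ideal L \<longrightarrow> projective (regular_rep\<lparr>carrier := L\<rparr>))"

definition hereditary_lrb :: "'b::left_regular_band itself \<Rightarrow> 'k::field itself \<Rightarrow> bool" where
  "hereditary_lrb B k \<longleftrightarrow> connected_lrb B \<and> hereditary_algebra B k"

definition maximal_left_ideal ::
  "('b::{finite, semigroup_mult}, 'k::field) semigroup_algebra set \<Rightarrow> bool" where
  "maximal_left_ideal M \<longleftrightarrow> left_ideal M \<and> M \<noteq> UNIV \<and>
     (\<forall>L. left_ideal L \<and> M \<subseteq> L \<longrightarrow> L = M \<or> L = UNIV)"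

definition jacobson_radical :: "('b::{finite, semigroup_mult}, 'k::field) semigroup_algebra set" where
  "jacobson_radical = \<Inter>{M. maximal_left_ideal M}"

definition primitive_idempotent ::
  "('b::{finite, semigroup_mult}, 'k::field) semigroup_algebra \<Rightarrow> bool" where
  "primitive_idempotent e \<longleftrightarrow> e \<noteq> 0 \<and> e * e = e \<and>
     \<not> (\<exists>u v. u \<noteq> 0 \<and> v \<noteq> 0 \<and> u * u = u \<and> v * v = v \<and> u * v = 0 \<and> v * u = 0 \<and> e = u + v)"

text \<open>Completeness: the sum is the identity of the algebra. The identity is not a basis
  element in general, so it is described by its defining property.\<close>

definition cfpoi ::
  "'i set \<Rightarrow> ('i \<Rightarrow> ('b::{finite, semigroup_mult}, 'k::field) semigroup_algebra) \<Rightarrow> bool" where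
  "cfpoi I E \<longleftrightarrow> finite I \<and> (\<forall>i\<in>I. primitive_idempotent (E i)) \<and>
     (\<forall>i\<in>I. \<forall>j\<in>I. i \<noteq> j \<longrightarrow> E i * E j = 0) \<and>
     (\<forall>a. (\<Sum>i\<in>I. E i) * a = a \<and> a * (\<Sum>i\<in>I. E i) = a)"

definition simple_rep ::
  "'b set \<Rightarrow> (('b::left_regular_band, 'k::field) semigroup_algebra, 'k, 'k) rep" where
  "simple_rep X = \<lparr>carrier = UNIV, vadd = (+), vzero = 0, vscale = (*),
     act = (\<lambda>a t. (\<Sum>b\<in>UNIV. coeff a b * (if X \<subseteq> supp b then 1 else 0)) * t)\<rparr>"

definition standardly_indexed ::
  "('b set \<Rightarrow> ('b::left_regular_band, 'k::field) semigroup_algebra) \<Rightarrow> bool" where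
  "standardly_indexed E \<longleftrightarrow> (\<forall>X\<in>supports. rep_iso UNIV
     (quotient_rep (regular_rep\<lparr>carrier := {a * E X | a. True}\<rparr>) {r * E X | r. r \<in> jacobson_radical})
     (simple_rep X))"


section \<open>Reduced homology of order complexes\<close>

text \<open>Simplices of the order complex of \<open>P\<close> with \<open>l\<close> vertices, listed increasingly. The empty
  simplex is included, so the boundary of a vertex is the empty simplex, which is the
  augmentation. Dimension \<open>n\<close> corresponds to \<open>l = n + 1\<close>.\<close>

definition order_simplices :: "('p \<Rightarrow> 'p \<Rightarrow> bool) \<Rightarrow> 'p set \<Rightarrow> nat \<Rightarrow> 'p list set" where
  "order_simplices lt P l = {xs. set xs \<subseteq> P \<and> sorted_wrt lt xs \<and> length xs = l}"

definition boundary :: "('p list \<Rightarrow>\<^sub>0 'k::field) \<Rightarrow> ('p list \<Rightarrow>\<^sub>0 'k)" where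
  "boundary f = (\<Sum>xs\<in>Poly_Mapping.keys f. \<Sum>i<length xs.
     Poly_Mapping.single (take i xs @ drop (Suc i) xs) ((- 1) ^ i * Poly_Mapping.lookup f xs))"

definition simplicial_chains ::
  "('p \<Rightarrow> 'p \<Rightarrow> bool) \<Rightarrow> 'p set \<Rightarrow> ('r \<Rightarrow> 'p \<Rightarrow> 'p) \<Rightarrow> nat \<Rightarrow> ('r, 'k::field, 'p list \<Rightarrow>\<^sub>0 'k) rep" where
  "simplicial_chains lt P \<alpha> l = free_rep (order_simplices lt P l) (\<lambda>g. map (\<alpha> g))"

definition reduced_homology ::
  "nat \<Rightarrow> ('p \<Rightarrow> 'p \<Rightarrow> bool) \<Rightarrow> 'p set \<Rightarrow> ('r \<Rightarrow> 'p \<Rightarrow> 'p) \<Rightarrow> ('r, 'k::field, ('p list \<Rightarrow>\<^sub>0 'k) set) rep" where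
  "reduced_homology n lt P \<alpha> =
     (let C = simplicial_chains lt P \<alpha> (n + 1)
      in quotient_rep (C\<lparr>carrier := {f \<in> carrier C. boundary f = 0}\<rparr>)
           (boundary ` carrier (simplicial_chains lt P \<alpha> (n + 2) :: ('r, 'k, _) rep)))"


section \<open>The representations in the decomposition\<close>

definition lrb_action :: "('g, 'm) monoid_scheme \<Rightarrow> ('g \<Rightarrow> 'b::left_regular_band \<Rightarrow> 'b) \<Rightarrow> bool" where
  "lrb_action G \<phi> \<longleftrightarrow> group_action G UNIV \<phi> \<and>
     (\<forall>g\<in>carrier G. \<forall>x y. \<phi> g (x * y) = \<phi> g x * \<phi> g y)"

definition stab :: "('g, 'm) monoid_scheme \<Rightarrow> ('g \<Rightarrow> 'b \<Rightarrow> 'b) \<Rightarrow> 'b set \<Rightarrow> 'g set" where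
  "stab G \<phi> X = stabilizer G (\<lambda>g Z. \<phi> g ` Z) X"

definition invariant_family ::
  "('g, 'm) monoid_scheme \<Rightarrow> ('g \<Rightarrow> 'b \<Rightarrow> 'b) \<Rightarrow>
   ('b set \<Rightarrow> ('b::left_regular_band, 'k::field) semigroup_algebra) \<Rightarrow> bool" where
  "invariant_family G \<phi> E \<longleftrightarrow>
     (\<forall>g\<in>carrier G. \<forall>X\<in>supports. alg_map (\<phi> g) (E X) = E (\<phi> g ` X))"

definition corner_rep ::
  "('g \<Rightarrow> 'b \<Rightarrow> 'b) \<Rightarrow> ('b::left_regular_band, 'k::field) semigroup_algebra \<Rightarrow>
   ('b, 'k) semigroup_algebra \<Rightarrow> ('g, 'k, ('b, 'k) semigroup_algebra) rep" where
  "corner_rep \<phi> e f = \<lparr>carrier = {e * a * f | a. True}, vadd = (+), vzero = 0,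
     vscale = alg_scale, act = (\<lambda>g. alg_map (\<phi> g))\<rparr>"

text \<open>\<open>B\<^sup><\<^sup>b\<close> restricted to supports above \<open>W\<close>, and the zeroth reduced homology of
  its order complex under the twisted action \<open>g \<^bold>* a = b \<cdot> g(a)\<close>.\<close>

definition below_part :: "'b::left_regular_band \<Rightarrow> 'b set \<Rightarrow> 'b set" where
  "below_part b W = {a. lrb_less a b \<and> W \<subseteq> supp a}"

definition H0_rep ::
  "('g \<Rightarrow> 'b \<Rightarrow> 'b) \<Rightarrow> 'b::left_regular_band \<Rightarrow> 'b set \<Rightarrow> ('g, 'k::field, ('b list \<Rightarrow>\<^sub>0 'k) set) rep" where
  "H0_rep \<phi> b W = reduced_homology 0 lrb_less (below_part b W) (\<lambda>g a. b * \<phi> g a)"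

definition support_chains ::
  "'b::left_regular_band set \<Rightarrow> 'b set \<Rightarrow> nat \<Rightarrow> 'b set list set" where
  "support_chains X Y m = {c. length c = m + 1 \<and> set c \<subseteq> supports \<and> sorted_wrt (\<subset>) c \<and>
     hd c = X \<and> last c = Y}"

definition chain_orbits ::
  "('g, 'm) monoid_scheme \<Rightarrow> ('g \<Rightarrow> 'b \<Rightarrow> 'b) \<Rightarrow> 'b::left_regular_band set \<Rightarrow> 'b set \<Rightarrow> nat
     \<Rightarrow> 'b set list set set" where
  "chain_orbits G \<phi> X Y m =
     orbits (G\<lparr>carrier := stab G \<phi> X \<inter> stab G \<phi> Y\<rparr>) (support_chains X Y m)
       (\<lambda>g. map (\<lambda>Z. \<phi> g ` Z))"

definition chain_tensor ::
  "('g \<Rightarrow> 'b \<Rightarrow> 'b) \<Rightarrow> ('b set \<Rightarrow> 'b::left_regular_band) \<Rightarrow> 'b set list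
     \<Rightarrow> ('g, 'k::field, (('b list \<Rightarrow>\<^sub>0 'k) set list \<Rightarrow>\<^sub>0 'k) set) rep" where
  "chain_tensor \<phi> bz c =
     tensor_rep (map (\<lambda>i. H0_rep \<phi> (bz (c ! i)) (c ! (i - 1))) [1..<length c])"

definition chain_induced ::
  "('g, 'm) monoid_scheme \<Rightarrow> ('g \<Rightarrow> 'b \<Rightarrow> 'b) \<Rightarrow> ('b set \<Rightarrow> 'b::left_regular_band) \<Rightarrow>
   'b set \<Rightarrow> 'b set \<Rightarrow> 'b set list
     \<Rightarrow> ('g, 'k::field, ('g \<times> (('b list \<Rightarrow>\<^sub>0 'k) set list \<Rightarrow>\<^sub>0 'k) set \<Rightarrow>\<^sub>0 'k) set) rep" where
  "chain_induced G \<phi> bz X Y c =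
     induced_rep G (\<Inter>Z\<in>set c. stab G \<phi> Z) (stab G \<phi> X \<inter> stab G \<phi> Y) (chain_tensor \<phi> bz c)"

end

theory Submission
  imports Defs
begin

text \<open>
  Let \<open>A = kB\<close>, let \<open>C(Y,X) = E\<^sub>Y A E\<^sub>X\<close>, and let \<open>D(Y,X)\<close> be the span of the products
  \<open>C(Y,Z) C(Z,X)\<close> with \<open>X < Z < Y\<close>. Since \<open>A E\<^sub>X = (k L\<^sub>X) E\<^sub>X\<close> for the set \<open>L\<^sub>X\<close> of elements of
  support \<open>X\<close>, the map \<open>f E\<^sub>X \<mapsto> [b f]\<close>, where \<open>b\<close> has support \<open>Y\<close>, is defined on \<open>C(Y,X)\<close>; it
  induces an equivariant isomorphism of \<open>C(Y,X) / D(Y,X)\<close> with the reduced zeroth homology of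
  \<open>{a < b. \<sigma>(a) \<ge> X}\<close>. By Maschke's theorem this quotient lifts to an equivariant complement of
  \<open>D(Y,X)\<close>. Multiplying lifts along chains gives a homomorphism from the right-hand side to
  \<open>C(Y,X)\<close>, which is surjective because replacing a factor by its lift changes a product only
  by products along longer chains.

  If \<open>A\<close> is hereditary, the radical of \<open>A E\<^sub>X\<close> is projective, hence freely generated by a basis
  of the complements of the \<open>D(Z,X)\<close>. This bounds \<open>dim C(Y,X)\<close> from below by the number of
  paths, that is, by the size of a spanning set of the right-hand side; so the homomorphism
  is also injective.
\<close>

section \<open>Supports\<close>

text \<open>Dimensions of tensor products and of induced representations are never computed. For
  each summand on the right only a spanning set is built, from arrows along the representative chain
  and coset representatives of the chain stabilizer. Taken over all orbits, the images of these
  elements span \<open>C(Y,X)\<close>, and there are at most as many indices as the dimension of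
  \<open>C(Y,X)\<close>. So the images form a basis, and the coefficients of an element on the right
  can be read off from its image; that is injectivity.

  The shape of the argument comes from a conflict between equivariance and counting. The count uses
  one finite set of arrows for every pair of supports, chosen without regard to the group. The
  homomorphism uses the arrows along one chain of each orbit and moves their products by the group,
  and moved arrows are in general not the arrows chosen for the moved pair. Hence the spanning
  statement allows separate complements for every chain, and the count needs that the number of
  arrows does not drop when a pair is moved.\<close>

lemma self_in_supp [simp]: "b \<in> supp b"
  for b :: "'b::left_regular_band"
  unfolding supp_def using lrb_idem[of b, symmetric] by blast

lemma supp_in_supports [simp]: "supp b \<in> supports"
  by (simp add: supports_def)

lemma supports_obtain:
  assumes "X \<in> supports" obtains b where "supp b = X"
  using assms by (auto simp: supports_def)

lemma supp_subset_iff: "supp a \<subseteq> supp b \<longleftrightarrow> a * b = a"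
  for a b :: "'b::left_regular_band"
proof
  assume "supp a \<subseteq> supp b"
  then have "a \<in> supp b" by auto
  then obtain c where "a = c * b" by (auto simp: supp_def)
  then show "a * b = a" by (simp add: mult.assoc lrb_idem)
next
  assume "a * b = a"
  then show "supp a \<subseteq> supp b"
    unfolding supp_def by (smt (verit) Collect_mono mult.assoc)
qed

text \<open>An element that absorbs \<open>a\<close> and \<open>b\<close> on the right absorbs
  \<open>a * b\<close>. Meets of the support semilattice are thus literal intersections, and every
  support condition on a product becomes set algebra.\<close>

lemma supp_mult: "supp (a * b) = supp a \<inter> supp b"
  for a b :: "'b::left_regular_band"
proof
  have "supp (a * b) \<subseteq> supp a"
    by (simp add: supp_subset_iff lrb_regular)
  moreover have "supp (a * b) \<subseteq> supp b"
    by (simp add: supp_subset_iff mult.assoc lrb_idem)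
  ultimately show "supp (a * b) \<subseteq> supp a \<inter> supp b" by blast
next
  show "supp a \<inter> supp b \<subseteq> supp (a * b)"
  proof
    fix x assume "x \<in> supp a \<inter> supp b"
    then have "\<exists>c. x = c * a" "\<exists>d. x = d * b" by (auto simp: supp_def)
    then have "x * a = x" "x * b = x" by (metis lrb_idem mult.assoc)+
    then have "x = x * (a * b)" by (simp flip: mult.assoc)
    then show "x \<in> supp (a * b)" unfolding supp_def by blast
  qed
qed

lemma mult_absorb: "supp a \<subseteq> supp b \<Longrightarrow> a * b = a"
  for a b :: "'b::left_regular_band"
  by (simp add: supp_subset_iff)

text \<open>With equal supports, absorption would give \<open>b * a = b\<close> and hence
  \<open>a = b\<close>. Supports therefore detect strictness in the semigroup order.\<close>

lemma lrb_less_supp: "lrb_less a b \<Longrightarrow> supp a \<subset> supp b"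
  unfolding lrb_less_def lrb_le_def
  by (metis inf.orderI inf_commute order_less_le supp_mult supp_subset_iff)


section \<open>The semigroup algebra\<close>

definition delta :: "'b \<Rightarrow> ('b, 'k::field) semigroup_algebra" where
  "delta b = of_coeff (\<lambda>x. if x = b then 1 else 0)"

lemma coeff_0 [simp]: "coeff 0 b = 0"
  and coeff_add [simp]: "coeff (x + y) b = coeff x b + coeff y b"
  and coeff_diff [simp]: "coeff (x - y) b = coeff x b - coeff y b"
  for x y :: "('b::{finite, semigroup_mult}, 'k::field) semigroup_algebra"
  by (simp_all add: zero_semigroup_algebra_def plus_semigroup_algebra_def
      minus_semigroup_algebra_def uminus_semigroup_algebra_def)

lemma coeff_sum [simp]: "coeff (\<Sum>i\<in>I. f i) b = (\<Sum>i\<in>I. coeff (f i) b)"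
  for f :: "'i \<Rightarrow> ('b::{finite, semigroup_mult}, 'k::field) semigroup_algebra"
  by (induction I rule: infinite_finite_induct) auto

lemma coeff_scale [simp]: "coeff (alg_scale c x) b = c * coeff x b"
  by (simp add: alg_scale_def)

lemma coeff_delta [simp]: "coeff (delta b) x = (if x = b then 1 else 0)"
  by (simp add: delta_def)

lemma coeff_mult:
  "coeff (x * y) c = (\<Sum>a\<in>UNIV. \<Sum>b\<in>UNIV. if a * b = c then coeff x a * coeff y b else 0)"
  for x y :: "('b::{finite, semigroup_mult}, 'k::field) semigroup_algebra"
proof -
  have "coeff (x * y) c = (\<Sum>p | fst p * snd p = c. coeff x (fst p) * coeff y (snd p))"
    by (simp add: times_semigroup_algebra_def case_prod_unfold)
  also have "\<dots> = (\<Sum>p\<in>UNIV. if fst p * snd p = c then coeff x (fst p) * coeff y (snd p) else 0)"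
    by (simp add: sum.If_cases)
  also have "\<dots> = (\<Sum>p\<in>UNIV \<times> UNIV. case p of (a, b) \<Rightarrow>
      if a * b = c then coeff x a * coeff y b else 0)"
    by (simp add: case_prod_unfold)
  finally show ?thesis
    by (simp only: sum.cartesian_product)
qed

lemma delta_mult: "delta a * delta b = delta (a * b)"
  for a b :: "'b::{finite, semigroup_mult}"
proof (rule semigroup_algebra_eqI)
  fix c
  have "coeff (delta a * delta b :: ('b, 'k::field) semigroup_algebra) c
      = (\<Sum>x\<in>UNIV. \<Sum>y\<in>UNIV. if y = b then (if x = a then (if a * b = c then 1 else 0) else 0) else 0)"
    unfolding coeff_mult by (intro sum.cong refl) auto
  also have "\<dots> = coeff (delta (a * b)) c"
    by simp
  finally show "coeff (delta a * delta b :: ('b, 'k::field) semigroup_algebra) c = coeff (delta (a * b)) c" .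
qed

lemma scale_mult_left [simp]: "alg_scale c x * y = alg_scale c (x * y)"
  and scale_mult_right [simp]: "x * alg_scale c y = alg_scale c (x * y)"
  for x y :: "('b::{finite, semigroup_mult}, 'k::field) semigroup_algebra"
  by (rule semigroup_algebra_eqI, simp add: coeff_mult sum_distrib_left ac_simps if_distrib
      cong: if_cong sum.cong)+

lemma alg_expand: "x = (\<Sum>b\<in>UNIV. alg_scale (coeff x b) (delta b))"
  for x :: "('b::{finite, semigroup_mult}, 'k::field) semigroup_algebra"
proof (rule semigroup_algebra_eqI)
  fix c
  have "(\<Sum>b\<in>UNIV. coeff x b * (if c = b then 1 else 0)) = (\<Sum>b\<in>UNIV. if c = b then coeff x b else 0)"
    by (intro sum.cong) auto
  then show "coeff x c = coeff (\<Sum>b\<in>UNIV. alg_scale (coeff x b) (delta b)) c"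
    by simp
qed

text \<open>The last case keeps the information that \<open>b\<close> occurs in \<open>x\<close>.
  Restrictions on the supports of the elements of \<open>x\<close> thereby reach the basis elements;
  \<open>alg_linear_eqI\<close> inherits this.\<close>

lemma alg_induct [case_names zero add delta]:
  fixes x :: "('b::{finite, semigroup_mult}, 'k::field) semigroup_algebra"
  assumes "P 0" and "\<And>x y. P x \<Longrightarrow> P y \<Longrightarrow> P (x + y)"
    and "\<And>c b. coeff x b \<noteq> 0 \<Longrightarrow> P (alg_scale c (delta b))"
  shows "P x"
proof -
  have "P (alg_scale (coeff x b) (delta b))" for b
    by (cases "coeff x b = 0") (use assms in auto)
  then have "P (\<Sum>b\<in>I. alg_scale (coeff x b) (delta b))" for I
    by (induction I rule: infinite_finite_induct) (auto intro: assms)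
  then show ?thesis using alg_expand[of x] by metis
qed

text \<open>Finite dimension carries two steps: an injective endomorphism is surjective in
  \<open>ex_level_mult_E\<close>, and spanning by few vectors gives a basis in
  \<open>spanning_family_independent\<close>.\<close>

interpretation alg_fd: finite_dimensional_vector_space
  "alg_scale :: 'k::field \<Rightarrow> ('b::{finite, semigroup_mult}, 'k) semigroup_algebra \<Rightarrow> ('b, 'k) semigroup_algebra"
  "range delta"
proof unfold_locales
  let ?D = "range delta :: ('b, 'k) semigroup_algebra set"
  show "finite ?D" by simp
  have inj: "inj (delta :: 'b \<Rightarrow> ('b, 'k) semigroup_algebra)"
    by (rule injI) (metis coeff_delta zero_neq_one)
  show "alg_space.independent ?D"
  proof
    assume "alg_space.dependent ?D"
    then obtain u :: "('b, 'k) semigroup_algebra \<Rightarrow> 'k" where u: "\<exists>v\<in>?D. u v \<noteq> 0"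
      "(\<Sum>v\<in>?D. alg_scale (u v) v) = 0"
      by (auto simp: alg_space.dependent_finite)
    from u(2) have "(\<Sum>b\<in>UNIV. alg_scale (u (delta b)) (delta b :: ('b, 'k) semigroup_algebra)) = 0"
      by (subst (asm) sum.reindex[OF inj]) simp
    then have "coeff (\<Sum>b\<in>UNIV. alg_scale (u (delta b)) (delta b :: ('b, 'k) semigroup_algebra)) c = 0" for c
      by simp
    moreover have "coeff (\<Sum>b\<in>UNIV. alg_scale (u (delta b)) (delta b :: ('b, 'k) semigroup_algebra)) c = u (delta c)" for c
    proof -
      have "(\<Sum>b\<in>UNIV. u (delta b) * (if c = b then 1 else 0)) = (\<Sum>b\<in>UNIV. if c = b then u (delta b) else 0)"
        by (intro sum.cong) auto
      then show ?thesis by simp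
    qed
    ultimately show False using u(1) by auto
  qed
  show "module.span alg_scale ?D = UNIV"
  proof (rule UNIV_eq_I[symmetric])
    fix x :: "('b, 'k) semigroup_algebra"
    show "x \<in> alg_space.span ?D"
      by (induction x rule: alg_induct)
        (auto intro: alg_space.span_zero alg_space.span_add alg_space.span_scale alg_space.span_base)
  qed
qed

section \<open>Linear maps of the semigroup algebra\<close>

definition alg_linear :: "(('b::{finite, semigroup_mult}, 'k::field) semigroup_algebra
    \<Rightarrow> ('c::{finite, semigroup_mult}, 'k) semigroup_algebra) \<Rightarrow> bool"
  where "alg_linear f \<longleftrightarrow> (\<forall>x y. f (x + y) = f x + f y) \<and> (\<forall>c x. f (alg_scale c x) = alg_scale c (f x))"

lemma alg_linearI [intro?]:
  "(\<And>x y. f (x + y) = f x + f y) \<Longrightarrow> (\<And>c x. f (alg_scale c x) = alg_scale c (f x)) \<Longrightarrow> alg_linear f"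
  by (auto simp: alg_linear_def)

lemma alg_linear_iff:
  fixes f :: "('a::{finite, semigroup_mult}, 'c::field) semigroup_algebra
    \<Rightarrow> ('b::{finite, semigroup_mult}, 'c) semigroup_algebra"
  shows "alg_linear f \<longleftrightarrow> Vector_Spaces.linear alg_scale alg_scale f"
  unfolding Vector_Spaces.linear_iff alg_linear_def
  by (auto intro: alg_space.vector_space_axioms)

lemma alg_linear_add: "alg_linear f \<Longrightarrow> f (x + y) = f x + f y"
  and alg_linear_scale: "alg_linear f \<Longrightarrow> f (alg_scale c x) = alg_scale c (f x)"
  by (auto simp: alg_linear_def)

lemma alg_linear_0: "alg_linear f \<Longrightarrow> f 0 = 0"
  by (metis add_cancel_right_right alg_linear_add)

lemma alg_linear_diff: "alg_linear f \<Longrightarrow> f (x - y) = f x - f y"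
  by (metis add_diff_cancel alg_linear_add diff_add_cancel)

lemma alg_linear_sum: "alg_linear f \<Longrightarrow> f (\<Sum>i\<in>I. g i) = (\<Sum>i\<in>I. f (g i))"
  by (induction I rule: infinite_finite_induct) (auto simp: alg_linear_add alg_linear_0)

lemma alg_linear_eqI:
  assumes "alg_linear f" "alg_linear g" "\<And>b. coeff x b \<noteq> 0 \<Longrightarrow> f (delta b) = g (delta b)"
  shows "f x = g x"
  by (induction x rule: alg_induct)
    (use assms in \<open>auto simp: alg_linear_0 alg_linear_add alg_linear_scale\<close>)

lemma alg_linear_span_subset:
  assumes "alg_linear f" "alg_space.subspace U" "\<And>x. x \<in> S \<Longrightarrow> f x \<in> U" "x \<in> alg_space.span S"
  shows "f x \<in> U"
  using assms(4)
proof (induction rule: alg_space.span_induct_alt)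
  case base
  then show ?case using assms by (simp add: alg_linear_0 alg_space.subspace_0)
next
  case (step c x y)
  then show ?case
    using assms by (simp add: alg_linear_add alg_linear_scale alg_space.subspace_add alg_space.subspace_scale)
qed

lemma alg_linear_mult_left: "alg_linear ((*) a)"
  and alg_linear_mult_right: "alg_linear (\<lambda>x. x * a)"
  by (rule alg_linearI; simp add: distrib_left distrib_right)+

lemma alg_linear_compose: "alg_linear f \<Longrightarrow> alg_linear g \<Longrightarrow> alg_linear (\<lambda>x. f (g x))"
  by (simp add: alg_linear_def)

lemma alg_linear_sum_fun: "(\<And>i. i \<in> I \<Longrightarrow> alg_linear (f i)) \<Longrightarrow> alg_linear (\<lambda>x. \<Sum>i\<in>I. f i x)"
  unfolding alg_linear_def by (simp add: sum.distrib alg_space.scale_sum_right)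

lemma alg_linear_id: "alg_linear (\<lambda>x. x)"
  by (simp add: alg_linear_def)

lemma linear_range_subspace: "alg_linear f \<Longrightarrow> alg_space.subspace U \<Longrightarrow> alg_space.subspace (f ` U)"
  unfolding alg_linear_iff by (rule module_hom.subspace_image) (simp_all add: module_hom_iff_linear)

section \<open>Maps of the algebra induced by maps of the semigroup\<close>

lemma coeff_alg_map: "coeff (alg_map h x) b = (\<Sum>a\<in>UNIV. if h a = b then coeff x a else 0)"
  for x :: "('b::finite, 'k::field) semigroup_algebra"
  by (simp add: alg_map_def sum.If_cases)

lemma alg_linear_alg_map: "alg_linear (alg_map h)"
  for h :: "'b::{finite, semigroup_mult} \<Rightarrow> 'b"
  by (rule alg_linearI; rule semigroup_algebra_eqI)
    (auto simp: coeff_alg_map sum_distrib_left simp flip: sum.distrib intro!: sum.cong)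

lemma alg_map_delta [simp]: "alg_map h (delta b) = delta (h b)"
  for b :: "'b::{finite, semigroup_mult}"
proof (rule semigroup_algebra_eqI)
  fix c
  have "coeff (alg_map h (delta b :: ('b, 'k::field) semigroup_algebra)) c
     = (\<Sum>a\<in>UNIV. if a = b then (if h b = c then 1 else 0) else 0)"
    unfolding coeff_alg_map by (intro sum.cong) auto
  then show "coeff (alg_map h (delta b :: ('b, 'k::field) semigroup_algebra)) c = coeff (delta (h b)) c"
    by (simp add: eq_commute)
qed

lemma alg_map_mult:
  fixes x y :: "('b::{finite, semigroup_mult}, 'k::field) semigroup_algebra"
  assumes "\<And>a b. h (a * b) = h a * h b"
  shows "alg_map h (x * y) = alg_map h x * alg_map h y"
proof (rule alg_linear_eqI[where x = x])
  show "alg_linear (\<lambda>x. alg_map h (x * y))"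
    by (rule alg_linear_compose[OF alg_linear_alg_map alg_linear_mult_right])
  show "alg_linear (\<lambda>x. alg_map h x * alg_map h y)"
    by (rule alg_linear_compose[OF alg_linear_mult_right alg_linear_alg_map])
  fix a
  show "alg_map h (delta a * y) = alg_map h (delta a) * alg_map h y"
  proof (rule alg_linear_eqI[where x = y])
    show "alg_linear (\<lambda>y. alg_map h (delta a * y))"
      by (rule alg_linear_compose[OF alg_linear_alg_map alg_linear_mult_left])
    show "alg_linear (\<lambda>y. alg_map h (delta a) * alg_map h y)"
      by (rule alg_linear_compose[OF alg_linear_mult_left alg_linear_alg_map])
  qed (simp add: delta_mult assms)
qed

lemma alg_map_comp:
  fixes x :: "('b::{finite, semigroup_mult}, 'k::field) semigroup_algebra"
  shows "alg_map f (alg_map h x) = alg_map (\<lambda>b. f (h b)) x"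
  by (rule alg_linear_eqI[where x = x]) (auto intro: alg_linear_compose alg_linear_alg_map)

lemma alg_map_id:
  fixes x :: "('b::{finite, semigroup_mult}, 'k::field) semigroup_algebra"
  shows "alg_map (\<lambda>b. b) x = x"
  by (rule alg_linear_eqI[where x = x]) (auto intro: alg_linear_alg_map alg_linear_id)


section \<open>The characters\<close>

text \<open>The character through which the algebra acts on the one-dimensional simple module of
  \<open>X\<close>, as in \<open>simple_rep\<close>.\<close>

definition chi :: "'b set \<Rightarrow> ('b::left_regular_band, 'k::field) semigroup_algebra \<Rightarrow> 'k" where
  "chi X a = (\<Sum>b\<in>UNIV. coeff a b * (if X \<subseteq> supp b then 1 else 0))"

lemma chi_add [simp]: "chi X (a + b) = chi X a + chi X b"
  by (simp add: chi_def distrib_right sum.distrib)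

lemma chi_scale [simp]: "chi X (alg_scale c a) = c * chi X a"
  by (simp add: chi_def sum_distrib_left mult.assoc)

lemma chi_0 [simp]: "chi X 0 = 0"
  by (simp add: chi_def)

lemma chi_diff [simp]: "chi X (a - b) = chi X a - chi X b"
  by (simp add: chi_def left_diff_distrib sum_subtractf)

lemma chi_delta [simp]: "chi X (delta b) = (if X \<subseteq> supp b then 1 else 0)"
proof -
  have "chi X (delta b :: ('b, 'k::field) semigroup_algebra) = (\<Sum>x\<in>UNIV. if x = b then (if X \<subseteq> supp b then 1 else 0) else 0)"
    unfolding chi_def by (intro sum.cong) auto
  then show ?thesis by simp
qed

lemma chi_sum [simp]: "chi X (\<Sum>i\<in>I. f i) = (\<Sum>i\<in>I. chi X (f i))"
  by (induction I rule: infinite_finite_induct) auto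

text \<open>By \<open>supp_mult\<close>, the support of a product contains \<open>X\<close> exactly
  when the supports of both factors do.\<close>

lemma chi_mult [simp]: "chi X (a * b) = chi X a * chi X b"
proof (induction a rule: alg_induct)
  case (delta c p)
  have "chi X (delta p * b) = chi X (delta p) * chi X b"
    by (induction b rule: alg_induct) (auto simp: distrib_left delta_mult supp_mult)
  then show ?case by (simp add: mult.assoc)
qed (auto simp: distrib_right)

text \<open>The projection to \<open>k L\<^sub>X\<close>, the space on which
  \<open>A E\<^sub>X\<close> is modelled.\<close>

definition level :: "'b set \<Rightarrow> ('b::left_regular_band, 'k::field) semigroup_algebra \<Rightarrow> ('b, 'k) semigroup_algebra" where
  "level X a = of_coeff (\<lambda>b. if supp b = X then coeff a b else 0)"

lemma coeff_level [simp]: "coeff (level X a) b = (if supp b = X then coeff a b else 0)"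
  by (simp add: level_def)

lemma alg_linear_level: "alg_linear (level X)"
  by (rule alg_linearI; rule semigroup_algebra_eqI) auto

lemma level_delta: "level X (delta b) = (if supp b = X then delta b else 0)"
  by (rule semigroup_algebra_eqI) auto

lemma level_level [simp]: "level X (level X a) = level X a"
  by (rule semigroup_algebra_eqI) auto

lemma level_supp: "level X f = f \<Longrightarrow> coeff f b \<noteq> 0 \<Longrightarrow> supp b = X"
  by (metis coeff_level)

lemma sum_level: "(\<Sum>X\<in>supports. level X a) = a"
proof (rule semigroup_algebra_eqI)
  fix b
  have "(\<Sum>X\<in>supports. if supp b = X then coeff a b else 0) = coeff a b"
    by (subst sum.delta') auto
  then show "coeff (\<Sum>X\<in>supports. level X a) b = coeff a b" by simp
qed

text \<open>For \<open>p\<close> and \<open>l\<close> of support \<open>X\<close>, the product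
  \<open>p * b * l\<close> is \<open>p\<close> if the support of \<open>b\<close> contains
  \<open>X\<close>, and otherwise its support is properly inside \<open>X\<close>. With
  \<open>E X\<close> for \<open>a\<close> this recovers \<open>f\<close> from
  \<open>f * E X\<close>.\<close>

lemma level_sandwich:
  assumes "level X f = f" and "supp l = X"
  shows "level X (f * a * delta l) = alg_scale (chi X a) f"
proof (rule alg_linear_eqI[where x = f])
  show "alg_linear (\<lambda>f. level X (f * a * delta l))"
    by (intro alg_linear_compose[OF alg_linear_level] alg_linear_compose[OF alg_linear_mult_right]
        alg_linear_mult_right)
  show "alg_linear (alg_scale (chi X a) :: ('a, 'b) semigroup_algebra \<Rightarrow> _)"
    by (rule alg_linearI) (simp_all add: alg_space.scale_right_distrib alg_space.scale_left_commute)
  fix p assume "coeff f p \<noteq> 0"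
  then have p: "supp p = X" using assms level_supp by blast
  show "level X (delta p * a * delta l) = alg_scale (chi X a) (delta p)"
  proof (induction a rule: alg_induct)
    case (delta c b)
    show ?case
    proof (cases "X \<subseteq> supp b")
      case True
      then have "p * b * l = p" using p assms by (simp add: mult_absorb)
      then show ?thesis using p True by (simp add: delta_mult alg_linear_scale[OF alg_linear_level] level_delta)
    next
      case False
      then have "supp (p * b * l) \<noteq> X" using p assms by (auto simp: supp_mult)
      then show ?thesis using p False by (simp add: delta_mult alg_linear_scale[OF alg_linear_level] level_delta)
    qed
  qed (auto simp: alg_linear_0[OF alg_linear_level] distrib_left distrib_right
      alg_linear_add[OF alg_linear_level] alg_space.scale_left_distrib)
qed

text \<open>Let \<open>W\<close> be maximal among the supports above \<open>X\<close> of elements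
  occurring in \<open>e\<close>. If \<open>b\<close> of support \<open>W\<close> is a product of two
  occurring elements, both have supports containing \<open>W\<close>, so the left one has support
  \<open>W\<close> by maximality and then equals \<open>b\<close>. Hence the coefficient of
  \<open>e * e\<close> at \<open>b\<close> is that of \<open>e\<close> times \<open>chi W e\<close>,
  which is zero, against idempotence.\<close>

lemma coeff_idempotent_low:
  fixes e :: "('b::left_regular_band, 'k::field) semigroup_algebra"
  assumes idem: "e * e = e" and chi: "\<And>Z. Z \<in> supports \<Longrightarrow> X \<subseteq> Z \<Longrightarrow> chi Z e = 0"
    and "coeff e c \<noteq> 0"
  shows "\<not> X \<subseteq> supp c"
proof
  assume "X \<subseteq> supp c"
  define S where "S = {supp b | b. coeff e b \<noteq> 0 \<and> X \<subseteq> supp b}"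
  have "finite S" "S \<noteq> {}"
    unfolding S_def using \<open>X \<subseteq> supp c\<close> assms(3) by auto
  then obtain W where W: "W \<in> S" "\<And>V. V \<in> S \<Longrightarrow> W \<subseteq> V \<Longrightarrow> W = V"
    by (metis finite_has_maximal)
  then obtain b where b: "supp b = W" "coeff e b \<noteq> 0" "X \<subseteq> W" by (auto simp: S_def)
  have summand: "(if a * d = b then coeff e a * coeff e d else 0)
      = (if a = b then (coeff e b * (coeff e d * (if W \<subseteq> supp d then 1 else 0))) else 0)" for a d
  proof (cases "coeff e a = 0 \<or> coeff e d = 0")
    case True
    then show ?thesis by auto
  next
    case False
    show ?thesis
    proof (cases "a * d = b")
      case True
      then have "W = supp a \<inter> supp d" using b by (auto simp: supp_mult)
      moreover from this have "supp a \<in> S" "supp d \<in> S" using False b by (auto simp: S_def)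
      ultimately have "W = supp a" "W \<subseteq> supp d" using W(2) by auto
      then have "a = b" using True mult_absorb by metis
      with True \<open>W \<subseteq> supp d\<close> show ?thesis by simp
    next
      case False
      moreover have "a * d = b" if "a = b" "W \<subseteq> supp d" using that b mult_absorb by metis
      ultimately show ?thesis by auto
    qed
  qed
  have "coeff (e * e) b = coeff e b * chi W e"
    unfolding coeff_mult summand chi_def
    by (subst sum.swap) (simp add: sum_distrib_left)
  also have "\<dots> = 0" using chi[of W] b by auto
  finally show False using idem b by simp
qed

lemma alg_linear_zero: "alg_linear (\<lambda>_. 0)"
  by (simp add: alg_linear_def)

lemma level_mult_low:
  assumes "\<not> X \<subseteq> supp w"
  shows "level X (delta w * a) = 0"
proof (rule alg_linear_eqI[where x = a])
  show "alg_linear (\<lambda>a. level X (delta w * a))"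
    by (rule alg_linear_compose[OF alg_linear_level alg_linear_mult_left])
qed (use assms in \<open>auto simp: delta_mult level_delta supp_mult alg_linear_zero\<close>)

section \<open>Idempotents dual to the characters\<close>

text \<open>\<open>chi_E\<close> restates the standard indexing, which speaks of quotients of the
  modules \<open>A E\<^sub>X\<close>, as duality with the characters;
  \<open>standard_idempotents_cfpoi\<close> makes the passage.\<close>

locale standard_idempotents =
  fixes E :: "'b::left_regular_band set \<Rightarrow> ('b, 'k::field) semigroup_algebra"
  assumes orth: "\<And>X Y. X \<in> supports \<Longrightarrow> Y \<in> supports \<Longrightarrow> E X * E Y = (if X = Y then E X else 0)"
    and sum_E_left: "\<And>a. (\<Sum>X\<in>supports. E X) * a = a"
    and sum_E_right: "\<And>a. a * (\<Sum>X\<in>supports. E X) = a"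
    and chi_E: "\<And>X Y. X \<in> supports \<Longrightarrow> Y \<in> supports \<Longrightarrow> chi X (E Y) = (if X = Y then 1 else 0)"
begin

lemma E_idem: "X \<in> supports \<Longrightarrow> E X * E X = E X"
  by (simp add: orth)

lemma E_nonzero: "X \<in> supports \<Longrightarrow> E X \<noteq> 0"
  using chi_E[of X X] by auto

lemma expand_left: "a = (\<Sum>X\<in>supports. E X * a)"
  using sum_E_left[of a] by (simp add: sum_distrib_right)

text \<open>By \<open>level_sandwich\<close>, an element of support \<open>X\<close> on the right
  followed by \<open>level X\<close> recovers \<open>f\<close> from \<open>f * E X\<close>.\<close>

lemma level_mult_E_zero:
  assumes "X \<in> supports" "level X f = f" "f * E X = 0"
  shows "f = 0"
proof -
  obtain l where "supp l = X" using assms supports_obtain by blast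
  then have "alg_scale (chi X (E X)) f = level X (f * E X * delta l)"
    using level_sandwich assms by metis
  then show ?thesis using assms by (simp add: chi_E alg_linear_0[OF alg_linear_level])
qed

text \<open>The endomorphism \<open>T\<close> multiplies the level \<open>Z\<close> part of its
  argument by \<open>E Z\<close>, for all \<open>Z\<close> at once. Orthogonality separates the
  summands and each is injective on its level, so \<open>T\<close> is injective, hence surjective by
  finite dimension. Multiplying \<open>a * E X = T g\<close> by \<open>E X\<close> leaves only level
  \<open>X\<close>.\<close>

lemma ex_level_mult_E:
  assumes "X \<in> supports"
  obtains f where "level X f = f" "a * E X = f * E X"
proof -
  define T where "T a = (\<Sum>Z\<in>supports. level Z a * E Z)" for a
  have lin: "alg_linear T"
    unfolding T_def
    by (intro alg_linear_sum_fun alg_linear_compose[OF alg_linear_mult_right] alg_linear_level)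
  have T_E: "T a * E Z = level Z a * E Z" if "Z \<in> supports" for a Z
  proof -
    have "T a * E Z = (\<Sum>W\<in>supports. if W = Z then level Z a * E Z else 0)"
      unfolding T_def sum_distrib_right using that
      by (intro sum.cong) (auto simp: mult.assoc orth)
    then show ?thesis using that by simp
  qed
  have "inj T"
  proof (rule injI)
    fix x y assume "T x = T y"
    then have T0: "T (x - y) = 0" by (simp add: alg_linear_diff[OF lin])
    have "level Z (x - y) = 0" if "Z \<in> supports" for Z
    proof (rule level_mult_E_zero[OF that level_level])
      show "level Z (x - y) * E Z = 0"
        unfolding T_E[OF that, symmetric] T0 by simp
    qed
    then have "(\<Sum>Z\<in>supports. level Z (x - y)) = 0" by (rule sum.neutral[OF ballI])
    then have "x - y = 0" by (simp only: sum_level)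
    then show "x = y" by simp
  qed
  then have "surj T"
    using alg_fd.linear_inj_imp_surj lin by (auto simp: alg_linear_iff)
  then obtain g where g: "a * E X = T g" by (metis surjD)
  have "a * E X = a * E X * E X" using assms by (simp add: mult.assoc E_idem)
  also have "\<dots> = level X g * E X" using g T_E assms by simp
  finally show ?thesis using that[of "level X g"] by simp
qed

text \<open>Write the product as \<open>f * E X\<close> with \<open>f\<close> in level
  \<open>X\<close>. Sandwiching recovers \<open>f\<close> as the level \<open>X\<close> part of a
  product that starts with \<open>w\<close>; all supports in it are inside that of \<open>w\<close>,
  so it never reaches level \<open>X\<close>.\<close>

lemma delta_mult_E_zero:
  assumes "X \<in> supports" "\<not> X \<subseteq> supp w"
  shows "delta w * E X = 0"
proof -
  obtain f where f: "level X f = f" "delta w * E X = f * E X"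
    using ex_level_mult_E[OF assms(1)] by metis
  obtain l where l: "supp l = X" using assms supports_obtain by blast
  have "f = level X (f * E X * delta l)"
    using level_sandwich[OF f(1) l, of "E X"] assms(1) by (simp add: chi_E)
  also have "\<dots> = level X (delta w * (E X * delta l))" by (simp only: f(2)[symmetric] mult.assoc)
  also have "\<dots> = 0" by (rule level_mult_low[OF assms(2)])
  finally show ?thesis using f by simp
qed

text \<open>If the support of \<open>b\<close> were not inside \<open>Y\<close>, no support above it
  could be \<open>Y\<close>, so all characters in \<open>coeff_idempotent_low\<close> would vanish
  on \<open>E Y\<close>.\<close>

lemma coeff_E_low:
  assumes "Y \<in> supports" "coeff (E Y) b \<noteq> 0"
  shows "supp b \<subseteq> Y"
proof (rule ccontr)
  assume "\<not> supp b \<subseteq> Y"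
  then have "\<not> supp b \<subseteq> supp b"
    using assms by (intro coeff_idempotent_low[of "E Y"]) (auto simp: E_idem chi_E)
  then show False by simp
qed

text \<open>All elements occurring in \<open>E Y * a\<close> have support inside \<open>Y\<close>,
  and such an element annihilates \<open>E X\<close> unless its support contains
  \<open>X\<close>.\<close>

lemma E_mult_E_zero:
  assumes "X \<in> supports" "Y \<in> supports" "\<not> X \<subseteq> Y"
  shows "E Y * a * E X = 0"
proof (rule alg_linear_eqI[where x = "E Y"])
  show "alg_linear (\<lambda>e. e * a * E X)"
    by (rule alg_linear_compose[OF alg_linear_mult_right alg_linear_mult_right])
  show "alg_linear (\<lambda>_. 0)" by (rule alg_linear_zero)
  fix b assume "coeff (E Y) b \<noteq> 0"
  then have b: "supp b \<subseteq> Y" using coeff_E_low assms by blast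
  show "delta b * a * E X = 0"
  proof (rule alg_linear_eqI[where x = a])
    show "alg_linear (\<lambda>a. delta b * a * E X)"
      by (rule alg_linear_compose[OF alg_linear_mult_right alg_linear_mult_left])
    show "alg_linear (\<lambda>_. 0)" by (rule alg_linear_zero)
    fix c
    have "\<not> X \<subseteq> supp (b * c)" using b assms by (auto simp: supp_mult)
    then show "delta b * delta c * E X = 0"
      using assms delta_mult_E_zero by (simp add: delta_mult)
  qed
qed

text \<open>If the support of \<open>b\<close> contains \<open>X\<close>, the elements occurring in
  \<open>E X\<close> absorb \<open>b\<close> on the right; otherwise \<open>delta b * E X\<close> is
  zero. So the diagonal corners are one-dimensional.\<close>

lemma E_mult_E_same:
  assumes X: "X \<in> supports"
  shows "E X * a * E X = alg_scale (chi X a) (E X)"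
proof (induction a rule: alg_induct)
  case (delta c b)
  have "E X * delta b * E X = (if X \<subseteq> supp b then E X else 0)"
  proof (cases "X \<subseteq> supp b")
    case False
    then show ?thesis using delta_mult_E_zero[OF X] by (simp add: mult.assoc)
  next
    case True
    have "E X * delta b * E X = E X * E X"
    proof (rule alg_linear_eqI[where x = "E X" and f = "\<lambda>e. e * delta b * E X" and g = "\<lambda>e. e * E X"])
      show "alg_linear (\<lambda>e. e * delta b * E X)"
        by (rule alg_linear_compose[OF alg_linear_mult_right alg_linear_mult_right])
      show "alg_linear (\<lambda>e. e * E X)" by (rule alg_linear_mult_right)
      fix p assume "coeff (E X) p \<noteq> 0"
      then have "supp p \<subseteq> supp b" using coeff_E_low X True by blast
      then show "delta p * delta b * E X = delta p * E X" by (simp add: delta_mult mult_absorb)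
    qed
    then show ?thesis using True E_idem X by simp
  qed
  then show ?case by simp
qed (simp_all add: distrib_left distrib_right alg_space.scale_left_distrib)


section \<open>Corners and their decomposable elements\<close>

definition corner :: "'b set \<Rightarrow> 'b set \<Rightarrow> ('b, 'k) semigroup_algebra set" where
  "corner Y X = {E Y * a * E X | a. True}"

text \<open>The corner at \<open>(Y,X)\<close> of the square of the radical. A basis of a complement
  therefore counts the arrows from \<open>X\<close> to \<open>Y\<close> in the quiver of the
  algebra.\<close>

definition decomposables :: "'b set \<Rightarrow> 'b set \<Rightarrow> ('b, 'k) semigroup_algebra set" where
  "decomposables Y X = alg_space.span {x * y | x y. \<exists>Z\<in>supports. X \<subset> Z \<and> Z \<subset> Y \<and> x \<in> corner Y Z \<and> y \<in> corner Z X}"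

lemma corner_iff:
  assumes "X \<in> supports" "Y \<in> supports"
  shows "x \<in> corner Y X \<longleftrightarrow> E Y * x = x \<and> x * E X = x"
proof
  assume "x \<in> corner Y X"
  then obtain a where "x = E Y * a * E X" by (auto simp: corner_def)
  moreover have "E Y * (E Y * a * E X) = E Y * E Y * a * E X"
    "E Y * a * E X * E X = E Y * a * (E X * E X)" by (simp_all only: mult.assoc)
  ultimately show "E Y * x = x \<and> x * E X = x"
    using assms E_idem by simp
next
  assume "E Y * x = x \<and> x * E X = x"
  then have "x = E Y * x * E X" by simp
  then show "x \<in> corner Y X" by (auto simp: corner_def)
qed

lemma corner_subspace: "alg_space.subspace (corner Y X)"
proof -
  have "corner Y X = (\<lambda>a. E Y * a * E X) ` UNIV" by (auto simp: corner_def)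
  moreover have "alg_linear (\<lambda>a. E Y * a * E X)"
    by (rule alg_linear_compose[OF alg_linear_mult_right alg_linear_mult_left])
  ultimately show ?thesis
    using linear_range_subspace[OF _ alg_space.subspace_UNIV] by simp
qed

lemma corner_mult:
  assumes "X \<in> supports" "Y \<in> supports" "Z \<in> supports" "x \<in> corner Y Z" "y \<in> corner Z X"
  shows "x * y \<in> corner Y X"
proof -
  have "E Y * (x * y) = E Y * x * y" "x * y * E X = x * (y * E X)" by (simp_all only: mult.assoc)
  with assms show ?thesis by (simp add: corner_iff)
qed

lemma decomposables_subspace: "alg_space.subspace (decomposables Y X)"
  by (simp add: decomposables_def)

lemma mult_in_decomposables:
  assumes "Z \<in> supports" "X \<subset> Z" "Z \<subset> Y" "x \<in> corner Y Z" "y \<in> corner Z X"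
  shows "x * y \<in> decomposables Y X"
  unfolding decomposables_def using assms by (intro alg_space.span_base) blast

lemma decomposables_subset_corner:
  assumes "X \<in> supports" "Y \<in> supports"
  shows "decomposables Y X \<subseteq> corner Y X"
  unfolding decomposables_def
  using assms corner_mult by (intro alg_space.span_minimal corner_subspace) blast

lemma corner_not_subset:
  assumes "X \<in> supports" "Y \<in> supports" "\<not> X \<subseteq> Y"
  shows "corner Y X = {0}"
  using E_mult_E_zero[OF assms] by (auto simp: corner_def)

lemma corner_same:
  assumes "X \<in> supports" "x \<in> corner X X"
  shows "x = alg_scale (chi X x) (E X)"
  using assms E_mult_E_same[of X x] by (simp add: corner_iff)

text \<open>Multiplicativity puts the factors \<open>chi W (E Y)\<close> and
  \<open>chi W (E X)\<close> into the value, and one of them is zero.\<close>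

lemma chi_corner:
  assumes "X \<in> supports" "Y \<in> supports" "W \<in> supports" "X \<noteq> Y" "x \<in> corner Y X"
  shows "chi W x = 0"
proof -
  have "x = E Y * x * E X" using assms by (simp add: corner_iff)
  then have "chi W x = chi W (E Y * x * E X)" by (rule arg_cong)
  also have "\<dots> = chi W (E Y) * chi W x * chi W (E X)" by simp
  also have "\<dots> = 0" using assms by (simp add: chi_E)
  finally show ?thesis .
qed

text \<open>Insert the sum of all \<open>E Z\<close> between \<open>r\<close> and \<open>y\<close>.
  The term \<open>Z = Y\<close> is the scalar multiple, the terms strictly between \<open>X\<close>
  and \<open>Y\<close> are decomposable, \<open>Z = X\<close> vanishes because
  \<open>chi X y = 0\<close>, and all others contain a zero corner. So left multiplication acts
  modulo decomposables through \<open>chi Y\<close>.\<close>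

lemma mult_mod_decomposables:
  assumes "X \<in> supports" "Y \<in> supports" "X \<subset> Y" and y: "y * E X = y" "chi X y = 0"
  shows "E Y * r * y - alg_scale (chi Y r) (E Y * y) \<in> decomposables Y X"
proof -
  have "E Y * r * y = (\<Sum>Z\<in>supports. E Y * r * (E Z * y))"
    by (subst expand_left[of y]) (simp only: sum_distrib_left)
  also have "\<dots> = E Y * r * (E Y * y) + (\<Sum>Z\<in>supports - {Y}. E Y * r * (E Z * y))"
    using assms by (intro sum.remove) auto
  also have "E Y * r * (E Y * y) = alg_scale (chi Y r) (E Y * y)"
  proof -
    have "E Y * r * (E Y * y) = E Y * r * E Y * y" by (simp add: mult.assoc)
    then show ?thesis using E_mult_E_same[of Y r] assms by simp
  qed
  finally have eq: "E Y * r * y - alg_scale (chi Y r) (E Y * y) = (\<Sum>Z\<in>supports - {Y}. E Y * r * (E Z * y))"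
    by simp
  have "E Y * r * (E Z * y) \<in> decomposables Y X" if "Z \<in> supports - {Y}" for Z
  proof -
    have Z: "Z \<in> supports" "Z \<noteq> Y" using that by auto
    have Zy: "E Z * y = E Z * y * E X" using y by (simp add: mult.assoc)
    have YZ: "E Y * r * (E Z * y) = (E Y * r * E Z) * (E Z * y)"
    proof -
      have "(E Y * r * E Z) * (E Z * y) = E Y * r * (E Z * E Z * y)" by (simp only: mult.assoc)
      then show ?thesis using Z E_idem by simp
    qed
    consider "X \<subset> Z" "Z \<subset> Y" | "Z = X" | "\<not> X \<subseteq> Z" | "\<not> Z \<subseteq> Y" using Z by blast
    then show ?thesis
    proof cases
      case 1
      then show ?thesis unfolding YZ using Z Zy
        by (intro mult_in_decomposables[of Z]) (auto simp: corner_def)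
    next
      case 2
      then have "E Z * y = 0" using Zy E_mult_E_same[of X y] assms by simp
      then show ?thesis by (simp add: alg_space.subspace_0 decomposables_subspace)
    next
      case 3
      then have "E Z * y = 0" using Zy E_mult_E_zero[of X Z] assms Z by simp
      then show ?thesis by (simp add: alg_space.subspace_0 decomposables_subspace)
    next
      case 4
      then have "E Y * r * E Z = 0" using E_mult_E_zero[of Z Y] assms Z by simp
      then show ?thesis unfolding YZ by (simp add: alg_space.subspace_0 decomposables_subspace)
    qed
  qed
  then show ?thesis unfolding eq by (intro alg_space.subspace_sum decomposables_subspace)
qed

text \<open>The coordinates of an element of \<open>A E\<^sub>X = (k L\<^sub>X) E\<^sub>X\<close>, where \<open>L\<^sub>X\<close> is the set of elements of support \<open>X\<close>.\<close>

definition coord :: "'b set \<Rightarrow> ('b, 'k) semigroup_algebra \<Rightarrow> ('b, 'k) semigroup_algebra" where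
  "coord X a = level X (a * delta (SOME l. supp l = X))"

lemma alg_linear_coord: "alg_linear (coord X)"
  unfolding coord_def by (rule alg_linear_compose[OF alg_linear_level alg_linear_mult_right])

lemma level_coord [simp]: "level X (coord X a) = coord X a"
  by (simp add: coord_def)

text \<open>The element chosen inside \<open>coord\<close> does not matter here:
  \<open>level_sandwich\<close> holds for every element of support \<open>X\<close>, and
  \<open>chi X (E X) = 1\<close>.\<close>

lemma coord_mult_E:
  assumes "X \<in> supports" "level X f = f"
  shows "coord X (f * E X) = f"
proof -
  have "supp (SOME l. supp l = X) = X"
    using assms(1) by (metis (mono_tags, lifting) someI_ex supports_obtain)
  then show ?thesis
    using level_sandwich[OF assms(2)] assms(1) by (simp add: coord_def chi_E)
qed

lemma mult_E_coord:
  assumes "X \<in> supports" "a * E X = a"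
  shows "coord X a * E X = a"
proof -
  obtain f where f: "level X f = f" "a * E X = f * E X"
    using ex_level_mult_E[OF assms(1)] by blast
  then have "a = f * E X" using assms by simp
  with f coord_mult_E[OF assms(1) f(1)] show ?thesis by simp
qed

lemma chi_coord:
  assumes "X \<in> supports" "a * E X = a"
  shows "chi X (coord X a) = chi X a"
proof -
  have "chi X a = chi X (coord X a * E X)" using mult_E_coord[OF assms] by simp
  then show ?thesis using assms by (simp add: chi_E)
qed

end

section \<open>Quotients\<close>

text \<open>\<open>quotient_rep\<close> defines its operations by unions over all representatives.
  Such a union collapses to a single coset when \<open>N\<close> is a subgroup that the operation
  respects.\<close>

locale quotient_data =
  fixes V :: "('r, 'k, 'v::ab_group_add) rep" and N :: "'v set"
  assumes vadd_plus: "vadd V = (+)"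
    and zero_in: "0 \<in> N" and diff_in: "\<And>x y. x \<in> N \<Longrightarrow> y \<in> N \<Longrightarrow> x - y \<in> N"
begin

lemma add_in: "x \<in> N \<Longrightarrow> y \<in> N \<Longrightarrow> x + y \<in> N"
  using diff_in[of x "0 - y"] diff_in[of 0 y] zero_in by simp

lemma vcoset_eq: "vcoset V N x = {y. y - x \<in> N}"
  unfolding vcoset_def vadd_plus
  by (auto simp: image_iff) (metis add_diff_cancel_left' diff_add_cancel add.commute)

lemma vcoset_eq_iff: "vcoset V N x = vcoset V N y \<longleftrightarrow> x - y \<in> N"
proof
  assume "vcoset V N x = vcoset V N y"
  moreover have "x \<in> vcoset V N x" using zero_in by (simp add: vcoset_eq)
  ultimately show "x - y \<in> N" by (simp add: vcoset_eq)
next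
  assume xy: "x - y \<in> N"
  have "z - y \<in> N" if "z - x \<in> N" for z using add_in[OF that xy] by simp
  moreover have "z - x \<in> N" if "z - y \<in> N" for z using diff_in[OF that xy] by simp
  ultimately show "vcoset V N x = vcoset V N y" by (auto simp: vcoset_eq)
qed

lemma UN_vcoset:
  assumes "\<And>y. y - x \<in> N \<Longrightarrow> h y - h x \<in> N"
  shows "(\<Union>y\<in>vcoset V N x. vcoset V N (h y)) = vcoset V N (h x)"
proof -
  have "vcoset V N (h y) = vcoset V N (h x)" if "y \<in> vcoset V N x" for y
    using that assms by (simp add: vcoset_eq_iff) (simp add: vcoset_eq)
  moreover have "x \<in> vcoset V N x" using zero_in by (simp add: vcoset_eq)
  ultimately show ?thesis by blast
qed

lemma quotient_vadd:
  "vadd (quotient_rep V N) (vcoset V N x) (vcoset V N y) = vcoset V N (x + y)"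
proof -
  have "(\<Union>b\<in>vcoset V N y. vcoset V N (a + b)) = vcoset V N (a + y)" for a
    by (rule UN_vcoset) simp
  moreover have "(\<Union>a\<in>vcoset V N x. vcoset V N (a + y)) = vcoset V N (x + y)"
    by (rule UN_vcoset) simp
  ultimately show ?thesis by (simp add: quotient_rep_def vadd_plus)
qed

lemma quotient_vscale:
  assumes "\<And>y z. vscale V c (y - z) = vscale V c y - vscale V c z" and "\<And>n. n \<in> N \<Longrightarrow> vscale V c n \<in> N"
  shows "vscale (quotient_rep V N) c (vcoset V N x) = vcoset V N (vscale V c x)"
  unfolding quotient_rep_def using assms by (simp add: UN_vcoset flip: assms(1))

lemma quotient_act:
  assumes "\<And>y z. act V g (y - z) = act V g y - act V g z" and "\<And>n. n \<in> N \<Longrightarrow> act V g n \<in> N"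
  shows "act (quotient_rep V N) g (vcoset V N x) = vcoset V N (act V g x)"
  unfolding quotient_rep_def using assms by (simp add: UN_vcoset flip: assms(1))

end

lemma carrier_quotient: "carrier (quotient_rep V N) = vcoset V N ` carrier V"
  by (simp add: quotient_rep_def)

lemma rep_homD:
  assumes "f \<in> rep_hom S V W"
  shows "\<And>x. x \<in> carrier V \<Longrightarrow> f x \<in> carrier W"
    and "\<And>x y. x \<in> carrier V \<Longrightarrow> y \<in> carrier V \<Longrightarrow> f (vadd V x y) = vadd W (f x) (f y)"
    and "\<And>c x. x \<in> carrier V \<Longrightarrow> f (vscale V c x) = vscale W c (f x)"
    and "\<And>g x. g \<in> S \<Longrightarrow> x \<in> carrier V \<Longrightarrow> f (act V g x) = act W g (f x)"
  using assms by (auto simp: rep_hom_def)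


section \<open>Standard indexing\<close>

lemma left_ideal_radical: "left_ideal (jacobson_radical :: ('b::{finite, semigroup_mult}, 'k::field) semigroup_algebra set)"
proof -
  have *: "alg_space.subspace M" "\<And>a x. x \<in> M \<Longrightarrow> a * x \<in> M" if "maximal_left_ideal M"
    for M :: "('b, 'k) semigroup_algebra set"
    using that by (auto simp: maximal_left_ideal_def left_ideal_def)
  have "alg_space.subspace (\<Inter>{M :: ('b, 'k) semigroup_algebra set. maximal_left_ideal M})"
    by (rule alg_space.subspace_Inter) (use * in auto)
  then show ?thesis
    unfolding left_ideal_def jacobson_radical_def using * by blast
qed

text \<open>An isomorphism with the simple module sends the class of \<open>E X\<close> to a nonzero
  scalar, since that class generates. Acting with \<open>E X\<close> fixes the class by idempotence
  but multiplies the scalar by \<open>chi X (E X)\<close>.\<close>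

lemma chi_standardly_indexed:
  fixes E :: "'b::left_regular_band set \<Rightarrow> ('b, 'k::field) semigroup_algebra"
  assumes "standardly_indexed E" and X: "X \<in> supports" and idem: "E X * E X = E X"
  shows "chi X (E X) = 1"
proof -
  let ?V = "regular_rep\<lparr>carrier := {a * E X | a. True}\<rparr> :: (('b, 'k) semigroup_algebra, 'k, ('b, 'k) semigroup_algebra) rep"
  let ?N = "{r * E X | r. r \<in> (jacobson_radical :: ('b, 'k) semigroup_algebra set)}"
  let ?Q = "quotient_rep ?V ?N"
  have J: "left_ideal (jacobson_radical :: ('b, 'k) semigroup_algebra set)" by (rule left_ideal_radical)
  interpret quotient_data ?V ?N
  proof
    show "vadd ?V = (+)" by (simp add: regular_rep_def)
    have "(0 :: ('b, 'k) semigroup_algebra) \<in> jacobson_radical"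
      using J alg_space.subspace_0 unfolding left_ideal_def by blast
    then show "0 \<in> ?N" by force
    fix x y assume "x \<in> ?N" "y \<in> ?N"
    then obtain r s where "x = r * E X" "y = s * E X" "r \<in> jacobson_radical" "s \<in> jacobson_radical" by auto
    then have "x - y = (r - s) * E X" "r - s \<in> jacobson_radical"
      using J alg_space.subspace_diff unfolding left_ideal_def by (auto simp: left_diff_distrib)
    then show "x - y \<in> ?N" by blast
  qed
  have act: "act ?Q a (vcoset ?V ?N x) = vcoset ?V ?N (a * x)" for a x
  proof -
    have "act ?Q a (vcoset ?V ?N x) = vcoset ?V ?N (act ?V a x)"
    proof (rule quotient_act)
      show "act ?V a (y - z) = act ?V a y - act ?V a z" for y z
        by (simp add: regular_rep_def right_diff_distrib)
      fix n assume "n \<in> ?N"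
      then obtain r where "n = r * E X" "r \<in> jacobson_radical" by auto
      moreover from this have "a * r \<in> jacobson_radical" using J unfolding left_ideal_def by blast
      ultimately have "\<exists>r. a * n = r * E X \<and> r \<in> jacobson_radical" by (metis mult.assoc)
      then show "act ?V a n \<in> ?N" by (simp add: regular_rep_def)
    qed
    then show ?thesis by (simp add: regular_rep_def)
  qed
  have "rep_iso UNIV ?Q (simple_rep X)"
    using assms(1) X unfolding standardly_indexed_def by blast
  then obtain f where f: "f \<in> rep_hom UNIV ?Q (simple_rep X)"
    and bij: "bij_betw f (carrier ?Q) (carrier (simple_rep X :: (('b, 'k) semigroup_algebra, 'k, 'k) rep))"
    unfolding rep_iso_def by (elim bexE) (rule that)
  let ?e = "vcoset ?V ?N (E X)"
  have "E X \<in> carrier ?V" using idem[symmetric] by auto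
  then have e: "?e \<in> carrier ?Q" by (simp add: carrier_quotient)
  have f_act: "f (vcoset ?V ?N (a * E X)) = chi X a * f ?e" for a
    using rep_homD(4)[OF f UNIV_I e, of a] unfolding act by (simp add: simple_rep_def chi_def)
  have "f ?e \<noteq> 0"
  proof
    assume 0: "f ?e = 0"
    have "f A = 0" if A: "A \<in> carrier ?Q" for A
    proof -
      obtain a where "A = vcoset ?V ?N (a * E X)" using A by (auto simp: carrier_quotient)
      then show ?thesis using f_act 0 by simp
    qed
    moreover have "1 \<in> f ` carrier ?Q"
      using bij by (simp add: bij_betw_def simple_rep_def)
    ultimately show False by auto
  qed
  moreover have "f ?e = chi X (E X) * f ?e" using f_act[of "E X"] idem by simp
  ultimately show ?thesis by simp
qed

text \<open>For distinct \<open>X\<close> and \<open>Y\<close>, apply \<open>chi X\<close> to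
  \<open>E X * E Y = 0\<close> and use \<open>chi X (E X) = 1\<close>.\<close>

lemma standard_idempotents_cfpoi:
  assumes "cfpoi supports E" and "standardly_indexed E"
  shows "standard_idempotents E"
proof
  fix X Y :: "'a set" assume XY: "X \<in> supports" "Y \<in> supports"
  have idem: "E Z * E Z = E Z" if "Z \<in> supports" for Z
    using assms(1) that by (simp add: cfpoi_def primitive_idempotent_def)
  show orth: "E X * E Y = (if X = Y then E X else 0)"
    using assms(1) XY idem by (simp add: cfpoi_def)
  have chi1: "chi Z (E Z) = 1" if "Z \<in> supports" for Z
    using chi_standardly_indexed assms(2) that idem by blast
  show "chi X (E Y) = (if X = Y then 1 else 0)"
  proof (cases "X = Y")
    case False
    then have "chi X (E X) * chi X (E Y) = 0" using orth by (simp flip: chi_mult)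
    then show ?thesis using chi1[OF XY(1)] False by simp
  qed (simp add: chi1 XY)
qed (use assms(1) in \<open>simp_all add: cfpoi_def\<close>)


section \<open>Projective left ideals\<close>

text \<open>The dual basis lemma. The \<open>f i\<close> are the coordinates of the embedding into a
  free module, the \<open>x i\<close> the images of the standard basis vectors under the retraction.
  The identity enters as \<open>u\<close>, since the type of the algebra has no distinguished unit;
  it is the nonzero entry of the basis vectors \<open>e i\<close>.\<close>

lemma projective_dual_basis:
  fixes L :: "('b::{finite, semigroup_mult}, 'k::field) semigroup_algebra set" and u
  assumes L: "left_ideal L" and proj: "projective (regular_rep\<lparr>carrier := L\<rparr>)"
    and unit: "\<And>a. u * a = a" "\<And>a :: ('b, 'k) semigroup_algebra. a * u = a"
  obtains I :: "('b, 'k) semigroup_algebra set" and f x where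
    "\<And>i. i \<in> I \<Longrightarrow> x i \<in> L"
    "\<And>i y z. i \<in> I \<Longrightarrow> y \<in> L \<Longrightarrow> z \<in> L \<Longrightarrow> f i (y + z) = f i y + f i z"
    "\<And>i y a. i \<in> I \<Longrightarrow> y \<in> L \<Longrightarrow> f i (a * y) = a * f i y"
    "\<And>y. y \<in> L \<Longrightarrow> finite {i\<in>I. f i y \<noteq> 0}"
    "\<And>y. y \<in> L \<Longrightarrow> y = (\<Sum>i | i \<in> I \<and> f i y \<noteq> 0. f i y * x i)"
proof -
  let ?P = "regular_rep\<lparr>carrier := L\<rparr> :: (('b, 'k) semigroup_algebra, 'k, ('b, 'k) semigroup_algebra) rep"
  let ?R = "regular_rep :: (('b, 'k) semigroup_algebra, 'k, ('b, 'k) semigroup_algebra) rep"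
  obtain I :: "('b, 'k) semigroup_algebra set" and F g where
    F: "F \<in> rep_hom UNIV ?P (direct_sum I (\<lambda>_. ?R))"
    and g: "g \<in> rep_hom UNIV (direct_sum I (\<lambda>_. ?R)) ?P"
    and gF: "\<And>x. x \<in> L \<Longrightarrow> g (F x) = x"
    using proj unfolding projective_def by auto
  let ?D = "direct_sum I (\<lambda>_. ?R)"
  have carrier_D: "y \<in> carrier ?D \<longleftrightarrow> y \<in> extensional I \<and> finite {i\<in>I. y i \<noteq> 0}" for y
    by (auto simp: direct_sum_def regular_rep_def PiE_def)
  define e where "e i = (\<lambda>j\<in>I. if j = i then u else 0)" for i
  have e: "e i \<in> carrier ?D" if "i \<in> I" for i
  proof -
    have "{j\<in>I. e i j \<noteq> 0} \<subseteq> {i}" by (auto simp: e_def)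
    then show ?thesis unfolding carrier_D using finite_subset by (auto simp: e_def)
  qed
  have zeroD: "(\<lambda>i\<in>I. 0) \<in> carrier ?D" by (simp add: carrier_D)
  have g0: "g (\<lambda>i\<in>I. 0) = 0"
  proof -
    have "vscale ?D 0 (\<lambda>i\<in>I. 0) = (\<lambda>i\<in>I. 0)"
      by (auto simp: direct_sum_def regular_rep_def)
    then show ?thesis using rep_homD(3)[OF g zeroD, of 0] by (simp add: regular_rep_def)
  qed
  \<comment> \<open>Induction over a finite set containing the support of \<open>y\<close>: one
    coordinate is set to zero and put back as a multiple of a basis vector.\<close>
  have expand: "g y = (\<Sum>i\<in>S. y i * g (e i))"
    if "finite S" "S \<subseteq> I" "y \<in> extensional I" "{i\<in>I. y i \<noteq> 0} \<subseteq> S" for S y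
    using that
  proof (induction S arbitrary: y)
    case empty
    then have "y = (\<lambda>i\<in>I. 0)" by (auto simp: extensional_def)
    then show ?case using g0 by (simp only: sum.empty)
  next
    case (insert s S)
    define z where "z = y(s := 0)"
    have z: "z \<in> extensional I" "{i\<in>I. z i \<noteq> 0} \<subseteq> S"
      using insert.prems by (auto simp: z_def extensional_def)
    have zD: "z \<in> carrier ?D" unfolding carrier_D
      using z insert.hyps finite_subset by auto
    have s: "s \<in> I" using insert.prems by simp
    have fin: "finite {i\<in>I. y s * e s i \<noteq> 0}"
      by (rule finite_subset[of _ "{s}"]) (auto simp: e_def)
    have yeD: "act ?D (y s) (e s) \<in> carrier ?D"
      unfolding carrier_D
      by (auto simp: direct_sum_def regular_rep_def intro!: finite_subset[OF _ fin])
    have y: "y = vadd ?D z (act ?D (y s) (e s))"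
      using insert.prems s
      by (auto simp: direct_sum_def regular_rep_def z_def e_def unit extensional_def fun_eq_iff)
    have "g y = g z + y s * g (e s)"
      by (subst y) (use rep_homD(2)[OF g zD yeD] rep_homD(4)[OF g UNIV_I e[OF s]] in \<open>simp add: regular_rep_def\<close>)
    also have "g z = (\<Sum>i\<in>S. z i * g (e i))" using insert z by simp
    also have "\<dots> = (\<Sum>i\<in>S. y i * g (e i))" using insert.hyps by (intro sum.cong) (auto simp: z_def)
    finally show ?case using insert.hyps by (simp add: add.commute)
  qed
  show ?thesis
  proof (rule that[of I "\<lambda>i. g (e i)" "\<lambda>i y. F y i"])
    fix i assume i: "i \<in> I"
    show "g (e i) \<in> L" using rep_homD(1)[OF g e[OF i]] by (simp add: regular_rep_def)
    show "F (y + z) i = F y i + F z i" if "y \<in> L" "z \<in> L" for y z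
      using rep_homD(2)[OF F, of y z] that i by (simp add: regular_rep_def direct_sum_def)
    show "F (a * y) i = a * F y i" if "y \<in> L" for y a
      using rep_homD(4)[OF F UNIV_I, of y a] that i by (simp add: regular_rep_def direct_sum_def)
  next
    fix y assume y: "y \<in> L"
    then have Fy: "F y \<in> carrier ?D" using rep_homD(1)[OF F, of y] by simp
    then show fin: "finite {i \<in> I. F y i \<noteq> 0}" by (simp add: carrier_D)
    have "y = g (F y)" using gF y by simp
    also have "\<dots> = (\<Sum>i | i \<in> I \<and> F y i \<noteq> 0. F y i * g (e i))"
      using Fy fin by (intro expand) (auto simp: carrier_D)
    finally show "y = (\<Sum>i | i \<in> I \<and> F y i \<noteq> 0. F y i * g (e i))" .
  qed
qed

text \<open>Independence is stated for a family rather than a set: two equal members would admit the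
  coefficients 1 and -1, so the hypothesis already forces the family to be injective.\<close>

lemma card_le_dim_family:
  fixes x :: "'i \<Rightarrow> ('b::{finite, semigroup_mult}, 'k::field) semigroup_algebra"
  assumes I: "finite I" and C: "x ` I \<subseteq> C"
    and indep: "\<And>c i. (\<Sum>i\<in>I. alg_scale (c i) (x i)) = 0 \<Longrightarrow> i \<in> I \<Longrightarrow> c i = 0"
  shows "card I \<le> alg_space.dim C"
proof -
  have inj: "inj_on x I"
  proof (rule inj_onI, rule ccontr)
    fix i j assume ij: "i \<in> I" "j \<in> I" "x i = x j" "i \<noteq> j"
    define c where "c k = (if k = i then 1 else if k = j then -1 else 0 :: 'k)" for k
    have "(\<Sum>k\<in>I. alg_scale (c k) (x k)) = (\<Sum>k\<in>{i, j}. alg_scale (c k) (x k))"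
      using ij I by (intro sum.mono_neutral_right) (auto simp: c_def)
    also have "\<dots> = 0" using ij by (simp add: c_def)
    finally have "c i = 0" using indep ij by blast
    then show False by (simp add: c_def)
  qed
  have "alg_space.independent (x ` I)"
  proof
    assume "alg_space.dependent (x ` I)"
    then obtain c where c: "\<exists>v\<in>x ` I. c v \<noteq> 0" "(\<Sum>v\<in>x ` I. alg_scale (c v) v) = 0"
      using I by (auto simp: alg_space.dependent_finite)
    have "(\<Sum>i\<in>I. alg_scale (c (x i)) (x i)) = 0"
      using c(2) by (simp add: sum.reindex[OF inj])
    then have "c (x i) = 0" if "i \<in> I" for i using indep[of "\<lambda>i. c (x i)" i] that by blast
    then show False using c(1) by blast
  qed
  then have "card (x ` I) \<le> alg_space.dim C"
    using C alg_fd.independent_card_le_dim by blast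
  then show ?thesis using inj by (simp add: card_image)
qed

text \<open>The image spans, so its size is at least the dimension, which is at least the size of
  the index set. All these numbers agree, so the family is injective and a basis.\<close>

lemma spanning_family_independent:
  fixes x :: "'i \<Rightarrow> ('b::{finite, semigroup_mult}, 'k::field) semigroup_algebra"
  assumes I: "finite I" and span: "C \<subseteq> alg_space.span (x ` I)" and sub: "x ` I \<subseteq> C"
    and card: "card I \<le> alg_space.dim C"
    and c: "(\<Sum>i\<in>I. alg_scale (c i) (x i)) = (\<Sum>i\<in>I. alg_scale (d i) (x i))" and i: "i \<in> I"
  shows "c i = d i"
proof -
  have "card (x ` I) \<le> card I" using I by (rule card_image_le)
  then have indep: "alg_space.independent (x ` I)"
    using alg_fd.card_le_dim_spanning[OF sub span] I card by simp
  then have "alg_space.dim C = card (x ` I)"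
    using alg_space.dim_unique[OF sub span indep] by simp
  then have inj: "inj_on x I" using card I \<open>card (x ` I) \<le> card I\<close> by (intro eq_card_imp_inj_on) auto
  define e where "e v = c (the_inv_into I x v) - d (the_inv_into I x v)" for v
  have "(\<Sum>v\<in>x ` I. alg_scale (e v) v) = (\<Sum>i\<in>I. alg_scale (c i - d i) (x i))"
    by (subst sum.reindex[OF inj]) (simp add: e_def the_inv_into_f_f[OF inj])
  also have "\<dots> = 0" using c by (simp add: alg_space.scale_left_diff_distrib sum_subtractf)
  finally have "e (x i) = 0"
    using alg_space.independentD[OF indep, of "x ` I" e "x i"] I i by simp
  then show ?thesis using i by (simp add: e_def the_inv_into_f_f[OF inj])
qed

text \<open>Indexed exactly like the factor list in \<open>chain_tensor\<close>, with the upper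
  support as first argument as in \<open>corner Y X\<close>.\<close>

definition steps :: "('a \<Rightarrow> 'a \<Rightarrow> 'c) \<Rightarrow> 'a list \<Rightarrow> 'c list" where
  "steps F c = map (\<lambda>i. F (c ! i) (c ! (i - 1))) [1..<length c]"

lemma steps_single [simp]: "steps F [x] = []"
  by (simp add: steps_def)

lemma steps_Cons: "c \<noteq> [] \<Longrightarrow> steps F (x # c) = F (hd c) x # steps F c"
proof -
  assume c: "c \<noteq> []"
  then have "[1..<length (x # c)] = 1 # map Suc [1..<length c]"
    by (cases c) (simp_all add: map_Suc_upt upt_conv_Cons del: upt_Suc)
  then show ?thesis using c
    by (auto simp: steps_def hd_conv_nth nth_Cons' simp del: upt_Suc intro!: map_cong)
qed

lemma support_chains_0:
  "X \<in> supports \<Longrightarrow> support_chains X Y 0 = (if X = Y then {[X]} else {})"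
  by (auto simp: support_chains_def length_Suc_conv)

text \<open>Chains are cut at the bottom because \<open>dim_step\<close> also peels off the first
  arrow, the one that starts at \<open>X\<close>.\<close>

lemma support_chains_Suc:
  assumes "X \<in> supports"
  shows "support_chains X Y (Suc m) = (\<Union>Z\<in>{Z\<in>supports. X \<subset> Z}. (#) X ` support_chains Z Y m)"
proof (intro equalityI subsetI)
  fix c assume "c \<in> support_chains X Y (Suc m)"
  then have c: "length c = Suc (Suc m)" "set c \<subseteq> supports" "sorted_wrt (\<subset>) c" "hd c = X" "last c = Y"
    by (auto simp: support_chains_def)
  then obtain Z c' where eq: "c = X # Z # c'" by (metis length_Suc_conv list.sel(1))
  then have "Z \<in> supports" "X \<subset> Z" "Z # c' \<in> support_chains Z Y m"
    using c by (auto simp: support_chains_def)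
  then show "c \<in> (\<Union>Z\<in>{Z\<in>supports. X \<subset> Z}. (#) X ` support_chains Z Y m)"
    using eq by blast
next
  fix c assume "c \<in> (\<Union>Z\<in>{Z\<in>supports. X \<subset> Z}. (#) X ` support_chains Z Y m)"
  then obtain Z c' where Z: "Z \<in> supports" "X \<subset> Z" "c' \<in> support_chains Z Y m" "c = X # c'" by blast
  then obtain c'' where "c' = Z # c''" by (cases c') (auto simp: support_chains_def)
  then show "c \<in> support_chains X Y (Suc m)"
    using Z assms by (auto simp: support_chains_def)
qed

lemma finite_support_chains: "finite (support_chains X Y m)"
  by (rule finite_subset[of _ "{c. set c \<subseteq> supports \<and> length c = m + 1}"])
    (auto simp: support_chains_def intro: finite_lists_length_eq)

text \<open>The members of a strict chain are distinct. This bound makes the sums over all lengths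
  finite and ends the replacement of factors by longer products.\<close>

lemma support_chains_length:
  fixes X :: "'b::left_regular_band set"
  assumes "c \<in> support_chains X Y m"
  shows "m < card (supports :: 'b set set)"
proof -
  have "distinct c"
  proof -
    have "sorted_wrt (\<subset>) c" using assms by (simp add: support_chains_def)
    then show ?thesis by (induction c) auto
  qed
  then have "card (set c) = m + 1" using assms by (simp add: support_chains_def distinct_card)
  moreover have "card (set c) \<le> card (supports :: 'b set set)"
    using assms by (intro card_mono) (auto simp: support_chains_def)
  ultimately show ?thesis by simp
qed


section \<open>Path counting in the hereditary case\<close>

text \<open>Lifts of a basis of \<open>C(Y,X) / D(Y,X)\<close>; the last condition is independence
  modulo decomposables.\<close>

definition (in standard_idempotents) arrows where
  "arrows Y X S \<longleftrightarrow> finite S \<and> S \<subseteq> corner Y X \<and>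
     corner Y X \<subseteq> alg_space.span (S \<union> decomposables Y X) \<and>
     (\<forall>c. (\<Sum>v\<in>S. alg_scale (c v) v) \<in> decomposables Y X \<longrightarrow> (\<forall>v\<in>S. c v = 0))"

locale hereditary_idempotents = standard_idempotents E
  for E :: "'b::left_regular_band set \<Rightarrow> ('b, 'k::field) semigroup_algebra" +
  assumes hereditary: "hereditary_algebra TYPE('b) TYPE('k)"
begin

text \<open>This is the radical of \<open>A E\<^sub>X\<close>: among the characters only
  \<open>chi X\<close> is nonzero on \<open>A E\<^sub>X\<close>.\<close>

lemma left_ideal_radical_part:
  "left_ideal {x. x * E X = x \<and> chi X x = 0}"
  unfolding left_ideal_def alg_space.subspace_def
  by (auto simp: distrib_right mult.assoc)

section \<open>Arrows starting at a fixed support\<close>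

context
  fixes X :: "'b set" and Q :: "'b set \<Rightarrow> ('b, 'k) semigroup_algebra set"
  assumes X: "X \<in> supports"
    and Q: "\<And>Z. Z \<in> supports \<Longrightarrow> X \<subset> Z \<Longrightarrow> arrows Z X (Q Z)"
begin

abbreviation J where "J \<equiv> Sigma {Z\<in>supports. X \<subset> Z} Q"

lemma finite_J: "finite J"
  using Q by (intro finite_SigmaI) (auto simp: arrows_def)

lemma snd_J_corner: "j \<in> J \<Longrightarrow> snd j \<in> corner (fst j) X"
proof -
  assume "j \<in> J"
  then have "fst j \<in> supports" "X \<subset> fst j" "snd j \<in> Q (fst j)" by (auto simp: mem_Sigma_iff)
  then show ?thesis using Q unfolding arrows_def by blast
qed

lemma snd_J: "j \<in> J \<Longrightarrow> E (fst j) * snd j = snd j" "j \<in> J \<Longrightarrow> snd j * E X = snd j"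
    "j \<in> J \<Longrightarrow> chi X (snd j) = 0"
proof -
  assume j: "j \<in> J"
  then have "fst j \<in> supports" "X \<noteq> fst j" by auto
  then show "E (fst j) * snd j = snd j" "snd j * E X = snd j" "chi X (snd j) = 0"
    using snd_J_corner[OF j] X corner_iff chi_corner by blast+
qed

text \<open>The left module \<open>M\<close> generated by the arrows contains every corner
  \<open>C(Z,X)\<close> with \<open>Z\<close> above \<open>X\<close>, by induction on the size of
  \<open>Z\<close>: a decomposable is a left multiple of an element of some \<open>C(W,X)\<close>
  with \<open>W\<close> smaller. Then \<open>x\<close> is the sum of its components
  \<open>E Z * x\<close>, the component at \<open>X\<close> being zero.\<close>

lemma generated:
  assumes x: "x * E X = x" "chi X x = 0"
  shows "\<exists>c. x = (\<Sum>j\<in>J. c j * snd j)"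
proof -
  define M where "M = {\<Sum>j\<in>J. c j * snd j | c. True}"
  have M_add: "y + z \<in> M" if yz: "y \<in> M" "z \<in> M" for y z
  proof -
    from yz obtain c d where "y = (\<Sum>j\<in>J. c j * snd j)" "z = (\<Sum>j\<in>J. d j * snd j)" unfolding M_def by blast
    then have "y + z = (\<Sum>j\<in>J. (c j + d j) * snd j)" by (simp add: distrib_right sum.distrib)
    then show ?thesis unfolding M_def by (intro CollectI exI[of _ "\<lambda>j. c j + d j"]) simp
  qed
  have M_mult: "a * y \<in> M" if y: "y \<in> M" for a y
  proof -
    from y obtain c where "y = (\<Sum>j\<in>J. c j * snd j)" unfolding M_def by blast
    then have "a * y = (\<Sum>j\<in>J. (a * c j) * snd j)" by (simp add: sum_distrib_left mult.assoc)
    then show ?thesis unfolding M_def by (intro CollectI exI[of _ "\<lambda>j. a * c j"]) simp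
  qed
  have M_scale: "alg_scale r y \<in> M" if y: "y \<in> M" for r y
  proof -
    have "alg_scale r y = alg_scale r (\<Sum>Z\<in>supports. E Z) * y" by (simp add: sum_E_left)
    then show ?thesis using M_mult[OF y] by metis
  qed
  have M0: "0 \<in> M" unfolding M_def by (intro CollectI exI[of _ "\<lambda>_. 0"]) simp
  have M_sub: "alg_space.subspace M"
    by (rule alg_space.subspaceI) (auto intro: M0 M_add M_scale)
  have M_J: "snd j \<in> M" if j: "j \<in> J" for j
  proof -
    define c where "c i = (if i = j then E (fst j) else 0)" for i
    have "(\<Sum>i\<in>J. c i * snd i) = (\<Sum>i\<in>J. if i = j then E (fst j) * snd j else 0)"
      by (intro sum.cong) (auto simp: c_def)
    also have "\<dots> = snd j" using j finite_J snd_J(1)[OF j] by simp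
    finally show ?thesis unfolding M_def by (metis (mono_tags, lifting) mem_Collect_eq)
  qed
  have corner_M: "Z \<in> supports \<Longrightarrow> X \<subset> Z \<Longrightarrow> corner Z X \<subseteq> M" for Z
  proof (induction "card Z" arbitrary: Z rule: less_induct)
    case less
    have "decomposables Z X \<subseteq> M"
      unfolding decomposables_def
    proof (rule alg_space.span_minimal[OF subsetI M_sub])
      fix z assume "z \<in> {x * y | x y. \<exists>W\<in>supports. X \<subset> W \<and> W \<subset> Z \<and> x \<in> corner Z W \<and> y \<in> corner W X}"
      then obtain x y W where z: "z = x * y"
        and W: "W \<in> supports" "X \<subset> W" "W \<subset> Z" "x \<in> corner Z W" "y \<in> corner W X" by blast
      have "card W < card Z" using W by (intro psubset_card_mono) auto
      then have "y \<in> M" using less W by blast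
      then show "z \<in> M" unfolding z by (rule M_mult)
    qed
    moreover have "Q Z \<subseteq> M"
    proof
      fix v assume "v \<in> Q Z"
      then have "(Z, v) \<in> J" using less by blast
      then show "v \<in> M" using M_J by fastforce
    qed
    ultimately have "alg_space.span (Q Z \<union> decomposables Z X) \<subseteq> M"
      by (intro alg_space.span_minimal M_sub) blast
    then show ?case using Q[of Z] less unfolding arrows_def by blast
  qed
  have "E Z * x \<in> M" if Z: "Z \<in> supports" for Z
  proof -
    have Zx: "E Z * x = E Z * x * E X" using x by (simp add: mult.assoc)
    consider "X \<subset> Z" | "Z = X" | "\<not> X \<subseteq> Z" by blast
    then show ?thesis
    proof cases
      case 1
      then show ?thesis using corner_M[OF Z] Zx unfolding corner_def by blast
    next
      case 2
      then show ?thesis using Zx E_mult_E_same[of X x] X x M0 by simp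
    next
      case 3
      then show ?thesis using Zx E_mult_E_zero[of X Z x] X Z M0 by simp
    qed
  qed
  then have "(\<Sum>Z\<in>supports. E Z * x) \<in> M" by (intro alg_space.subspace_sum M_sub)
  then have "x \<in> M" using expand_left[of x] by simp
  then show ?thesis unfolding M_def by blast
qed

text \<open>Over a hereditary algebra the radical part of \<open>A E\<^sub>X\<close> is projective, and the arrows
  starting at \<open>X\<close> generate it freely: in the endomorphism matrix \<open>m\<close> of the arrows obtained
  from a dual basis, the diagonal blocks are forced to be identities.\<close>

lemma arrows_free:
  assumes a: "\<And>j. j \<in> J \<Longrightarrow> a j * E (fst j) = a j" and sum0: "(\<Sum>j\<in>J. a j * snd j) = 0" and "j \<in> J"
  shows "a j = 0"
proof -
  let ?R = "{x. x * E X = x \<and> chi X x = 0}"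
  have ideal: "left_ideal ?R" by (rule left_ideal_radical_part)
  then have proj: "projective (regular_rep\<lparr>carrier := ?R\<rparr>)"
    using hereditary unfolding hereditary_algebra_def by blast
  obtain I :: "('b, 'k) semigroup_algebra set" and f x where
    xR: "\<And>i. i \<in> I \<Longrightarrow> x i \<in> ?R"
    and f_add: "\<And>i y z. i \<in> I \<Longrightarrow> y \<in> ?R \<Longrightarrow> z \<in> ?R \<Longrightarrow> f i (y + z) = f i y + f i z"
    and f_mult: "\<And>i y a. i \<in> I \<Longrightarrow> y \<in> ?R \<Longrightarrow> f i (a * y) = a * f i y"
    and f_fin: "\<And>y. y \<in> ?R \<Longrightarrow> finite {i\<in>I. f i y \<noteq> 0}"
    and f_sum: "\<And>y. y \<in> ?R \<Longrightarrow> y = (\<Sum>i | i \<in> I \<and> f i y \<noteq> 0. f i y * x i)"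
    by (rule projective_dual_basis[OF ideal proj sum_E_left sum_E_right]) (rule that, assumption+)
  have JR: "snd j \<in> ?R" if "j \<in> J" for j using snd_J that by blast
  define I0 where "I0 = (\<Union>j\<in>J. {i\<in>I. f i (snd j) \<noteq> 0})"
  have I0: "finite I0" "I0 \<subseteq> I"
    unfolding I0_def using finite_J f_fin JR by auto
  obtain c where c: "x i = (\<Sum>j\<in>J. c i j * snd j)" if "i \<in> I" for i
  proof -
    have "\<forall>i\<in>I. \<exists>c. x i = (\<Sum>j\<in>J. c j * snd j)" using generated xR by blast
    then obtain c where "\<forall>i\<in>I. x i = (\<Sum>j\<in>J. c i j * snd j)" by (rule bchoice[THEN exE])
    then show ?thesis using that by blast
  qed
  \<comment> \<open>Coordinates of the arrow \<open>l\<close> in the dual basis, expanded again in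
    the arrows. The factor \<open>E (fst j)\<close> places the entry in the corner from
    \<open>fst j\<close> to \<open>fst l\<close>, which is zero unless \<open>fst j\<close> is
    inside \<open>fst l\<close> and one-dimensional on the diagonal.\<close>
  define m where "m l j = (\<Sum>i\<in>I0. f i (snd l) * (c i j * E (fst j)))"
    for l j :: "'b set \<times> ('b, 'k) semigroup_algebra"
  have m_right: "m l j * E (fst j) = m l j" if "j \<in> J" for l j
  proof -
    have "E (fst j) * E (fst j) = E (fst j)" using that by (intro E_idem) auto
    then show ?thesis by (simp add: m_def sum_distrib_right mult.assoc)
  qed
  have m_left: "E (fst l) * m l j = m l j" if l: "l \<in> J" for l j
  proof -
    have "E (fst l) * f i (snd l) = f i (snd l)" if "i \<in> I0" for i
      using f_mult[of i "snd l" "E (fst l)"] JR l that I0 snd_J(1)[OF l] by auto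
    then show ?thesis unfolding m_def sum_distrib_left by (simp flip: mult.assoc)
  qed
  have m_corner: "m l j \<in> corner (fst l) (fst j)" if "l \<in> J" "j \<in> J" for l j
    using that m_left[OF that(1)] m_right[OF that(2)]
    by (subst corner_iff) auto
  have m_sum: "snd l = (\<Sum>j\<in>J. m l j * snd j)" if l: "l \<in> J" for l
  proof -
    have "snd l = (\<Sum>i | i \<in> I \<and> f i (snd l) \<noteq> 0. f i (snd l) * x i)" using f_sum JR l by blast
    also have "\<dots> = (\<Sum>i\<in>I0. f i (snd l) * x i)"
      using I0 l by (intro sum.mono_neutral_left) (auto simp: I0_def)
    also have "\<dots> = (\<Sum>i\<in>I0. \<Sum>j\<in>J. f i (snd l) * (c i j * E (fst j)) * snd j)"
    proof (rule sum.cong[OF refl])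
      fix i assume "i \<in> I0"
      then have "x i = (\<Sum>j\<in>J. c i j * snd j)" using I0 c by blast
      also have "\<dots> = (\<Sum>j\<in>J. c i j * E (fst j) * snd j)"
        by (intro sum.cong refl) (simp add: mult.assoc snd_J(1))
      finally show "f i (snd l) * x i = (\<Sum>j\<in>J. f i (snd l) * (c i j * E (fst j)) * snd j)"
        by (simp add: sum_distrib_left mult.assoc)
    qed
    also have "\<dots> = (\<Sum>j\<in>J. m l j * snd j)"
      by (subst sum.swap) (simp add: m_def sum_distrib_right)
    finally show ?thesis .
  qed
  \<comment> \<open>Read \<open>m_sum\<close> modulo decomposables: entries with the same target
    \<open>Z\<close> are scalars, those with a smaller target contribute decomposables, all others
    vanish. Independence of \<open>Q Z\<close> modulo decomposables turns the scalars into a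
    Kronecker delta.\<close>
  have m_diag: "m l j = (if l = j then E (fst j) else 0)" if l: "l \<in> J" and j: "j \<in> J" and eq: "fst l = fst j" for l j
  proof -
    obtain Z v where lZ: "l = (Z, v)" and Z: "Z \<in> supports" "X \<subset> Z" "v \<in> Q Z" using l by auto
    obtain w where jZ: "j = (Z, w)" and w: "w \<in> Q Z" using j eq lZ by auto
    define mu where "mu u = chi Z (m l (Z, u))" for u
    have diag: "m l (Z, u) = alg_scale (mu u) (E Z)" if "u \<in> Q Z" for u
    proof -
      have "(Z, u) \<in> J" using that Z by blast
      then have "m l (Z, u) \<in> corner Z Z" using m_corner[OF l] lZ by fastforce
      then show ?thesis using corner_same Z unfolding mu_def by blast
    qed
    have JZ: "{Z} \<times> Q Z \<subseteq> J" using Z by blast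
    have "v = (\<Sum>j\<in>J. m l j * snd j)" using m_sum[OF l] lZ by simp
    also have "\<dots> = (\<Sum>j\<in>{Z} \<times> Q Z. m l j * snd j) + (\<Sum>j\<in>J - {Z} \<times> Q Z. m l j * snd j)"
      using sum.subset_diff[OF JZ finite_J] by (simp add: add.commute)
    also have "(\<Sum>j\<in>{Z} \<times> Q Z. m l j * snd j) = (\<Sum>u\<in>Q Z. alg_scale (mu u) u)"
    proof -
      have "(\<Sum>j\<in>{Z} \<times> Q Z. m l j * snd j) = (\<Sum>u\<in>Q Z. m l (Z, u) * u)"
        by (simp add: sum.cartesian_product')
      also have "\<dots> = (\<Sum>u\<in>Q Z. alg_scale (mu u) u)"
      proof (rule sum.cong[OF refl])
        fix u assume "u \<in> Q Z"
        then have "E Z * u = u" using snd_J(1)[of "(Z, u)"] Z by auto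
        then show "m l (Z, u) * u = alg_scale (mu u) u" using diag \<open>u \<in> Q Z\<close> by simp
      qed
      finally show ?thesis .
    qed
    finally have v: "v - (\<Sum>u\<in>Q Z. alg_scale (mu u) u) = (\<Sum>j\<in>J - {Z} \<times> Q Z. m l j * snd j)" by simp
    have "m l j * snd j \<in> decomposables Z X" if j: "j \<in> J - {Z} \<times> Q Z" for j
    proof -
      have W: "fst j \<in> supports" "X \<subset> fst j" "fst j \<noteq> Z" using j by auto
      have mj: "m l j \<in> corner Z (fst j)" using m_corner[OF l, of j] j lZ by simp
      show ?thesis
      proof (cases "fst j \<subset> Z")
        case True
        then show ?thesis using mult_in_decomposables[OF W(1,2) True mj] snd_J_corner[of j] j by blast
      next
        case False
        then have "\<not> fst j \<subseteq> Z" using W by blast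
        then have "m l j = 0" using mj corner_not_subset[OF W(1) Z(1)] by simp
        then show ?thesis by (simp add: alg_space.subspace_0 decomposables_subspace)
      qed
    qed
    then have "v - (\<Sum>u\<in>Q Z. alg_scale (mu u) u) \<in> decomposables Z X"
      unfolding v by (intro alg_space.subspace_sum decomposables_subspace)
    moreover have finQ: "finite (Q Z)" using Q Z by (simp add: arrows_def)
    have "(\<Sum>u\<in>Q Z. alg_scale ((if u = v then 1 else 0) - mu u) u) = v - (\<Sum>u\<in>Q Z. alg_scale (mu u) u)"
    proof -
      have "(\<Sum>u\<in>Q Z. alg_scale (if u = v then 1 else 0) u) = (\<Sum>u\<in>Q Z. if u = v then v else 0)"
        by (intro sum.cong) auto
      also have "\<dots> = v" using finQ Z by simp
      finally show ?thesis by (simp add: alg_space.scale_left_diff_distrib sum_subtractf)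
    qed
    ultimately have "(\<Sum>u\<in>Q Z. alg_scale ((if u = v then 1 else 0) - mu u) u) \<in> decomposables Z X" by simp
    moreover have "\<forall>c. (\<Sum>v\<in>Q Z. alg_scale (c v) v) \<in> decomposables Z X \<longrightarrow> (\<forall>v\<in>Q Z. c v = 0)"
      using Q[OF Z(1,2)] unfolding arrows_def by (elim conjE)
    ultimately have "\<forall>w\<in>Q Z. (if w = v then 1 else 0) - mu w = 0"
      by (elim allE[of _ "\<lambda>u. (if u = v then 1 else 0) - mu u"]) (rule mp)
    then have "(if w = v then 1 else 0) - mu w = 0" using w by blast
    then have "mu w = (if w = v then 1 else 0)" by simp
    then show ?thesis using diag[OF w] lZ jZ by auto
  qed
  have f_sum_J: "(\<Sum>l\<in>S. a l * f i (snd l)) = f i (\<Sum>l\<in>S. a l * snd l) \<and> (\<Sum>l\<in>S. a l * snd l) \<in> ?R"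
    if "i \<in> I" "S \<subseteq> J" "finite S" for i S
    using that(3,2)
  proof (induction S)
    case empty
    have "0 \<in> ?R" by simp
    then have "f i (0 * 0) = 0 * f i 0" using f_mult that(1) by blast
    then show ?case by simp
  next
    case (insert l S)
    then have l: "snd l \<in> ?R" using JR by blast
    then have al: "a l * snd l \<in> ?R" by (simp add: mult.assoc)
    have S: "(\<Sum>l\<in>S. a l * snd l) \<in> ?R" using insert by blast
    have "f i (\<Sum>l\<in>insert l S. a l * snd l) = f i (a l * snd l) + f i (\<Sum>l\<in>S. a l * snd l)"
      using insert f_add[OF that(1) al S] by simp
    also have "\<dots> = a l * f i (snd l) + (\<Sum>l\<in>S. a l * f i (snd l))"
      using insert f_mult[OF that(1) l] by simp
    finally have "f i (\<Sum>l\<in>insert l S. a l * snd l) = (\<Sum>l\<in>insert l S. a l * f i (snd l))"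
      using insert by simp
    moreover have "(\<Sum>l\<in>insert l S. a l * snd l) \<in> ?R"
      using al S insert by (simp add: distrib_right)
    ultimately show ?case by simp
  qed
  \<comment> \<open>The \<open>f i\<close> are module homomorphisms, so the relation between the
    arrows becomes a relation between the rows of \<open>m\<close>.\<close>
  have am: "(\<Sum>l\<in>J. a l * m l j) = 0" for j
  proof -
    have 0: "(\<Sum>l\<in>J. a l * f i (snd l)) = 0" if "i \<in> I0" for i
    proof -
      have iI: "i \<in> I" using that I0 by blast
      have "(0 :: ('b, 'k) semigroup_algebra) \<in> ?R" by simp
      then have "f i (0 * 0) = 0 * f i 0" using f_mult iI by blast
      then show ?thesis using f_sum_J[OF iI subset_refl finite_J] sum0 by simp
    qed
    have "(\<Sum>l\<in>J. a l * m l j) = (\<Sum>l\<in>J. \<Sum>i\<in>I0. a l * f i (snd l) * (c i j * E (fst j)))"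
      by (simp add: m_def sum_distrib_left mult.assoc)
    also have "\<dots> = (\<Sum>i\<in>I0. (\<Sum>l\<in>J. a l * f i (snd l)) * (c i j * E (fst j)))"
      by (subst sum.swap) (simp add: sum_distrib_right)
    also have "\<dots> = 0" using 0 by simp
    finally show ?thesis .
  qed
  \<comment> \<open>Downward induction on the target. The entry \<open>m l j\<close> is zero unless
    \<open>fst j\<close> is inside \<open>fst l\<close>; where this inclusion is strict,
    \<open>a l\<close> is zero by induction, so only the diagonal block is left.\<close>
  show ?thesis using \<open>j \<in> J\<close>
  proof (induction "card (- fst j)" arbitrary: j rule: less_induct)
    case less
    have "a l * m l j = (if l = j then a j else 0)" if l: "l \<in> J" for l
    proof (cases "fst l = fst j")
      case True
      then show ?thesis using m_diag[OF l less(2)] a[OF less(2)] by auto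
    next
      case False
      show ?thesis
      proof (cases "fst j \<subset> fst l")
        case True
        then have "card (- fst l) < card (- fst j)" by (intro psubset_card_mono) auto
        then show ?thesis using less(1)[OF _ l] False by auto
      next
        case nsub: False
        have "fst j \<in> supports" "fst l \<in> supports" using l less(2) by auto
        then have "m l j = 0"
          using m_corner[OF l less(2)] corner_not_subset[of "fst j" "fst l"] nsub False by blast
        then show ?thesis using False by auto
      qed
    qed
    then have "(\<Sum>l\<in>J. a l * m l j) = (\<Sum>l\<in>J. if l = j then a j else 0)" by (intro sum.cong) auto
    also have "\<dots> = a j" using finite_J less(2) by simp
    finally show ?case using am by simp
  qed
qed

text \<open>The products of the arrows from \<open>X\<close> to \<open>Z\<close> with a basis of
  \<open>C(Y,Z)\<close> are independent: sorted by arrow, a relation has the form treated in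
  \<open>arrows_free\<close>, so the left coefficient of every arrow is zero, and this coefficient
  is a combination of basis elements.\<close>

lemma dim_step:
  assumes Y: "Y \<in> supports"
  shows "(\<Sum>Z | Z \<in> supports \<and> X \<subset> Z. card (Q Z) * alg_space.dim (corner Y Z)) \<le> alg_space.dim (corner Y X)"
proof -
  have "\<exists>P. P \<subseteq> corner Y Z \<and> alg_space.independent P \<and> card P = alg_space.dim (corner Y Z)" for Z
    using alg_space.basis_exists by metis
  then obtain P where P: "\<And>Z. P Z \<subseteq> corner Y Z" "\<And>Z. alg_space.independent (P Z)"
    "\<And>Z. card (P Z) = alg_space.dim (corner Y Z)" by metis
  have finP: "finite (P Z)" for Z by (rule alg_fd.finiteI_independent[OF P(2)])
  let ?S = "{Z. Z \<in> supports \<and> X \<subset> Z}"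
  have finS: "finite ?S" by simp
  define K where "K = Sigma J (\<lambda>j. P (fst j))"
  have finK: "finite K" unfolding K_def using finite_J finP by auto
  have "card K = (\<Sum>j\<in>J. card (P (fst j)))" unfolding K_def using finite_J finP by simp
  also have "\<dots> = (\<Sum>Z\<in>?S. \<Sum>v\<in>Q Z. card (P Z))"
    using Q by (subst sum.Sigma) (auto simp: arrows_def case_prod_unfold)
  also have "\<dots> = (\<Sum>Z\<in>?S. card (Q Z) * alg_space.dim (corner Y Z))" by (simp add: P)
  finally have cardK: "card K = \<dots>" .
  have "card K \<le> alg_space.dim (corner Y X)"
  proof (rule card_le_dim_family[OF finK, where x = "\<lambda>k. snd k * snd (fst k)"])
    show "(\<lambda>k. snd k * snd (fst k)) ` K \<subseteq> corner Y X"
    proof (safe, unfold K_def)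
      fix k assume "k \<in> Sigma J (\<lambda>j. P (fst j))"
      then obtain j p where "k = (j, p)" "j \<in> J" "p \<in> P (fst j)" by (rule SigmaE)
      then have k: "fst k \<in> J" "snd k \<in> corner Y (fst (fst k))"
        using subsetD[OF P(1), of p "fst j"] by simp_all
      moreover have "fst (fst k) \<in> supports" using k by auto
      ultimately show "snd k * snd (fst k) \<in> corner Y X"
        using corner_mult[OF X Y _ k(2) snd_J_corner[OF k(1)]] by blast
    qed
    fix c k assume sum0: "(\<Sum>k\<in>K. alg_scale (c k) (snd k * snd (fst k))) = 0" and k: "k \<in> K"
    define a where "a j = (\<Sum>p\<in>P (fst j). alg_scale (c (j, p)) p)" for j
    have "(\<Sum>j\<in>J. a j * snd j) = (\<Sum>j\<in>J. \<Sum>p\<in>P (fst j). alg_scale (c (j, p)) (p * snd j))"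
      by (simp add: a_def sum_distrib_right)
    also have "\<dots> = (\<Sum>k\<in>K. alg_scale (c k) (snd k * snd (fst k)))"
      unfolding K_def using finite_J finP by (subst sum.Sigma) (auto simp: case_prod_unfold)
    finally have "(\<Sum>j\<in>J. a j * snd j) = 0" using sum0 by simp
    moreover have "a j * E (fst j) = a j" if "j \<in> J" for j
    proof -
      have "p * E (fst j) = p" if "p \<in> P (fst j)" for p
        using P(1)[of "fst j"] that \<open>j \<in> J\<close> Y by (auto simp: corner_iff)
      then show ?thesis by (simp add: a_def sum_distrib_right)
    qed
    moreover obtain j p where jp: "k = (j, p)" "j \<in> J" "p \<in> P (fst j)"
      using k unfolding K_def by (rule SigmaE)
    ultimately have "a j = 0" by (intro arrows_free[of a]) blast+
    then show "c k = 0"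
      using alg_space.independentD[OF P(2)[of "fst j"] finP subset_refl, of "\<lambda>p. c (j, p)" p] jp
      by (simp add: a_def)
  qed
  then show ?thesis using cardK by simp
qed

end

text \<open>Iterating \<open>dim_step\<close> counts the paths of arrows from \<open>X\<close> to
  \<open>Y\<close>, sorted by the chain of supports they visit. \<open>M\<close> truncates the
  length of the chains and is the induction variable.\<close>

lemma sum_chains_le_dim:
  assumes Q: "\<And>X Z. X \<in> supports \<Longrightarrow> Z \<in> supports \<Longrightarrow> X \<subset> Z \<Longrightarrow> arrows Z X (Q Z X)"
    and X: "X \<in> supports" and Y: "Y \<in> supports"
  shows "(\<Sum>m\<le>M. \<Sum>c\<in>support_chains X Y m. prod_list (steps (\<lambda>Z W. card (Q Z W)) c)) \<le> alg_space.dim (corner Y X)"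
  using X
proof (induction M arbitrary: X)
  case 0
  have "1 \<le> alg_space.dim (corner X X)"
  proof -
    have "E X \<in> corner X X" using 0 E_idem by (simp add: corner_iff)
    then have "\<not> corner X X \<subseteq> {0}" using E_nonzero[OF 0] by blast
    then have "alg_space.dim (corner X X) \<noteq> 0" by (simp only: alg_fd.dim_eq_0 not_False_eq_True)
    then show ?thesis by linarith
  qed
  then show ?case using 0 by (auto simp: support_chains_0)
next
  case (Suc M)
  let ?w = "\<lambda>c. prod_list (steps (\<lambda>Z W. card (Q Z W)) c)"
  let ?S = "{Z. Z \<in> supports \<and> X \<subset> Z}"
  have step: "(\<Sum>c\<in>support_chains X Y (Suc m). ?w c) = (\<Sum>Z\<in>?S. card (Q Z X) * (\<Sum>c\<in>support_chains Z Y m. ?w c))" for m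
  proof -
    have "(\<Sum>c\<in>support_chains X Y (Suc m). ?w c) = (\<Sum>Z\<in>?S. \<Sum>c\<in>(#) X ` support_chains Z Y m. ?w c)"
      unfolding support_chains_Suc[OF Suc.prems]
    proof (intro sum.UNION_disjoint ballI impI)
      show "(#) X ` support_chains Z Y m \<inter> (#) X ` support_chains Z' Y m = {}" if "Z \<noteq> Z'" for Z Z'
        using that by (auto simp: support_chains_def)
    qed (simp_all add: finite_support_chains)
    also have "\<dots> = (\<Sum>Z\<in>?S. \<Sum>c\<in>support_chains Z Y m. ?w (X # c))"
      by (simp add: sum.reindex)
    also have "\<dots> = (\<Sum>Z\<in>?S. \<Sum>c\<in>support_chains Z Y m. card (Q Z X) * ?w c)"
    proof (intro sum.cong refl)
      fix Z c assume "c \<in> support_chains Z Y m"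
      then have "c \<noteq> []" "hd c = Z" by (auto simp: support_chains_def)
      then show "?w (X # c) = card (Q Z X) * ?w c" by (simp add: steps_Cons)
    qed
    finally show ?thesis by (simp add: sum_distrib_left)
  qed
  have "(\<Sum>m\<le>Suc M. \<Sum>c\<in>support_chains X Y m. ?w c)
      = (\<Sum>c\<in>support_chains X Y 0. ?w c) + (\<Sum>m\<le>M. \<Sum>c\<in>support_chains X Y (Suc m). ?w c)"
    by (rule sum.atMost_Suc_shift)
  also have "(\<Sum>m\<le>M. \<Sum>c\<in>support_chains X Y (Suc m). ?w c)
      = (\<Sum>Z\<in>?S. card (Q Z X) * (\<Sum>m\<le>M. \<Sum>c\<in>support_chains Z Y m. ?w c))"
    unfolding step by (subst sum.swap) (simp add: sum_distrib_left)
  also have "\<dots> \<le> (\<Sum>Z\<in>?S. card (Q Z X) * alg_space.dim (corner Y Z))"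
    using Suc.IH by (intro sum_mono mult_left_mono) auto
  finally have le: "(\<Sum>m\<le>Suc M. \<Sum>c\<in>support_chains X Y m. ?w c)
      \<le> (\<Sum>c\<in>support_chains X Y 0. ?w c) + (\<Sum>Z\<in>?S. card (Q Z X) * alg_space.dim (corner Y Z))" by simp
  show ?case
  proof (cases "X = Y")
    case True
    \<comment> \<open>No support strictly above \<open>Y\<close> leads back to \<open>Y\<close>, so
      only the trivial chain contributes.\<close>
    have "alg_space.dim (corner Y Z) = 0" if "Z \<in> ?S" for Z
    proof -
      have "corner Y Z = {0}" using that True Y by (intro corner_not_subset) auto
      then show ?thesis by (simp only: alg_fd.dim_eq_0)
    qed
    then have "(\<Sum>Z\<in>?S. card (Q Z X) * alg_space.dim (corner Y Z)) = 0" by simp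
    moreover have "(\<Sum>c\<in>support_chains X Y 0. ?w c) \<le> alg_space.dim (corner Y X)"
      using Suc.IH[OF Suc.prems] by (rule order_trans[rotated]) (auto intro: member_le_sum)
    ultimately show ?thesis using le by linarith
  next
    case False
    then have "(\<Sum>c\<in>support_chains X Y 0. ?w c) = 0" using Suc.prems by (simp add: support_chains_0)
    moreover have "(\<Sum>Z\<in>?S. card (Q Z X) * alg_space.dim (corner Y Z)) \<le> alg_space.dim (corner Y X)"
      using Suc.prems Q Y by (intro dim_step) auto
    ultimately show ?thesis using le by linarith
  qed
qed

end

section \<open>Equivariance and Maschke's theorem\<close>

locale equivariant_idempotents = standard_idempotents E + group G
  for E :: "'b::left_regular_band set \<Rightarrow> ('b, 'k::field) semigroup_algebra"
    and G :: "('g, 'm) monoid_scheme" +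
  fixes \<phi> :: "'g \<Rightarrow> 'b \<Rightarrow> 'b"
  assumes finite_G: "finite (carrier G)"
    and action: "lrb_action G \<phi>"
    and invariant: "invariant_family G \<phi> E"
    and char_not_dvd: "\<not> CHAR('k) dvd order G"
begin

lemma \<phi>_bij: "g \<in> carrier G \<Longrightarrow> bij (\<phi> g)"
  using action unfolding lrb_action_def by (metis group_action.bij_prop0 bij_betw_def Bij_def IntD2 group_action.surj_prop group_action.inj_prop)

lemma \<phi>_hom: "g \<in> carrier G \<Longrightarrow> \<phi> g (x * y) = \<phi> g x * \<phi> g y"
  using action unfolding lrb_action_def by blast

lemma \<phi>_mult: "g \<in> carrier G \<Longrightarrow> h \<in> carrier G \<Longrightarrow> \<phi> (g \<otimes>\<^bsub>G\<^esub> h) x = \<phi> g (\<phi> h x)"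
  using action unfolding lrb_action_def by (meson group_action.composition_rule UNIV_I)

lemma \<phi>_one: "\<phi> \<one>\<^bsub>G\<^esub> = (\<lambda>x. x)"
  using action group_action.id_eq_one[of G UNIV \<phi>] unfolding lrb_action_def by (auto simp: fun_eq_iff)

lemma \<phi>_inj: "g \<in> carrier G \<Longrightarrow> inj (\<phi> g)"
  using \<phi>_bij bij_def by blast

lemma \<phi>_supp: "g \<in> carrier G \<Longrightarrow> \<phi> g ` supp b = supp (\<phi> g b)"
  by (intro image_supp \<phi>_bij \<phi>_hom)

lemma \<phi>_supports: "g \<in> carrier G \<Longrightarrow> X \<in> supports \<Longrightarrow> \<phi> g ` X \<in> supports"
  by (metis \<phi>_supp supp_in_supports supports_obtain)

lemma \<phi>_psubset: "g \<in> carrier G \<Longrightarrow> \<phi> g ` X \<subset> \<phi> g ` Z \<longleftrightarrow> X \<subset> Z"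
  using \<phi>_inj by (simp add: inj_image_subset_iff psubset_eq inj_image_eq_iff)

lemma \<phi>_image_mult:
  "g \<in> carrier G \<Longrightarrow> h \<in> carrier G \<Longrightarrow> \<phi> (g \<otimes>\<^bsub>G\<^esub> h) ` X = \<phi> g ` \<phi> h ` X"
  by (simp add: \<phi>_mult image_image)

lemma \<phi>_image_inv: "g \<in> carrier G \<Longrightarrow> \<phi> (inv\<^bsub>G\<^esub> g) ` \<phi> g ` X = X"
  using \<phi>_image_mult[of "inv\<^bsub>G\<^esub> g" g X] by (simp add: \<phi>_one)

definition move :: "'g \<Rightarrow> ('b, 'k) semigroup_algebra \<Rightarrow> ('b, 'k) semigroup_algebra" where
  "move g = alg_map (\<phi> g)"

lemma move_linear: "alg_linear (move g)"
  unfolding move_def by (rule alg_linear_alg_map)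

lemma move_delta: "move g (delta b) = delta (\<phi> g b)"
  by (simp add: move_def)

lemma move_times: "g \<in> carrier G \<Longrightarrow> move g (x * y) = move g x * move g y"
  unfolding move_def by (rule alg_map_mult) (rule \<phi>_hom)

lemma move_mult: "g \<in> carrier G \<Longrightarrow> h \<in> carrier G \<Longrightarrow> move (g \<otimes>\<^bsub>G\<^esub> h) x = move g (move h x)"
proof -
  assume "g \<in> carrier G" "h \<in> carrier G"
  then have "\<phi> (g \<otimes>\<^bsub>G\<^esub> h) = (\<lambda>b. \<phi> g (\<phi> h b))" by (simp add: fun_eq_iff \<phi>_mult)
  then show ?thesis by (simp add: move_def alg_map_comp)
qed

lemma move_one: "move \<one>\<^bsub>G\<^esub> x = x"
  by (simp add: move_def \<phi>_one alg_map_id)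

lemma move_inv: "g \<in> carrier G \<Longrightarrow> move (inv\<^bsub>G\<^esub> g) (move g x) = x"
  and move_inv': "g \<in> carrier G \<Longrightarrow> move g (move (inv\<^bsub>G\<^esub> g) x) = x"
  by (simp_all add: move_one flip: move_mult)

lemma move_E: "g \<in> carrier G \<Longrightarrow> X \<in> supports \<Longrightarrow> move g (E X) = E (\<phi> g ` X)"
  using invariant unfolding invariant_family_def move_def by blast

lemma move_corner:
  assumes "g \<in> carrier G" "X \<in> supports" "Y \<in> supports" "x \<in> corner Y X"
  shows "move g x \<in> corner (\<phi> g ` Y) (\<phi> g ` X)"
proof -
  obtain a where "x = E Y * a * E X" using assms(4) by (auto simp: corner_def)
  then have "move g x = E (\<phi> g ` Y) * move g a * E (\<phi> g ` X)"
    using assms by (simp add: move_times move_E)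
  then show ?thesis by (auto simp: corner_def)
qed

lemma move_decomposables:
  assumes g: "g \<in> carrier G" and X: "X \<in> supports" and Y: "Y \<in> supports" and x: "x \<in> decomposables Y X"
  shows "move g x \<in> decomposables (\<phi> g ` Y) (\<phi> g ` X)"
proof (rule alg_linear_span_subset[OF move_linear decomposables_subspace _ x[unfolded decomposables_def]])
  fix z assume "z \<in> {x * y | x y. \<exists>Z\<in>supports. X \<subset> Z \<and> Z \<subset> Y \<and> x \<in> corner Y Z \<and> y \<in> corner Z X}"
  then obtain x y Z where z: "z = x * y"
    and Z: "Z \<in> supports" "X \<subset> Z" "Z \<subset> Y" "x \<in> corner Y Z" "y \<in> corner Z X" by blast
  have "move g x * move g y \<in> decomposables (\<phi> g ` Y) (\<phi> g ` X)"
  proof (rule mult_in_decomposables)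
    show "\<phi> g ` Z \<in> supports" using \<phi>_supports g Z by blast
    show "\<phi> g ` X \<subset> \<phi> g ` Z" "\<phi> g ` Z \<subset> \<phi> g ` Y" using \<phi>_psubset[OF g] Z by simp_all
    show "move g x \<in> corner (\<phi> g ` Y) (\<phi> g ` Z)" "move g y \<in> corner (\<phi> g ` Z) (\<phi> g ` X)"
      using move_corner g X Y Z by simp_all
  qed
  then show "move g z \<in> decomposables (\<phi> g ` Y) (\<phi> g ` X)" using z g by (simp add: move_times)
qed

lemma in_stab: "g \<in> stab G \<phi> X \<longleftrightarrow> g \<in> carrier G \<and> \<phi> g ` X = X"
  by (auto simp: stab_def stabilizer_def)

lemma stab_subgroup: "subgroup (stab G \<phi> X) G"
proof (rule subgroup.intro)
  show "stab G \<phi> X \<subseteq> carrier G" by (auto simp: in_stab)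
  fix g h assume "g \<in> stab G \<phi> X" "h \<in> stab G \<phi> X"
  then show "g \<otimes>\<^bsub>G\<^esub> h \<in> stab G \<phi> X" by (simp add: in_stab \<phi>_image_mult)
next
  show "\<one>\<^bsub>G\<^esub> \<in> stab G \<phi> X" by (simp add: in_stab \<phi>_one)
next
  fix g assume "g \<in> stab G \<phi> X"
  then show "inv\<^bsub>G\<^esub> g \<in> stab G \<phi> X" by (metis in_stab \<phi>_image_inv inv_closed)
qed

text \<open>Average a linear projection onto \<open>D\<close> over \<open>K\<close>, whose order
  divides that of \<open>G\<close> and so is invertible. The result \<open>p\<close> is an
  equivariant projection onto \<open>D\<close>; what is delivered is its complement
  \<open>\<pi>\<close>, whose kernel is exactly \<open>D\<close>.\<close>

lemma maschke:
  assumes K: "subgroup K G" and D: "alg_space.subspace D"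
    and D_inv: "\<And>g x. g \<in> K \<Longrightarrow> x \<in> D \<Longrightarrow> move g x \<in> D"
  obtains \<pi> where "alg_linear \<pi>" "\<And>x. x - \<pi> x \<in> D" "\<And>x. x \<in> D \<Longrightarrow> \<pi> x = 0"
    "\<And>g x. g \<in> K \<Longrightarrow> \<pi> (move g x) = move g (\<pi> x)"
proof -
  interpret vsp: vector_space_pair "alg_scale :: 'k \<Rightarrow> ('b, 'k) semigroup_algebra \<Rightarrow> _"
      "alg_scale :: 'k \<Rightarrow> ('b, 'k) semigroup_algebra \<Rightarrow> _"
    by unfold_locales
  have lin: "Vector_Spaces.linear alg_scale alg_scale (\<lambda>x. x :: ('b, 'k) semigroup_algebra)"
    using alg_linear_id by (simp add: alg_linear_iff)
  obtain q where "q ` UNIV \<subseteq> D \<and> Vector_Spaces.linear alg_scale alg_scale q \<and> (\<forall>x\<in>D. q x = x)"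
    using vsp.linear_exists_left_inverse_on[OF lin D inj_on_id2] by (elim exE)
  then have q: "q ` UNIV \<subseteq> D" "alg_linear q" "\<And>x. x \<in> D \<Longrightarrow> q x = x"
    by (simp_all add: alg_linear_iff)
  have KG: "g \<in> K \<Longrightarrow> g \<in> carrier G" for g by (rule subgroup.mem_carrier[OF K])
  have finK: "finite K" by (rule finite_subset[OF subgroup.subset[OF K] finite_G])
  have "card K dvd order G" unfolding lagrange[OF K, symmetric] by (rule dvd_triv_right)
  then have cardK: "of_nat (card K) \<noteq> (0 :: 'k)"
    using char_not_dvd dvd_trans unfolding of_nat_eq_0_iff_char_dvd by blast
  define s where "s x = (\<Sum>k\<in>K. move k (q (move (inv\<^bsub>G\<^esub> k) x)))" for x
  define p where "p x = alg_scale (1 / of_nat (card K)) (s x)" for x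
  have s_lin: "alg_linear s" unfolding s_def
    by (intro alg_linear_sum_fun alg_linear_compose[OF move_linear] alg_linear_compose[OF q(2)] move_linear)
  have p_lin: "alg_linear p"
    using s_lin unfolding p_def alg_linear_def
    by (simp add: alg_space.scale_right_distrib alg_space.scale_left_commute)
  have p_D: "p x \<in> D" for x
    unfolding p_def s_def
    by (intro alg_space.subspace_scale alg_space.subspace_sum D D_inv) (use q(1) in auto)
  have p_id: "p x = x" if x: "x \<in> D" for x
  proof -
    have "move k (q (move (inv\<^bsub>G\<^esub> k) x)) = x" if k: "k \<in> K" for k
    proof -
      have "inv\<^bsub>G\<^esub> k \<in> K" by (rule subgroup.m_inv_closed[OF K k])
      then have "move (inv\<^bsub>G\<^esub> k) x \<in> D" using D_inv x by blast
      then show ?thesis using q(3) KG k by (simp add: move_inv')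
    qed
    then have "s x = (\<Sum>k\<in>K. x)" unfolding s_def by (intro sum.cong) auto
    also have "\<dots> = alg_scale (of_nat (card K)) x"
      by (simp add: alg_space.sum_constant_scale)
    finally show ?thesis using cardK by (simp add: p_def)
  qed
  have p_equiv: "p (move g x) = move g (p x)" if g: "g \<in> K" for g x
  proof -
    \<comment> \<open>Left translation by \<open>g\<close> permutes \<open>K\<close>; this change of
      index makes the average commute with \<open>g\<close>.\<close>
    have bij: "bij_betw (\<lambda>k. g \<otimes>\<^bsub>G\<^esub> k) K K"
    proof (rule bij_betw_byWitness[where f' = "\<lambda>k. inv\<^bsub>G\<^esub> g \<otimes>\<^bsub>G\<^esub> k"])
      show "\<forall>k\<in>K. inv\<^bsub>G\<^esub> g \<otimes>\<^bsub>G\<^esub> (g \<otimes>\<^bsub>G\<^esub> k) = k" "\<forall>k\<in>K. g \<otimes>\<^bsub>G\<^esub> (inv\<^bsub>G\<^esub> g \<otimes>\<^bsub>G\<^esub> k) = k"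
        using KG g by (simp_all flip: m_assoc)
    qed (use K g in \<open>auto simp: subgroup.m_closed subgroup.m_inv_closed\<close>)
    have "s (move g x) = (\<Sum>k\<in>K. move (g \<otimes>\<^bsub>G\<^esub> k) (q (move (inv\<^bsub>G\<^esub> (g \<otimes>\<^bsub>G\<^esub> k)) (move g x))))"
      unfolding s_def by (rule sum.reindex_bij_betw[OF bij, symmetric])
    also have "\<dots> = (\<Sum>k\<in>K. move g (move k (q (move (inv\<^bsub>G\<^esub> k) x))))"
    proof (rule sum.cong[OF refl])
      fix k assume k: "k \<in> K"
      have "inv\<^bsub>G\<^esub> (g \<otimes>\<^bsub>G\<^esub> k) \<otimes>\<^bsub>G\<^esub> g = inv\<^bsub>G\<^esub> k"
        using KG g k by (simp add: inv_mult_group m_assoc)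
      then have "move (inv\<^bsub>G\<^esub> (g \<otimes>\<^bsub>G\<^esub> k)) (move g x) = move (inv\<^bsub>G\<^esub> k) x"
        using KG g k by (simp flip: move_mult)
      then show "move (g \<otimes>\<^bsub>G\<^esub> k) (q (move (inv\<^bsub>G\<^esub> (g \<otimes>\<^bsub>G\<^esub> k)) (move g x)))
          = move g (move k (q (move (inv\<^bsub>G\<^esub> k) x)))"
        using KG g k by (simp add: move_mult)
    qed
    also have "\<dots> = move g (s x)" unfolding s_def by (simp add: alg_linear_sum[OF move_linear])
    finally show ?thesis by (simp add: p_def alg_linear_scale[OF move_linear])
  qed
  show ?thesis
  proof (rule that[of "\<lambda>x. x - p x"])
    show "alg_linear (\<lambda>x. x - p x)"
      using p_lin by (simp add: alg_linear_def alg_space.scale_right_diff_distrib)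
    show "x - (x - p x) \<in> D" for x using p_D by simp
    show "x - p x = 0" if "x \<in> D" for x using p_id that by simp
    show "move g x - p (move g x) = move g (x - p x)" if "g \<in> K" for g x
      using p_equiv[OF that] by (simp add: alg_linear_diff[OF move_linear])
  qed
qed

text \<open>\<open>\<pi>\<close> picks one representative in each class modulo
  \<open>D(Y,X)\<close>, compatibly with the stabilizer of both supports. It lives on the whole
  algebra and preserves the corner because \<open>D(Y,X)\<close> lies in it.\<close>

definition splitting where
  "splitting Y X \<pi> \<longleftrightarrow> alg_linear \<pi> \<and> (\<forall>x. x - \<pi> x \<in> decomposables Y X) \<and>
     (\<forall>x\<in>decomposables Y X. \<pi> x = 0) \<and>
     (\<forall>g\<in>stab G \<phi> X \<inter> stab G \<phi> Y. \<forall>x. \<pi> (move g x) = move g (\<pi> x))"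

text \<open>The arrows are a basis of the image of the corner under \<open>\<pi>\<close>, not of an
  arbitrary complement. Being fixed by \<open>\<pi>\<close>, an arrow is returned when its class is
  lifted.\<close>

lemma ex_splitting:
  assumes X: "X \<in> supports" and Y: "Y \<in> supports"
  shows "\<exists>\<pi> Q. splitting Y X \<pi> \<and> arrows Y X Q \<and> (\<forall>v\<in>Q. \<pi> v = v)"
proof -
  have K: "subgroup (stab G \<phi> X \<inter> stab G \<phi> Y) G"
    by (intro subgroups_Inter_pair stab_subgroup)
  have "move g x \<in> decomposables Y X" if "g \<in> stab G \<phi> X \<inter> stab G \<phi> Y" "x \<in> decomposables Y X" for g x
    using move_decomposables[OF _ X Y that(2), of g] that(1) by (auto simp: in_stab)
  then obtain \<pi> where \<pi>: "alg_linear \<pi>" "\<And>x. x - \<pi> x \<in> decomposables Y X" "\<And>x. x \<in> decomposables Y X \<Longrightarrow> \<pi> x = 0"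
    "\<And>g x. g \<in> stab G \<phi> X \<inter> stab G \<phi> Y \<Longrightarrow> \<pi> (move g x) = move g (\<pi> x)"
    using maschke[OF K decomposables_subspace] by metis
  have split: "splitting Y X \<pi>" unfolding splitting_def using \<pi> by blast
  obtain Q where Q: "Q \<subseteq> \<pi> ` corner Y X" "alg_space.independent Q" "\<pi> ` corner Y X \<subseteq> alg_space.span Q"
    using alg_space.basis_exists[of "\<pi> ` corner Y X"] by metis
  have finQ: "finite Q" by (rule alg_fd.finiteI_independent[OF Q(2)])
  have fixed: "\<pi> v = v" if v: "v \<in> Q" for v
  proof -
    obtain x where "v = \<pi> x" using v Q by blast
    moreover have "\<pi> (x - \<pi> x) = 0" using \<pi> by blast
    ultimately show ?thesis by (simp add: alg_linear_diff[OF \<pi>(1)])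
  qed
  have "arrows Y X Q" unfolding arrows_def
  proof (intro conjI allI impI finQ)
    show "Q \<subseteq> corner Y X"
    proof
      fix v assume "v \<in> Q"
      then obtain x where x: "v = \<pi> x" "x \<in> corner Y X" using Q by blast
      have "x - \<pi> x \<in> corner Y X" using \<pi>(2)[of x] decomposables_subset_corner[OF X Y] by blast
      then have "x - (x - \<pi> x) \<in> corner Y X"
        by (rule alg_space.subspace_diff[OF corner_subspace x(2)])
      then show "v \<in> corner Y X" using x by simp
    qed
    show "corner Y X \<subseteq> alg_space.span (Q \<union> decomposables Y X)"
    proof
      fix x assume "x \<in> corner Y X"
      then have "\<pi> x \<in> alg_space.span (Q \<union> decomposables Y X)"
        using Q(3) alg_space.span_mono[of Q "Q \<union> decomposables Y X"] by blast
      moreover have "x - \<pi> x \<in> alg_space.span (Q \<union> decomposables Y X)"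
        using \<pi>(2) by (intro alg_space.span_base) blast
      ultimately have "\<pi> x + (x - \<pi> x) \<in> alg_space.span (Q \<union> decomposables Y X)"
        by (rule alg_space.span_add)
      then show "x \<in> alg_space.span (Q \<union> decomposables Y X)" by simp
    qed
    fix c assume "(\<Sum>v\<in>Q. alg_scale (c v) v) \<in> decomposables Y X"
    then have "\<pi> (\<Sum>v\<in>Q. alg_scale (c v) v) = 0" by (rule \<pi>(3))
    then have "(\<Sum>v\<in>Q. alg_scale (c v) v) = 0"
      using fixed by (simp add: alg_linear_sum[OF \<pi>(1)] alg_linear_scale[OF \<pi>(1)])
    then show "\<forall>v\<in>Q. c v = 0"
      using alg_space.independentD[OF Q(2) finQ subset_refl] by blast
  qed
  then show ?thesis using split fixed by blast
qed

text \<open>Moving by \<open>g\<close> identifies the two quotients by decomposables, whose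
  dimensions are the numbers of arrows. Concretely, the moved arrows projected by
  \<open>\<pi>\<close> are independent in the span of \<open>Q'\<close>.\<close>

lemma card_arrows_le:
  assumes g: "g \<in> carrier G" and X: "X \<in> supports" and Y: "Y \<in> supports"
    and Q: "arrows Y X Q" and Q': "arrows (\<phi> g ` Y) (\<phi> g ` X) Q'"
    and split: "splitting (\<phi> g ` Y) (\<phi> g ` X) \<pi>" and fixed: "\<And>v. v \<in> Q' \<Longrightarrow> \<pi> v = v"
  shows "card Q \<le> card Q'"
proof -
  have \<pi>: "alg_linear \<pi>" "\<And>x. x - \<pi> x \<in> decomposables (\<phi> g ` Y) (\<phi> g ` X)"
    "\<And>x. x \<in> decomposables (\<phi> g ` Y) (\<phi> g ` X) \<Longrightarrow> \<pi> x = 0"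
    using split unfolding splitting_def by blast+
  have fin: "finite Q" "finite Q'" using Q Q' by (auto simp: arrows_def)
  have indep: "\<forall>c. (\<Sum>v\<in>Q. alg_scale (c v) v) \<in> decomposables Y X \<longrightarrow> (\<forall>v\<in>Q. c v = 0)"
    using Q unfolding arrows_def by (elim conjE)
  have "card Q \<le> alg_space.dim (alg_space.span Q')"
  proof (rule card_le_dim_family[OF fin(1), where x = "\<lambda>v. \<pi> (move g v)"])
    show "(\<lambda>v. \<pi> (move g v)) ` Q \<subseteq> alg_space.span Q'"
    proof
      fix y assume "y \<in> (\<lambda>v. \<pi> (move g v)) ` Q"
      then obtain v where v: "y = \<pi> (move g v)" "v \<in> Q" by blast
      then have "move g v \<in> corner (\<phi> g ` Y) (\<phi> g ` X)"
        using move_corner[OF g X Y] Q unfolding arrows_def by blast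
      then have *: "move g v \<in> alg_space.span (Q' \<union> decomposables (\<phi> g ` Y) (\<phi> g ` X))"
        using Q' unfolding arrows_def by blast
      show "y \<in> alg_space.span Q'" unfolding v(1)
        by (rule alg_linear_span_subset[OF \<pi>(1) alg_space.subspace_span _ *])
          (use fixed \<pi>(3) in \<open>auto intro: alg_space.span_base alg_space.span_zero\<close>)
    qed
    fix c v assume "(\<Sum>v\<in>Q. alg_scale (c v) (\<pi> (move g v))) = 0" and v: "v \<in> Q"
    then have 0: "\<pi> (move g (\<Sum>v\<in>Q. alg_scale (c v) v)) = 0"
      by (simp add: alg_linear_sum[OF \<pi>(1)] alg_linear_scale[OF \<pi>(1)]
          alg_linear_sum[OF move_linear] alg_linear_scale[OF move_linear])
    let ?x = "\<Sum>v\<in>Q. alg_scale (c v) v"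
    have "move g ?x \<in> decomposables (\<phi> g ` Y) (\<phi> g ` X)" using \<pi>(2)[of "move g ?x"] 0 by simp
    then have "move (inv\<^bsub>G\<^esub> g) (move g ?x)
        \<in> decomposables (\<phi> (inv\<^bsub>G\<^esub> g) ` \<phi> g ` Y) (\<phi> (inv\<^bsub>G\<^esub> g) ` \<phi> g ` X)"
      by (rule move_decomposables[OF inv_closed[OF g] \<phi>_supports[OF g X] \<phi>_supports[OF g Y]])
    then have "?x \<in> decomposables Y X" by (simp only: move_inv[OF g] \<phi>_image_inv[OF g])
    then show "c v = 0" using indep v by blast
  qed
  also have "\<dots> \<le> card Q'" by (rule alg_space.dim_le_card[OF subset_refl fin(2)])
  finally show ?thesis .
qed

end

section \<open>Linear maps on free spaces\<close>

text \<open>Linear extension from a basis, with \<open>h s a\<close> in the role of \<open>a\<close>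
  times the image of \<open>s\<close>. Group actions, boundaries and maps into the algebra are all
  of this form.\<close>

definition ksum :: "('s \<Rightarrow> 'k \<Rightarrow> 'v) \<Rightarrow> ('s \<Rightarrow>\<^sub>0 'k::zero) \<Rightarrow> 'v::comm_monoid_add" where
  "ksum h u = (\<Sum>s\<in>Poly_Mapping.keys u. h s (Poly_Mapping.lookup u s))"

lemma ksum_superset:
  assumes "finite A" "Poly_Mapping.keys u \<subseteq> A" "\<And>s. h s 0 = 0"
  shows "ksum h u = (\<Sum>s\<in>A. h s (Poly_Mapping.lookup u s))"
  unfolding ksum_def using assms by (intro sum.mono_neutral_left) (auto simp: in_keys_iff)

lemma ksum_single: "h s 0 = 0 \<Longrightarrow> ksum h (Poly_Mapping.single s c) = h s c"
  by (simp add: ksum_def)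

lemma ksum_add:
  fixes h :: "'s \<Rightarrow> 'k::field \<Rightarrow> 'v::ab_group_add"
  assumes "\<And>s a b. h s (a + b) = h s a + h s b"
  shows "ksum h (u + v) = ksum h u + ksum h v"
proof -
  have h0: "h s 0 = 0" for s using assms[of s 0 0] by simp
  let ?A = "Poly_Mapping.keys u \<union> Poly_Mapping.keys v"
  have "ksum h w = (\<Sum>s\<in>?A. h s (Poly_Mapping.lookup w s))" if "w \<in> {u, v, u + v}" for w
    using that keys_add[of u v] by (intro ksum_superset h0) auto
  then show ?thesis by (simp add: lookup_add assms sum.distrib)
qed

lemma ksum_diff:
  fixes h :: "'s \<Rightarrow> 'k::field \<Rightarrow> 'v::ab_group_add"
  assumes "\<And>s a b. h s (a + b) = h s a + h s b"
  shows "ksum h (u - v) = ksum h u - ksum h v"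
  using ksum_add[of h "u - v" v] assms by (simp add: algebra_simps)

text \<open>The scaling \<open>f\<close> of the target is kept abstract, since the targets are both
  the semigroup algebra and other free spaces.\<close>

lemma ksum_scale:
  fixes h :: "'s \<Rightarrow> 'k::field \<Rightarrow> 'v::ab_group_add"
  assumes "\<And>s. h s 0 = 0" "\<And>s a. h s (c * a) = f (h s a)" "f 0 = 0" "\<And>x y. f (x + y) = f x + f y"
  shows "ksum h (free_scale c u) = f (ksum h u)"
proof -
  have "Poly_Mapping.keys (free_scale c u) \<subseteq> Poly_Mapping.keys u" by (auto simp: in_keys_iff)
  then have "ksum h (free_scale c u) = (\<Sum>s\<in>Poly_Mapping.keys u. f (h s (Poly_Mapping.lookup u s)))"
    using assms by (subst ksum_superset[of "Poly_Mapping.keys u"]) auto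
  also have "\<dots> = f (ksum h u)"
  proof -
    have "(\<Sum>s\<in>A. f (h s (Poly_Mapping.lookup u s))) = f (\<Sum>s\<in>A. h s (Poly_Mapping.lookup u s))" for A
      by (induction A rule: infinite_finite_induct) (auto simp: assms)
    then show ?thesis by (simp add: ksum_def)
  qed
  finally show ?thesis .
qed

lemma free_scale_single [simp]: "free_scale c (Poly_Mapping.single s a) = Poly_Mapping.single s (c * a)"
  by (rule poly_mapping_eqI) (simp add: lookup_single when_def)

lemma poly_mapping_expand:
  "u = (\<Sum>s\<in>Poly_Mapping.keys u. free_scale (Poly_Mapping.lookup u s) (Poly_Mapping.single s 1))"
proof (rule poly_mapping_eqI)
  fix t
  have "(\<Sum>s\<in>Poly_Mapping.keys u. Poly_Mapping.lookup u s when s = t)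
      = (\<Sum>s\<in>Poly_Mapping.keys u. if s = t then Poly_Mapping.lookup u s else 0)"
    by (intro sum.cong) (auto simp: when_def)
  also have "\<dots> = Poly_Mapping.lookup u t" by (simp add: in_keys_iff)
  finally show "Poly_Mapping.lookup u t = Poly_Mapping.lookup
      (\<Sum>s\<in>Poly_Mapping.keys u. free_scale (Poly_Mapping.lookup u s) (Poly_Mapping.single s 1)) t"
    by (simp add: lookup_sum lookup_single)
qed

lemma keys_subset_span:
  "Poly_Mapping.keys u \<subseteq> S \<Longrightarrow> u \<in> free_space.span ((\<lambda>s. Poly_Mapping.single s 1) ` S)"
  by (subst poly_mapping_expand) (intro free_space.span_sum free_space.span_scale free_space.span_base, blast)

lemma keys_subspace: "free_space.subspace {u :: 's \<Rightarrow>\<^sub>0 'k::field. Poly_Mapping.keys u \<subseteq> S}"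
proof (rule free_space.subspaceI)
  show "x + y \<in> {u. Poly_Mapping.keys u \<subseteq> S}"
    if "x \<in> {u. Poly_Mapping.keys u \<subseteq> S}" "y \<in> {u. Poly_Mapping.keys u \<subseteq> S}" for x y :: "'s \<Rightarrow>\<^sub>0 'k"
    using that keys_add[of x y] by auto
qed (auto simp: in_keys_iff)

lemma act_free_rep: "act (free_rep S \<alpha>) g = ksum (\<lambda>s a. Poly_Mapping.single (\<alpha> g s) a)"
  by (auto simp: free_rep_def ksum_def)

lemma act_free_rep_add:
  "act (free_rep S \<alpha>) g (u + v) = act (free_rep S \<alpha>) g u + act (free_rep S \<alpha>) g v"
  and act_free_rep_diff:
  "act (free_rep S \<alpha>) g (u - v) = act (free_rep S \<alpha>) g u - act (free_rep S \<alpha>) g v"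
  and act_free_rep_scale:
  "act (free_rep S \<alpha>) g (free_scale c u) = free_scale c (act (free_rep S \<alpha>) g u)"
  and act_free_rep_single:
  "act (free_rep S \<alpha>) g (Poly_Mapping.single s c) = Poly_Mapping.single (\<alpha> g s) c"
  unfolding act_free_rep
  by (simp_all add: ksum_add single_add ksum_diff ksum_single)
    (rule ksum_scale; simp add: free_space.scale_right_distrib)

lemma boundary_ksum: "boundary = ksum (\<lambda>xs a. \<Sum>i<length xs. Poly_Mapping.single (take i xs @ drop (Suc i) xs) ((- 1) ^ i * a))"
  by (auto simp: boundary_def ksum_def)

lemma boundary_add: "boundary (u + v) = boundary u + boundary v"
  and boundary_scale: "boundary (free_scale c u) = free_scale c (boundary u)"
  unfolding boundary_ksum
   apply (rule ksum_add) apply (simp add: distrib_left single_add sum.distrib)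
  apply (rule ksum_scale) apply (simp_all add: free_space.scale_right_distrib free_space.scale_sum_right mult.left_commute)
  done

lemma boundary_single: "boundary (Poly_Mapping.single xs c)
    = (\<Sum>i<length xs. Poly_Mapping.single (take i xs @ drop (Suc i) xs) ((- 1) ^ i * c))"
  unfolding boundary_ksum by (rule ksum_single) simp

lemma linear_span_image:
  assumes "\<And>u v. F (u + v) = F u + F v" "\<And>c u. F (free_scale c u) = sc c (F u)"
    and "x \<in> free_space.span S" and "F 0 \<in> U" "\<And>u v. u \<in> U \<Longrightarrow> v \<in> U \<Longrightarrow> u + v \<in> U"
    and "\<And>c u. u \<in> U \<Longrightarrow> sc c u \<in> U" and "\<And>s. s \<in> S \<Longrightarrow> F s \<in> U"
  shows "F x \<in> U"
  using assms(3)
proof (induction rule: free_space.span_induct_alt)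
  case base
  then show ?case using assms(4) .
next
  case (step c x y)
  then show ?case by (simp add: assms)
qed


section \<open>The zeroth reduced homology\<close>

text \<open>The linear span in terms of the operations stored in the record, as quotient carriers
  have no type class structure of their own.\<close>

inductive_set generated :: "('r, 'k, 'v) rep \<Rightarrow> 'v set \<Rightarrow> 'v set" for V S where
  zero: "vzero V \<in> generated V S"
| base: "s \<in> S \<Longrightarrow> s \<in> generated V S"
| add: "v \<in> generated V S \<Longrightarrow> w \<in> generated V S \<Longrightarrow> vadd V v w \<in> generated V S"
| scale: "v \<in> generated V S \<Longrightarrow> vscale V c v \<in> generated V S"

text \<open>A weak form of being a representation. It suffices for spanning sets to pass to tensor
  products and induced representations, and for the inverse of a bijective homomorphism to be a
  homomorphism.\<close>

definition operator_space :: "'r set \<Rightarrow> ('r, 'k::field, 'v) rep \<Rightarrow> bool" where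
  "operator_space K V \<longleftrightarrow> vzero V \<in> carrier V \<and>
     (\<forall>v\<in>carrier V. \<forall>w\<in>carrier V. vadd V v w \<in> carrier V) \<and>
     (\<forall>c. \<forall>v\<in>carrier V. vscale V c v \<in> carrier V) \<and>
     (\<forall>v\<in>carrier V. vscale V 0 v = vzero V) \<and>
     (\<forall>g\<in>K. \<forall>v\<in>carrier V. act V g v \<in> carrier V) \<and>
     (\<forall>g\<in>K. \<forall>v\<in>carrier V. \<forall>w\<in>carrier V. act V g (vadd V v w) = vadd V (act V g v) (act V g w)) \<and>
     (\<forall>g\<in>K. \<forall>c. \<forall>v\<in>carrier V. act V g (vscale V c v) = vscale V c (act V g v))"

lemma generated_subset:
  assumes "operator_space K V" "S \<subseteq> carrier V"
  shows "generated V S \<subseteq> carrier V"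
proof
  fix v assume "v \<in> generated V S"
  then show "v \<in> carrier V"
    by induction (use assms in \<open>auto simp: operator_space_def\<close>)
qed

definition edges :: "'b::left_regular_band set \<Rightarrow> ('b list \<Rightarrow>\<^sub>0 'k::field) set" where
  "edges P = {Poly_Mapping.single [q] 1 - Poly_Mapping.single [p] 1 | p q. p \<in> P \<and> q \<in> P \<and> lrb_less p q}"

text \<open>The boundary of the 1-simplex \<open>[p, q]\<close> is \<open>[q] - [p]\<close>, and a
  linear map sends a span to the span of the images. The number 2 counts vertices.\<close>

lemma boundaries_span_edges:
  "boundary ` carrier (simplicial_chains lrb_less P \<alpha> 2 :: ('r, 'k::field, 'b::left_regular_band list \<Rightarrow>\<^sub>0 'k) rep)
     = free_space.span (edges P)"
proof -
  let ?S = "order_simplices lrb_less P 2"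
  have carrier: "carrier (simplicial_chains lrb_less P \<alpha> 2 :: ('r, 'k, 'b list \<Rightarrow>\<^sub>0 'k) rep) = {u. Poly_Mapping.keys u \<subseteq> ?S}"
    by (simp add: simplicial_chains_def free_rep_def)
  have simplex: "xs \<in> ?S \<longleftrightarrow> (\<exists>p q. xs = [p, q] \<and> p \<in> P \<and> q \<in> P \<and> lrb_less p q)" for xs
    by (auto simp: order_simplices_def numeral_2_eq_2 length_Suc_conv)
  have bd: "boundary (Poly_Mapping.single [p, q] 1) = Poly_Mapping.single [q] 1 - (Poly_Mapping.single [p] 1 :: 'b list \<Rightarrow>\<^sub>0 'k)" for p q
    by (simp add: boundary_single numeral_2_eq_2 single_uminus)
  show ?thesis unfolding carrier
  proof (intro equalityI subsetI)
    fix x assume "x \<in> boundary ` {u :: 'b list \<Rightarrow>\<^sub>0 'k. Poly_Mapping.keys u \<subseteq> ?S}"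
    then obtain u :: "'b list \<Rightarrow>\<^sub>0 'k" where u: "x = boundary u" "Poly_Mapping.keys u \<subseteq> ?S" by blast
    show "x \<in> free_space.span (edges P)" unfolding u(1)
    proof (rule linear_span_image[OF boundary_add boundary_scale keys_subset_span[OF u(2)]])
      fix s :: "'b list \<Rightarrow>\<^sub>0 'k" assume "s \<in> (\<lambda>s. Poly_Mapping.single s 1) ` ?S"
      then obtain p q where "p \<in> P" "q \<in> P" "lrb_less p q" "s = Poly_Mapping.single [p, q] 1"
        by (auto simp: simplex)
      then show "boundary s \<in> free_space.span (edges P)"
        unfolding edges_def by (auto simp: bd intro!: free_space.span_base)
    qed (auto simp: boundary_def intro: free_space.span_zero free_space.span_add free_space.span_scale)
  next
    fix x assume x: "x \<in> free_space.span (edges P :: ('b list \<Rightarrow>\<^sub>0 'k) set)"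
    let ?U = "boundary ` {u :: 'b list \<Rightarrow>\<^sub>0 'k. Poly_Mapping.keys u \<subseteq> ?S}"
    have "free_space.subspace ?U"
    proof (rule free_space.subspaceI)
      show "0 \<in> ?U" by (rule image_eqI[of _ _ 0]) (simp_all add: boundary_def)
      show "x + y \<in> ?U" if "x \<in> ?U" "y \<in> ?U" for x y
      proof -
        from that obtain u v where "x = boundary u" "y = boundary v"
          "u \<in> {u. Poly_Mapping.keys u \<subseteq> ?S}" "v \<in> {u. Poly_Mapping.keys u \<subseteq> ?S}" by blast
        then show ?thesis
          by (intro image_eqI[of _ _ "u + v"] free_space.subspace_add[OF keys_subspace]) (simp_all add: boundary_add)
      qed
      show "free_scale c x \<in> ?U" if "x \<in> ?U" for c x
      proof -
        from that obtain u where "x = boundary u" "u \<in> {u. Poly_Mapping.keys u \<subseteq> ?S}" by blast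
        then show ?thesis
          by (intro image_eqI[of _ _ "free_scale c u"] free_space.subspace_scale[OF keys_subspace])
            (simp_all add: boundary_scale)
      qed
    qed
    moreover have "edges P \<subseteq> ?U"
    proof
      fix e :: "'b list \<Rightarrow>\<^sub>0 'k" assume "e \<in> edges P"
      then obtain p q where pq: "p \<in> P" "q \<in> P" "lrb_less p q" "e = Poly_Mapping.single [q] 1 - Poly_Mapping.single [p] 1"
        by (auto simp: edges_def)
      then have "e = boundary (Poly_Mapping.single [p, q] 1)" "[p, q] \<in> ?S" by (auto simp: bd simplex)
      then show "e \<in> ?U" by (intro image_eqI) auto
    qed
    ultimately show "x \<in> ?U" using free_space.span_minimal x by blast
  qed
qed

text \<open>The simplices have one vertex, hence the number 1. The boundary of a vertex is the empty
  simplex, so the carrier consists of the combinations of vertices with coefficient sum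
  zero.\<close>

definition cycles :: "('g \<Rightarrow> 'b \<Rightarrow> 'b) \<Rightarrow> 'b::left_regular_band \<Rightarrow> 'b set \<Rightarrow> ('g, 'k::field, 'b list \<Rightarrow>\<^sub>0 'k) rep" where
  "cycles \<phi> b W = (let C = simplicial_chains lrb_less (below_part b W) (\<lambda>g a. b * \<phi> g a) 1
     in C\<lparr>carrier := {f \<in> carrier C. boundary f = 0}\<rparr>)"

lemma H0_rep_quotient: "H0_rep \<phi> b W = quotient_rep (cycles \<phi> b W) (free_space.span (edges (below_part b W)))"
  unfolding H0_rep_def reduced_homology_def Let_def cycles_def
  by (simp add: numeral_2_eq_2[symmetric] boundaries_span_edges)

abbreviation H0_class :: "('g \<Rightarrow> 'b \<Rightarrow> 'b) \<Rightarrow> 'b::left_regular_band \<Rightarrow> 'b set \<Rightarrow> ('b list \<Rightarrow>\<^sub>0 'k::field) \<Rightarrow> ('b list \<Rightarrow>\<^sub>0 'k) set" where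
  "H0_class \<phi> b W \<equiv> vcoset (cycles \<phi> b W) (free_space.span (edges (below_part b W)))"

lemma free_quotient_data:
  "vadd V = (+) \<Longrightarrow> free_space.subspace N \<Longrightarrow> quotient_data V N"
  by unfold_locales (auto intro: free_space.subspace_0 free_space.subspace_diff)

lemma cycles_ops: "vadd (cycles \<phi> b W) = (+)" "vscale (cycles \<phi> b W) = free_scale" "vzero (cycles \<phi> b W) = 0"
  "act (cycles \<phi> b W) g = ksum (\<lambda>s a. Poly_Mapping.single (map (\<lambda>a. b * \<phi> g a) s) a)"
  unfolding cycles_def Let_def simplicial_chains_def
  by (simp_all add: free_rep_def ksum_def fun_eq_iff)

lemma carrier_cycles:
  "u \<in> carrier (cycles \<phi> b W) \<longleftrightarrow> Poly_Mapping.keys u \<subseteq> (\<lambda>p. [p]) ` below_part b W \<and> boundary u = 0"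
proof -
  have "order_simplices lrb_less (below_part b W) 1 = (\<lambda>p. [p]) ` below_part b W"
    by (auto simp: order_simplices_def length_Suc_conv)
  then show ?thesis by (simp add: cycles_def Let_def simplicial_chains_def free_rep_def)
qed

interpretation H0: quotient_data "cycles \<phi> b W" "free_space.span (edges (below_part b W))" for \<phi> b W
  by (rule free_quotient_data) (simp_all add: cycles_ops)

lemma H0_vadd: "vadd (H0_rep \<phi> b W) (H0_class \<phi> b W u) (H0_class \<phi> b W v) = H0_class \<phi> b W (u + v)"
  unfolding H0_rep_quotient by (rule H0.quotient_vadd)

lemma H0_vscale: "vscale (H0_rep \<phi> b W) c (H0_class \<phi> b W u) = H0_class \<phi> b W (free_scale c u)"
  unfolding H0_rep_quotient
  by (subst H0.quotient_vscale)
    (simp_all add: cycles_ops free_space.scale_right_diff_distrib free_space.span_scale)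

lemma H0_vzero: "vzero (H0_rep \<phi> b W) = H0_class \<phi> b W 0"
  unfolding H0_rep_quotient by (simp add: quotient_rep_def cycles_ops)

text \<open>Once the twisted action maps edges to edges, it preserves the span of the boundaries and
  descends to homology.\<close>

lemma H0_act:
  assumes "\<And>p q. p \<in> below_part b W \<Longrightarrow> q \<in> below_part b W \<Longrightarrow> lrb_less p q \<Longrightarrow>
     b * \<phi> g p \<in> below_part b W \<and> b * \<phi> g q \<in> below_part b W \<and> lrb_less (b * \<phi> g p) (b * \<phi> g q)"
  shows "act (H0_rep \<phi> b W) g (H0_class \<phi> b W u) = H0_class \<phi> b W (act (cycles \<phi> b W) g u)"
  unfolding H0_rep_quotient
proof (rule H0.quotient_act)
  let ?V = "cycles \<phi> b W"
  have act: "act ?V g = act (free_rep UNIV (\<lambda>g. map (\<lambda>a. b * \<phi> g a))) g"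
    by (simp add: cycles_ops act_free_rep)
  show "act ?V g (y - z) = act ?V g y - act ?V g z" for y z
    unfolding act by (rule act_free_rep_diff)
  fix n assume n: "n \<in> free_space.span (edges (below_part b W))"
  show "act ?V g n \<in> free_space.span (edges (below_part b W))" unfolding act
  proof (rule linear_span_image[OF act_free_rep_add act_free_rep_scale n])
    fix s assume "s \<in> edges (below_part b W)"
    then obtain p q where pq: "p \<in> below_part b W" "q \<in> below_part b W" "lrb_less p q"
      "s = Poly_Mapping.single [q] 1 - Poly_Mapping.single [p] 1" by (auto simp: edges_def)
    then have "act (free_rep UNIV (\<lambda>g. map (\<lambda>a. b * \<phi> g a))) g s
       = Poly_Mapping.single [b * \<phi> g q] 1 - Poly_Mapping.single [b * \<phi> g p] 1"
      by (simp add: act_free_rep_diff act_free_rep_single)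
    then show "act (free_rep UNIV (\<lambda>g. map (\<lambda>a. b * \<phi> g a))) g s \<in> free_space.span (edges (below_part b W))"
      using assms[OF pq(1-3)] by (auto simp: edges_def intro!: free_space.span_base)
  qed (auto simp: act_free_rep ksum_def intro: free_space.span_zero free_space.span_add free_space.span_scale)
qed

lemma H0_class_eq_iff:
  "H0_class \<phi> b W u = H0_class \<phi> b W v \<longleftrightarrow> u - v \<in> free_space.span (edges (below_part b W))"
  by (rule H0.vcoset_eq_iff)

lemma carrier_H0_rep: "carrier (H0_rep \<phi> b W) = H0_class \<phi> b W ` carrier (cycles \<phi> b W)"
  by (simp add: H0_rep_quotient carrier_quotient)

section \<open>Linear maps from the algebra to chains\<close>

definition poly_linear :: "(('b::{finite, semigroup_mult}, 'k::field) semigroup_algebra \<Rightarrow> ('s \<Rightarrow>\<^sub>0 'k)) \<Rightarrow> bool" where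
  "poly_linear F \<longleftrightarrow> (\<forall>x y. F (x + y) = F x + F y) \<and> (\<forall>c x. F (alg_scale c x) = free_scale c (F x))"

lemma poly_linear_expand:
  assumes "poly_linear F"
  shows "F x = (\<Sum>b\<in>UNIV. free_scale (coeff x b) (F (delta b)))"
proof -
  have F: "F (x + y) = F x + F y" "F (alg_scale c x) = free_scale c (F x)" for x y c
    using assms unfolding poly_linear_def by blast+
  have F0: "F 0 = 0" using F(1)[of 0 0] by simp
  have "F (\<Sum>b\<in>A. alg_scale (coeff x b) (delta b)) = (\<Sum>b\<in>A. free_scale (coeff x b) (F (delta b)))" for A
    by (induction A rule: infinite_finite_induct) (simp_all add: F F0)
  from this[of UNIV] show ?thesis by (simp flip: alg_expand)
qed

lemma poly_linear_mem:
  assumes "poly_linear F" "free_space.subspace N" "\<And>b. coeff x b \<noteq> 0 \<Longrightarrow> F (delta b) \<in> N"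
  shows "F x \<in> N"
  unfolding poly_linear_expand[OF assms(1), of x]
proof (rule free_space.subspace_sum[OF assms(2)])
  fix b
  show "free_scale (coeff x b) (F (delta b)) \<in> N"
    using assms(3)[of b] assms(2) free_space.subspace_scale free_space.subspace_0
    by (cases "coeff x b = 0") auto
qed

lemma poly_linear_eqI:
  assumes "poly_linear F" "poly_linear F'" "\<And>b. coeff x b \<noteq> 0 \<Longrightarrow> F (delta b) = F' (delta b)"
  shows "F x = F' x"
  unfolding poly_linear_expand[OF assms(1), of x] poly_linear_expand[OF assms(2), of x]
proof (rule sum.cong[OF refl])
  fix b
  show "free_scale (coeff x b) (F (delta b)) = free_scale (coeff x b) (F' (delta b))"
    using assms(3)[of b] by (cases "coeff x b = 0") auto
qed

lemma poly_linear_compose: "poly_linear F \<Longrightarrow> alg_linear f \<Longrightarrow> poly_linear (\<lambda>x. F (f x))"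
  by (simp add: poly_linear_def alg_linear_def)

lemma poly_linear_diff: "poly_linear F \<Longrightarrow> poly_linear F' \<Longrightarrow> poly_linear (\<lambda>x. F x - F' x)"
  by (simp add: poly_linear_def free_space.scale_right_diff_distrib)

lemma poly_linear_chi: "poly_linear (\<lambda>x. free_scale (chi X x) u)"
  by (simp add: poly_linear_def free_space.scale_left_distrib)

text \<open>The representing chain of \<open>[b f]\<close>: for \<open>f\<close> in level
  \<open>X\<close> it is a combination of vertices below \<open>b\<close>.\<close>

definition shadow :: "'b::left_regular_band \<Rightarrow> ('b, 'k::field) semigroup_algebra \<Rightarrow> ('b list \<Rightarrow>\<^sub>0 'k)" where
  "shadow b f = (\<Sum>l\<in>UNIV. Poly_Mapping.single [b * l] (coeff f l))"

lemma shadow_linear: "poly_linear (shadow b)"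
  unfolding poly_linear_def shadow_def
  by (simp add: single_add sum.distrib free_space.scale_sum_right)

lemma shadow_add [simp]: "shadow b (x + y) = shadow b x + shadow b y"
  and shadow_scale [simp]: "shadow b (alg_scale c x) = free_scale c (shadow b x)"
  and shadow_0 [simp]: "shadow b 0 = 0"
  using shadow_linear[of b] unfolding poly_linear_def by (blast, blast) (simp add: shadow_def)

lemma shadow_delta: "shadow b (delta l) = Poly_Mapping.single [b * l] 1"
proof -
  have "shadow b (delta l) = (\<Sum>x\<in>UNIV. if x = l then Poly_Mapping.single [b * l] 1 else 0)"
    unfolding shadow_def by (intro sum.cong) auto
  then show ?thesis by simp
qed

lemma chi_level:
  assumes "level X f = f"
  shows "chi X f = (\<Sum>b\<in>UNIV. coeff f b)"
  unfolding chi_def using level_supp[OF assms] by (intro sum.cong) auto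

lemma shadow_keys: "Poly_Mapping.keys (shadow b f) \<subseteq> {[b * l] | l. coeff f l \<noteq> 0}"
proof -
  have "shadow b f \<in> {u. Poly_Mapping.keys u \<subseteq> {[b * l] | l. coeff f l \<noteq> 0}}"
    by (rule poly_linear_mem[OF shadow_linear keys_subspace]) (auto simp: shadow_delta)
  then show ?thesis by simp
qed

lemma single_sum: "Poly_Mapping.single s (\<Sum>i\<in>I. f i) = (\<Sum>i\<in>I. Poly_Mapping.single s (f i))"
  for f :: "'i \<Rightarrow> 'k::ab_group_add"
  by (induction I rule: infinite_finite_induct) (simp_all add: single_add)

text \<open>Every vertex has the empty simplex as boundary, so only the coefficient sum survives; on
  level \<open>X\<close> this sum is \<open>chi X f\<close>.\<close>

lemma boundary_shadow: "boundary (shadow b f) = Poly_Mapping.single [] (\<Sum>l\<in>UNIV. coeff f l)"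
proof -
  have "poly_linear (\<lambda>x. boundary (shadow b x))"
    by (simp add: poly_linear_def boundary_add boundary_scale)
  from poly_linear_expand[OF this, of f] show ?thesis
    by (simp add: shadow_delta boundary_single single_sum)
qed

text \<open>Elements of \<open>z\<close> with support properly inside \<open>X\<close> keep this
  property after multiplication from the left, so they do not contribute to level
  \<open>X\<close>.\<close>

lemma level_mult:
  assumes "\<And>c. coeff z c \<noteq> 0 \<Longrightarrow> supp c \<subseteq> X"
  shows "level X (x * z) = level X (x * level X z)"
proof (rule alg_linear_eqI[where x = z and f = "\<lambda>z. level X (x * z)" and g = "\<lambda>z. level X (x * level X z)"])
  show "alg_linear (\<lambda>z. level X (x * z))" "alg_linear (\<lambda>z. level X (x * level X z))"
    by (intro alg_linear_compose[OF alg_linear_level] alg_linear_compose[OF alg_linear_mult_left]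
        alg_linear_mult_left alg_linear_level)+
  fix c assume "coeff z c \<noteq> 0"
  then have c: "supp c \<subseteq> X" by (rule assms)
  show "level X (x * delta c) = level X (x * level X (delta c))"
  proof (cases "supp c = X")
    case False
    have "level X (x * delta c) = 0"
    proof (rule alg_linear_eqI[where x = x and f = "\<lambda>x. level X (x * delta c)" and g = "\<lambda>_. 0"])
      show "alg_linear (\<lambda>x. level X (x * delta c))"
        by (rule alg_linear_compose[OF alg_linear_level alg_linear_mult_right])
      fix w
      have "supp (w * c) \<noteq> X" using c False by (auto simp: supp_mult)
      then show "level X (delta w * delta c) = 0" by (simp add: delta_mult level_delta)
    qed (rule alg_linear_zero)
    then show ?thesis using False by (simp add: level_delta alg_linear_0[OF alg_linear_level])
  qed (simp add: level_delta)
qed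

lemma coeff_mult_delta_low:
  assumes "coeff (y * delta l) c \<noteq> 0"
  shows "supp c \<subseteq> supp l"
proof (rule ccontr)
  assume c: "\<not> supp c \<subseteq> supp l"
  have "y * delta l \<in> {z. coeff z c = 0}"
  proof (induction y rule: alg_induct)
    case (delta a b)
    have "b * l \<noteq> c" using c by (auto simp: supp_mult)
    then show ?case by (auto simp: delta_mult)
  qed (auto simp: distrib_right)
  then show False using assms by simp
qed

context standard_idempotents
begin

text \<open>Transported by \<open>coord\<close>, left multiplication on \<open>A E\<^sub>X\<close>
  becomes the Schuetzenberger representation: multiply elements of support \<open>X\<close> from the
  left and drop what leaves level \<open>X\<close>.\<close>

lemma coord_mult:
  assumes "X \<in> supports"
  shows "coord X (x * y) = level X (x * coord X y)"
proof -
  have l: "supp (SOME l. supp l = X) = X"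
    using assms by (metis (mono_tags, lifting) someI_ex supports_obtain)
  have "level X (x * (y * delta (SOME l. supp l = X))) = level X (x * level X (y * delta (SOME l. supp l = X)))"
    by (rule level_mult) (use coeff_mult_delta_low l in blast)
  then show ?thesis by (simp add: coord_def mult.assoc)
qed

end

context equivariant_idempotents
begin

lemma level_move:
  assumes "g \<in> carrier G" "\<phi> g ` X = X"
  shows "level X (move g f) = move g (level X f)"
proof (rule alg_linear_eqI[where x = f])
  show "alg_linear (\<lambda>f. level X (move g f))" "alg_linear (\<lambda>f. move g (level X f))"
    by (intro alg_linear_compose[OF alg_linear_level] alg_linear_compose[OF move_linear]
        alg_linear_level move_linear)+
  fix b
  have "supp (\<phi> g b) = X \<longleftrightarrow> supp b = X"
    using \<phi>_supp[OF assms(1), of b] \<phi>_inj[OF assms(1)] assms(2) by (metis inj_image_eq_iff)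
  then show "level X (move g (delta b)) = move g (level X (delta b))"
    by (simp add: move_delta level_delta alg_linear_0[OF move_linear])
qed

lemma coord_move:
  assumes g: "g \<in> carrier G" "\<phi> g ` X = X" and X: "X \<in> supports" and x: "x * E X = x"
  shows "coord X (move g x) = move g (coord X x)"
proof -
  have "move g x = move g (coord X x * E X)" by (simp only: mult_E_coord[OF X x])
  also have "\<dots> = move g (coord X x) * E X" using g X by (simp add: move_times move_E)
  finally have eq: "move g x = move g (coord X x) * E X" .
  have "level X (move g (coord X x)) = move g (coord X x)" using level_move[OF g] by simp
  then show ?thesis unfolding eq by (rule coord_mult_E[OF X])
qed

section \<open>Homology attached to one pair of supports\<close>

context
  fixes X Y :: "'b set" and b :: 'b
  assumes X: "X \<in> supports" and Y: "supp b = Y" and XY: "X \<subset> Y"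
begin

lemma Y_supports: "Y \<in> supports"
  using Y by auto

abbreviation "edge_span \<equiv> free_space.span (edges (below_part b X) :: ('b list \<Rightarrow>\<^sub>0 'k) set)"

text \<open>For \<open>p\<close> with \<open>b * p = p\<close> the support lies inside
  \<open>Y\<close>, and it is all of \<open>Y\<close> only if \<open>p = b\<close>. Trading
  \<open>p \<noteq> b\<close> for a condition on supports makes membership easy to follow under
  products and under the group.\<close>

lemma in_below: "p \<in> below_part b X \<longleftrightarrow> b * p = p \<and> X \<subseteq> supp p \<and> \<not> Y \<subseteq> supp p"
proof
  assume p: "p \<in> below_part b X"
  then have "lrb_less p b" by (simp add: below_part_def)
  then show "b * p = p \<and> X \<subseteq> supp p \<and> \<not> Y \<subseteq> supp p"
    using p lrb_less_supp[of p b] Y by (auto simp: below_part_def lrb_less_def lrb_le_def)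
next
  assume "b * p = p \<and> X \<subseteq> supp p \<and> \<not> Y \<subseteq> supp p"
  then show "p \<in> below_part b X" using Y by (auto simp: below_part_def lrb_less_def lrb_le_def)
qed

lemma edge_in_span:
  assumes "p \<in> below_part b X" "q \<in> below_part b X" "q * p = p"
  shows "Poly_Mapping.single [q] 1 - Poly_Mapping.single [p] 1 \<in> edge_span"
proof (cases "p = q")
  case True
  then show ?thesis by (simp add: free_space.span_zero)
next
  case False
  then have "lrb_less p q" using assms by (simp add: lrb_less_def lrb_le_def)
  then show ?thesis using assms unfolding edges_def by (intro free_space.span_base) blast
qed

lemma edge_in_span':
  assumes "p \<in> below_part b X" "q \<in> below_part b X" "q * p = p"
  shows "Poly_Mapping.single [p] 1 - Poly_Mapping.single [q] 1 \<in> edge_span"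
  using free_space.span_neg[OF edge_in_span[OF assms]] by simp

lemma shadow_cycle:
  assumes f: "level X f = f" "chi X f = 0"
  shows "shadow b f \<in> carrier (cycles \<phi> b X)"
  unfolding carrier_cycles
proof
  show "Poly_Mapping.keys (shadow b f) \<subseteq> (\<lambda>p. [p]) ` below_part b X"
  proof
    fix s assume "s \<in> Poly_Mapping.keys (shadow b f)"
    then obtain l where l: "s = [b * l]" "coeff f l \<noteq> 0" using shadow_keys by blast
    then have "supp l = X" using level_supp f by blast
    then have "b * l \<in> below_part b X"
      unfolding in_below using XY Y by (auto simp: supp_mult lrb_idem simp flip: mult.assoc)
    then show "s \<in> (\<lambda>p. [p]) ` below_part b X" using l by blast
  qed
  show "boundary (shadow b f) = 0"
    unfolding boundary_shadow using f chi_level[OF f(1)] by simp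
qed

text \<open>Three cases for a basis element \<open>w\<close>. If its support does not contain
  \<open>X\<close>, both terms vanish. If it contains \<open>Y\<close>, then
  \<open>b * w = b\<close> and the shadow is unchanged. In between, all vertices
  \<open>b * w * l\<close> lie below the single vertex \<open>b * w\<close> of
  \<open>below_part b X\<close>, so the shadow is homologous to \<open>chi X f\<close> times that
  vertex, which is zero.\<close>

lemma shadow_mult:
  assumes f: "level X f = f" "chi X f = 0"
  shows "shadow b (level X (r * f)) - free_scale (chi Y r) (shadow b f) \<in> edge_span"
proof -
  have "poly_linear (\<lambda>r. shadow b (level X (r * f)) - free_scale (chi Y r) (shadow b f))"
    by (intro poly_linear_diff poly_linear_chi poly_linear_compose[OF shadow_linear]
        alg_linear_compose[OF alg_linear_level] alg_linear_mult_right)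
  then show ?thesis
  proof (rule poly_linear_mem[OF _ free_space.subspace_span])
    fix w
    consider "\<not> X \<subseteq> supp w" | "Y \<subseteq> supp w" | "X \<subseteq> supp w" "\<not> Y \<subseteq> supp w" by blast
    then show "shadow b (level X (delta w * f)) - free_scale (chi Y (delta w)) (shadow b f) \<in> edge_span"
    proof cases
      case 1
      then have "\<not> Y \<subseteq> supp w" using XY by blast
      then show ?thesis using level_mult_low[OF 1, of f] by (simp add: free_space.span_zero)
    next
      case 2
      have "shadow b (level X (delta w * f)) = shadow b f"
      proof (rule poly_linear_eqI[where x = f and F = "\<lambda>f. shadow b (level X (delta w * f))"])
        show "poly_linear (\<lambda>f. shadow b (level X (delta w * f)))"
          by (intro poly_linear_compose[OF shadow_linear] alg_linear_compose[OF alg_linear_level] alg_linear_mult_left)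
        fix l assume "coeff f l \<noteq> 0"
        then have "supp l = X" using level_supp f by blast
        then have "supp (w * l) = X" using 2 XY by (auto simp: supp_mult)
        moreover have "b * w = b" using 2 Y by (simp add: mult_absorb)
        then have "b * (w * l) = b * l" by (simp flip: mult.assoc)
        ultimately show "shadow b (level X (delta w * delta l)) = shadow b (delta l)"
          by (simp add: delta_mult level_delta shadow_delta)
      qed (rule shadow_linear)
      then show ?thesis using 2 by (simp add: free_space.span_zero)
    next
      case 3
      have "poly_linear (\<lambda>f. shadow b (level X (delta w * f)) - free_scale (chi X f) (Poly_Mapping.single [b * w] 1))"
        by (intro poly_linear_diff poly_linear_chi poly_linear_compose[OF shadow_linear]
            alg_linear_compose[OF alg_linear_level] alg_linear_mult_left)
      then have "shadow b (level X (delta w * f)) - free_scale (chi X f) (Poly_Mapping.single [b * w] 1) \<in> edge_span"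
      proof (rule poly_linear_mem[OF _ free_space.subspace_span])
        fix l assume "coeff f l \<noteq> 0"
        then have l: "supp l = X" using level_supp f by blast
        then have wl: "supp (w * l) = X" using 3 XY by (auto simp: supp_mult)
        have "Poly_Mapping.single [b * (w * l)] 1 - Poly_Mapping.single [b * w] 1 \<in> edge_span"
        proof (rule edge_in_span')
          show "b * (w * l) \<in> below_part b X" "b * w \<in> below_part b X"
            using l 3 XY Y by (auto simp: in_below supp_mult lrb_idem simp flip: mult.assoc)
          have "b * w * (b * (w * l)) = (b * w * b) * w * l" by (simp only: mult.assoc)
          also have "\<dots> = b * (w * w) * l" by (simp only: lrb_regular mult.assoc)
          also have "\<dots> = b * (w * l)" by (simp only: lrb_idem mult.assoc)
          finally show "b * w * (b * (w * l)) = b * (w * l)" .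
        qed
        then show "shadow b (level X (delta w * delta l)) - free_scale (chi X (delta l)) (Poly_Mapping.single [b * w] 1) \<in> edge_span"
          using wl l by (simp add: delta_mult level_delta shadow_delta)
      qed
      then show ?thesis using 3 f by simp
    qed
  qed
qed

definition to_H0 where
  "to_H0 x = H0_class \<phi> b X (shadow b (coord X x))"

lemma to_H0_add: "to_H0 (x + y) = vadd (H0_rep \<phi> b X) (to_H0 x) (to_H0 y)"
  and to_H0_scale: "to_H0 (alg_scale c x) = vscale (H0_rep \<phi> b X) c (to_H0 x)"
  unfolding to_H0_def alg_linear_add[OF alg_linear_coord] alg_linear_scale[OF alg_linear_coord]
  by (simp_all add: H0_vadd H0_vscale)

lemma to_H0_zero: "to_H0 0 = vzero (H0_rep \<phi> b X)"
  by (simp add: to_H0_def H0_vzero alg_linear_0[OF alg_linear_coord])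

lemma corner_coord:
  assumes x: "x \<in> corner Y X"
  shows "x * E X = x" "E Y * x = x" "chi X (coord X x) = 0" "coord X x * E X = x"
proof -
  show 1: "x * E X = x" "E Y * x = x" using x X Y_supports corner_iff by blast+
  show "chi X (coord X x) = 0" using chi_coord[OF X 1(1)] chi_corner[OF X Y_supports X _ x] XY by auto
  show "coord X x * E X = x" using mult_E_coord[OF X 1(1)] .
qed

lemma to_H0_carrier: "x \<in> corner Y X \<Longrightarrow> to_H0 x \<in> carrier (H0_rep \<phi> b X)"
  unfolding to_H0_def carrier_H0_rep using corner_coord(3) by (intro imageI shadow_cycle) simp_all

lemma to_H0_eq_iff: "to_H0 x = vzero (H0_rep \<phi> b X) \<longleftrightarrow> shadow b (coord X x) \<in> edge_span"
  by (simp add: to_H0_def H0_vzero H0_class_eq_iff)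

text \<open>Since \<open>g\<close> fixes \<open>Y\<close>, the element \<open>\<phi> g b\<close> has
  the support of \<open>b\<close>, so \<open>b * \<phi> g b = b\<close>. Hence
  \<open>b * \<phi> g (b * l) = b * \<phi> g l\<close>: taking shadows turns the plain action of
  \<open>g\<close> into the twisted one.\<close>

lemma to_H0_act:
  assumes g: "g \<in> stab G \<phi> X \<inter> stab G \<phi> Y" and x: "x \<in> corner Y X"
  shows "to_H0 (move g x) = act (H0_rep \<phi> b X) g (to_H0 x)"
proof -
  have gG: "g \<in> carrier G" "\<phi> g ` X = X" "\<phi> g ` Y = Y" using g by (auto simp: in_stab)
  have "supp (\<phi> g b) = Y" using \<phi>_supp[OF gG(1), of b] gG(3) Y by simp
  then have bb: "b * \<phi> g b = b" using Y by (simp add: mult_absorb)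
  have below: "b * \<phi> g p \<in> below_part b X" if "p \<in> below_part b X" for p
  proof -
    have *: "X \<subseteq> supp (\<phi> g p)" "\<not> Y \<subseteq> supp (\<phi> g p)"
      using that \<phi>_supp[OF gG(1), of p] gG \<phi>_inj[OF gG(1)]
      by (metis in_below inj_image_subset_iff)+
    then show ?thesis using XY Y by (auto simp: in_below supp_mult lrb_idem simp flip: mult.assoc)
  qed
  have act_class: "act (H0_rep \<phi> b X) g (H0_class \<phi> b X u) = H0_class \<phi> b X (act (cycles \<phi> b X) g u)" for u :: "'b list \<Rightarrow>\<^sub>0 'k"
  proof (rule H0_act)
    fix p q assume pq: "p \<in> below_part b X" "q \<in> below_part b X" "lrb_less p q"
    have eq: "b * \<phi> g q * (b * \<phi> g p) = b * \<phi> g p"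
    proof -
      have "b * \<phi> g q * (b * \<phi> g p) = (b * \<phi> g q * b) * \<phi> g p" by (simp only: mult.assoc)
      also have "\<dots> = b * (\<phi> g q * \<phi> g p)" by (simp only: lrb_regular mult.assoc)
      also have "\<phi> g q * \<phi> g p = \<phi> g p"
        using pq(3) \<phi>_hom[OF gG(1), of q p] by (simp add: lrb_less_def lrb_le_def)
      finally show ?thesis .
    qed
    \<comment> \<open>Left multiplication by \<open>b\<close> intersects supports with
      \<open>Y\<close> and so does not change these, which are inside \<open>Y\<close> already;
      strictness survives.\<close>
    have "supp (b * \<phi> g p) \<noteq> supp (b * \<phi> g q)"
    proof -
      have "supp p \<subset> supp q" using lrb_less_supp pq(3) .
      then have "supp (\<phi> g p) \<subset> supp (\<phi> g q)" using \<phi>_psubset[OF gG(1)] \<phi>_supp[OF gG(1)] by metis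
      moreover have "supp q \<subseteq> Y" using pq(2) Y in_below[of q] by (metis inf.orderI inf_commute supp_mult)
      then have "\<phi> g ` supp q \<subseteq> \<phi> g ` Y" by (rule image_mono)
      then have "supp (\<phi> g q) \<subseteq> Y" by (simp only: \<phi>_supp[OF gG(1)] gG(3))
      ultimately show ?thesis unfolding supp_mult Y by blast
    qed
    then show "b * \<phi> g p \<in> below_part b X \<and> b * \<phi> g q \<in> below_part b X \<and> lrb_less (b * \<phi> g p) (b * \<phi> g q)"
      using below pq eq by (auto simp: lrb_less_def lrb_le_def)
  qed
  have "shadow b (move g f) = act (cycles \<phi> b X) g (shadow b f)" for f
  proof (rule poly_linear_eqI[where x = f])
    show "poly_linear (\<lambda>f. shadow b (move g f))"
      by (rule poly_linear_compose[OF shadow_linear move_linear])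
    have "act (cycles \<phi> b X) g = act (free_rep UNIV (\<lambda>g. map (\<lambda>a. b * \<phi> g a)) :: ('g, 'k, 'b list \<Rightarrow>\<^sub>0 'k) rep) g"
      by (simp add: cycles_ops act_free_rep)
    then show "poly_linear (\<lambda>f. act (cycles \<phi> b X) g (shadow b f :: 'b list \<Rightarrow>\<^sub>0 'k))"
      by (simp add: poly_linear_def act_free_rep_add act_free_rep_scale)
    fix l
    have "b * \<phi> g (b * l) = b * \<phi> g l" using bb \<phi>_hom[OF gG(1)] by (metis mult.assoc)
    then show "shadow b (move g (delta l)) = act (cycles \<phi> b X) g (shadow b (delta l) :: 'b list \<Rightarrow>\<^sub>0 'k)"
      by (simp add: move_delta shadow_delta cycles_ops ksum_single)
  qed
  then show ?thesis
    unfolding to_H0_def using coord_move[OF gG(1,2) X corner_coord(1)[OF x]] by (simp add: act_class)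
qed

lemma to_H0_mult:
  assumes "y * E X = y" "chi X y = 0"
  shows "shadow b (coord X (x * y)) - free_scale (chi Y x) (shadow b (coord X y)) \<in> edge_span"
  unfolding coord_mult[OF X]
  using shadow_mult[of "coord X y" x] chi_coord[OF X assms(1)] assms(2) by simp

text \<open>By \<open>to_H0_mult\<close>, a left factor \<open>x\<close> from \<open>C(Y,Z)\<close>
  with \<open>Z\<close> strictly below \<open>Y\<close> acts on classes as the scalar
  \<open>chi Y x\<close>, which is zero.\<close>

lemma to_H0_decomposables:
  assumes "x \<in> decomposables Y X"
  shows "to_H0 x = vzero (H0_rep \<phi> b X)"
proof -
  have "shadow b (coord X x) \<in> edge_span"
    using assms unfolding decomposables_def
  proof (induction rule: alg_space.span_induct_alt)
    case base
    show ?case by (simp add: alg_linear_0[OF alg_linear_coord] shadow_def free_space.span_zero)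
  next
    case (step c z y)
    then obtain x w Z where z: "z = x * w"
      and Z: "Z \<in> supports" "X \<subset> Z" "Z \<subset> Y" "x \<in> corner Y Z" "w \<in> corner Z X" by blast
    have "w * E X = w" using Z X corner_iff by blast
    moreover have "chi X w = 0" using chi_corner[OF X Z(1) X _ Z(5)] Z by blast
    moreover have "chi Y x = 0" using chi_corner[OF Z(1) Y_supports Y_supports _ Z(4)] Z by blast
    ultimately have "shadow b (coord X z) \<in> edge_span"
      using to_H0_mult[of w x] z by simp
    then show ?case
      using step
      by (simp add: alg_linear_add[OF alg_linear_coord] alg_linear_scale[OF alg_linear_coord]
          free_space.span_add free_space.span_scale)
  qed
  then show ?thesis by (simp add: to_H0_eq_iff)
qed

text \<open>Conversely, \<open>p\<close> in \<open>B\<^sup><\<^sup>b\<close> determines the class of \<open>E\<^sub>Y p l E\<^sub>X\<close> modulo decomposables,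
  independently of the choice of \<open>l\<close> of support \<open>X\<close> and constant on connected components.\<close>

lemma to_H0_kernel:
  assumes x: "x \<in> corner Y X" and 0: "to_H0 x = vzero (H0_rep \<phi> b X)"
  shows "x \<in> decomposables Y X"
proof -
  obtain l0 where l0: "supp l0 = X" using X supports_obtain by blast
  define T :: "('b list \<Rightarrow>\<^sub>0 'k) \<Rightarrow> ('b, 'k) semigroup_algebra" where
    "T = ksum (\<lambda>s a. alg_scale a (E Y * delta (hd s * l0) * E X))"
  have T_add: "T (u + v) = T u + T v" and T_diff: "T (u - v) = T u - T v" for u v
    unfolding T_def by (simp_all add: ksum_add ksum_diff alg_space.scale_left_distrib)
  have T_scale: "T (free_scale c u) = alg_scale c (T u)" for c u
    unfolding T_def by (rule ksum_scale) (simp_all add: alg_space.scale_right_distrib)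
  have T_single: "T (Poly_Mapping.single [p] 1) = E Y * delta (p * l0) * E X" for p
    unfolding T_def by (simp add: ksum_single)
  have "T u \<in> decomposables Y X" if u: "u \<in> edge_span" for u
  proof (rule linear_span_image[OF T_add T_scale u])
    fix e :: "'b list \<Rightarrow>\<^sub>0 'k" assume "e \<in> edges (below_part b X)"
    then obtain p q where pq: "p \<in> below_part b X" "q \<in> below_part b X" "lrb_less p q"
      "e = Poly_Mapping.single [q] 1 - Poly_Mapping.single [p] 1" by (auto simp: edges_def)
    have pq': "X \<subseteq> supp p" "\<not> Y \<subseteq> supp q" "q * p = p"
      using pq in_below by (auto simp: lrb_less_def lrb_le_def)
    \<comment> \<open>As \<open>q * p = p\<close>, left multiplication by \<open>q\<close> turns
      \<open>l0 - p * l0\<close> into \<open>q * l0 - p * l0\<close>, the difference belonging to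
      the edge. Since \<open>chi Y\<close> vanishes on \<open>q\<close> and \<open>chi X\<close> on
      \<open>?y\<close>, \<open>mult_mod_decomposables\<close> makes the image of the edge
      decomposable.\<close>
    let ?y = "(delta l0 - delta (p * l0)) * E X"
    have "E Y * delta q * ?y - alg_scale (chi Y (delta q)) (E Y * ?y) \<in> decomposables Y X"
      using X Y_supports XY pq' l0
      by (intro mult_mod_decomposables) (auto simp: mult.assoc E_idem supp_mult)
    moreover have "E Y * delta q * ?y = T e"
    proof -
      have "q * (p * l0) = p * l0" using pq' by (simp flip: mult.assoc)
      then have "delta q * (delta l0 - delta (p * l0)) = (delta (q * l0) - delta (p * l0) :: ('b, 'k) semigroup_algebra)"
        by (simp add: right_diff_distrib delta_mult)
      then have "E Y * delta q * ?y = E Y * (delta (q * l0) - delta (p * l0)) * E X"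
        by (metis mult.assoc)
      then show ?thesis unfolding pq(4) T_diff T_single by (simp add: left_diff_distrib right_diff_distrib)
    qed
    ultimately show "T e \<in> decomposables Y X" using pq' by simp
  next
    have "T 0 = 0" by (simp add: T_def ksum_def)
    then show "T 0 \<in> decomposables Y X" by (simp add: alg_space.subspace_0 decomposables_subspace)
  qed (simp_all add: alg_space.subspace_add alg_space.subspace_scale decomposables_subspace)
  then have 1: "T (shadow b (coord X x)) \<in> decomposables Y X" using 0 by (simp add: to_H0_eq_iff)
  have "T (shadow b (coord X x)) = E Y * (delta b * coord X x) * E X"
  proof (rule alg_linear_eqI[where x = "coord X x" and f = "\<lambda>f. T (shadow b f)" and g = "\<lambda>f. E Y * (delta b * f) * E X"])
    show "alg_linear (\<lambda>f. T (shadow b f))"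
      by (simp add: alg_linear_def T_add T_scale)
    show "alg_linear (\<lambda>f. E Y * (delta b * f) * E X)"
      by (intro alg_linear_compose[OF alg_linear_mult_right] alg_linear_compose[OF alg_linear_mult_left] alg_linear_mult_left)
    fix l assume "coeff (coord X x) l \<noteq> 0"
    then have "supp l = X" using level_supp[OF level_coord] by blast
    then have "l * l0 = l" using l0 by (simp add: mult_absorb)
    then have "b * l * l0 = b * l" by (simp add: mult.assoc)
    then show "T (shadow b (delta l)) = E Y * (delta b * delta l) * E X"
      by (simp add: shadow_delta T_single delta_mult)
  qed
  also have "\<dots> = E Y * delta b * x" using corner_coord(4)[OF x] by (metis mult.assoc)
  finally have 2: "E Y * delta b * x \<in> decomposables Y X" using 1 by simp
  \<comment> \<open>As \<open>chi Y\<close> is 1 on \<open>b\<close>, left multiplication by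
    \<open>b\<close> is the identity modulo decomposables; so \<open>x\<close> agrees with the image
    under \<open>T\<close> of a boundary.\<close>
  have "E Y * delta b * x - alg_scale (chi Y (delta b)) (E Y * x) \<in> decomposables Y X"
    using corner_coord[OF x] chi_corner[OF X Y_supports X _ x] XY X Y_supports
    by (intro mult_mod_decomposables) auto
  then have "E Y * delta b * x - x \<in> decomposables Y X" using corner_coord[OF x] Y by simp
  then have "E Y * delta b * x - (E Y * delta b * x - x) \<in> decomposables Y X"
    by (rule alg_space.subspace_diff[OF decomposables_subspace 2])
  then show ?thesis by simp
qed

text \<open>Replacing a vertex \<open>p\<close> by \<open>p * l0\<close> moves it along an edge to
  an element of support \<open>X\<close>, which is its own shadow because \<open>b * p = p\<close>.
  So every cycle is homologous to the shadow of some \<open>f\<close> in level \<open>X\<close> with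
  \<open>chi X f = 0\<close>, and multiplying by \<open>E Y\<close> on the left keeps the class
  since \<open>chi Y (E Y) = 1\<close>.\<close>

lemma to_H0_surj:
  assumes "h \<in> carrier (H0_rep \<phi> b X)"
  obtains x where "x \<in> corner Y X" "to_H0 x = h"
proof -
  obtain u where u: "h = H0_class \<phi> b X u" and cyc: "u \<in> carrier (cycles \<phi> b X)"
    using assms by (auto simp: carrier_H0_rep)
  then have keys: "Poly_Mapping.keys u \<subseteq> (\<lambda>p. [p]) ` below_part b X" and bd: "boundary u = 0"
    by (auto simp: carrier_cycles)
  obtain l0 where l0: "supp l0 = X" using X supports_obtain by blast
  let ?c = "Poly_Mapping.lookup u"
  define f where "f = (\<Sum>s\<in>Poly_Mapping.keys u. alg_scale (?c s) (delta (hd s * l0)))"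
  have below: "\<exists>p. s = [p] \<and> b * p = p \<and> p \<in> below_part b X \<and> supp (p * l0) = X" if "s \<in> Poly_Mapping.keys u" for s
  proof -
    from that keys obtain p where p: "s = [p]" "p \<in> below_part b X" by blast
    then have "b * p = p" "X \<subseteq> supp p" using in_below by blast+
    then show ?thesis using p l0 by (auto simp: supp_mult)
  qed
  have lev: "level X f = f"
    unfolding f_def alg_linear_sum[OF alg_linear_level]
    by (intro sum.cong refl) (use below in \<open>fastforce simp: alg_linear_scale[OF alg_linear_level] level_delta\<close>)
  have "boundary u = (\<Sum>s\<in>Poly_Mapping.keys u. Poly_Mapping.single [] (?c s))"
    unfolding boundary_def by (intro sum.cong refl) (use below in fastforce)
  then have sum0: "(\<Sum>s\<in>Poly_Mapping.keys u. ?c s) = 0"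
    using bd single_zero by (simp flip: single_sum) (metis lookup_single_eq lookup_zero)
  have "chi X f = (\<Sum>s\<in>Poly_Mapping.keys u. ?c s)"
    unfolding f_def chi_sum chi_scale by (intro sum.cong refl) (use below in fastforce)
  then have chi: "chi X f = 0" using sum0 by simp
  let ?x = "E Y * (f * E X)"
  have "?x \<in> corner Y X" unfolding corner_def by (rule CollectI, rule exI[of _ f]) (simp add: mult.assoc)
  moreover have "to_H0 ?x = h"
  proof -
    have fE: "f * E X * E X = f * E X" "chi X (f * E X) = 0" using chi X by (simp_all add: mult.assoc E_idem)
    have 1: "shadow b (coord X ?x) - shadow b f \<in> edge_span"
      using to_H0_mult[OF fE, of "E Y"] coord_mult_E[OF X lev] Y_supports by (simp add: chi_E)
    have "shadow b f = (\<Sum>s\<in>Poly_Mapping.keys u. free_scale (?c s) (shadow b (delta (hd s * l0))))"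
    proof -
      have "shadow b (\<Sum>s\<in>A. alg_scale (?c s) (delta (hd s * l0)))
          = (\<Sum>s\<in>A. free_scale (?c s) (shadow b (delta (hd s * l0))))" for A
        by (induction A rule: infinite_finite_induct) simp_all
      then show ?thesis unfolding f_def .
    qed
    then have "shadow b f - u = (\<Sum>s\<in>Poly_Mapping.keys u. free_scale (?c s) (shadow b (delta (hd s * l0)) - Poly_Mapping.single s 1))"
      using poly_mapping_expand[of u] by (simp add: sum_subtractf free_space.scale_right_diff_distrib)
    also have "\<dots> \<in> edge_span"
    proof (intro free_space.span_sum free_space.span_scale)
      fix s assume "s \<in> Poly_Mapping.keys u"
      then obtain p where p: "s = [p]" "b * p = p" "p \<in> below_part b X" "supp (p * l0) = X" using below by blast
      have "b * (p * l0) = p * l0" using p by (simp flip: mult.assoc)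
      moreover have "p * l0 \<in> below_part b X" using p calculation XY by (auto simp: in_below)
      moreover have "p * (p * l0) = p * l0" by (simp add: lrb_idem flip: mult.assoc)
      ultimately show "shadow b (delta (hd s * l0)) - Poly_Mapping.single s 1 \<in> edge_span"
        using edge_in_span'[OF _ p(3)] p by (simp add: shadow_delta)
    qed
    finally have "shadow b f - u \<in> edge_span" .
    then have "(shadow b (coord X ?x) - shadow b f) + (shadow b f - u) \<in> edge_span"
      by (rule free_space.span_add[OF 1])
    then show ?thesis unfolding to_H0_def u H0_class_eq_iff by simp
  qed
  ultimately show ?thesis using that by blast
qed

text \<open>On the corner, the kernel of \<open>to_H0\<close> is \<open>D(Y,X)\<close>, where
  \<open>\<pi>\<close> vanishes, so \<open>s (to_H0 x) = \<pi> x\<close> is well defined: an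
  equivariant lift of homology classes. The function \<open>h\<close> sends an arrow to its class;
  these classes span, and \<open>s\<close> returns each arrow.\<close>

lemma to_H0_section:
  assumes split: "splitting Y X \<pi>" and Q: "arrows Y X Q" and fixed: "\<And>v. v \<in> Q \<Longrightarrow> \<pi> v = v"
  shows "\<exists>s h. s \<in> rep_hom (stab G \<phi> X \<inter> stab G \<phi> Y) (H0_rep \<phi> b X) (corner_rep \<phi> (E Y) (E X)) \<and>
    (\<forall>v\<in>Q. h v \<in> carrier (H0_rep \<phi> b X) \<and> s (h v) = v) \<and>
    carrier (H0_rep \<phi> b X) \<subseteq> generated (H0_rep \<phi> b X) (h ` Q) \<and>
    operator_space (stab G \<phi> X \<inter> stab G \<phi> Y) (H0_rep \<phi> b X :: ('g, 'k, ('b list \<Rightarrow>\<^sub>0 'k) set) rep)"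
proof -
  let ?H = "H0_rep \<phi> b X :: ('g, 'k, ('b list \<Rightarrow>\<^sub>0 'k) set) rep"
  let ?K = "stab G \<phi> X \<inter> stab G \<phi> Y"
  have \<pi>: "alg_linear \<pi>" "\<And>x. x - \<pi> x \<in> decomposables Y X"
    "\<And>x. x \<in> decomposables Y X \<Longrightarrow> \<pi> x = 0"
    "\<And>g x. g \<in> ?K \<Longrightarrow> \<pi> (move g x) = move g (\<pi> x)"
    using split unfolding splitting_def by blast+
  have Q_corner: "Q \<subseteq> corner Y X" and Q_span: "corner Y X \<subseteq> alg_space.span (Q \<union> decomposables Y X)"
    using Q unfolding arrows_def by blast+
  have \<pi>_corner: "\<pi> x \<in> corner Y X" if "x \<in> corner Y X" for x
  proof -
    have "x - \<pi> x \<in> corner Y X" using \<pi>(2)[of x] decomposables_subset_corner[OF X Y_supports] by blast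
    then have "x - (x - \<pi> x) \<in> corner Y X" by (rule alg_space.subspace_diff[OF corner_subspace that])
    then show ?thesis by simp
  qed
  have move_corner': "move g x \<in> corner Y X" if "g \<in> ?K" "x \<in> corner Y X" for g x
    using move_corner[OF _ X Y_supports that(2), of g] that(1) by (auto simp: in_stab)
  have C_add: "x + y \<in> corner Y X" if "x \<in> corner Y X" "y \<in> corner Y X" for x y
    using alg_space.subspace_add[OF corner_subspace] that by blast
  have C_scale: "alg_scale c x \<in> corner Y X" if "x \<in> corner Y X" for c x
    using alg_space.subspace_scale[OF corner_subspace] that by blast
  define s where "s k = \<pi> (SOME x. x \<in> corner Y X \<and> to_H0 x = k)" for k
  have s: "s (to_H0 x) = \<pi> x" if x: "x \<in> corner Y X" for x
  proof -
    define y where "y = (SOME y. y \<in> corner Y X \<and> to_H0 y = to_H0 x)"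
    have y: "y \<in> corner Y X \<and> to_H0 y = to_H0 x"
      unfolding y_def by (rule someI[of _ x]) (use x in simp)
    have "to_H0 (y + alg_scale (-1) x) = vadd ?H (to_H0 x) (vscale ?H (-1) (to_H0 x))"
      using y by (simp only: to_H0_add to_H0_scale)
    also have "\<dots> = to_H0 (x + alg_scale (-1) x)" by (simp only: to_H0_add to_H0_scale)
    also have "\<dots> = vzero ?H" by (simp add: to_H0_zero)
    finally have "y + alg_scale (-1) x \<in> decomposables Y X"
      by (intro to_H0_kernel C_add C_scale) (use x y in auto)
    then have "\<pi> (y - x) = 0" using \<pi>(3) by simp
    then show ?thesis unfolding s_def y_def[symmetric] by (simp add: alg_linear_diff[OF \<pi>(1)])
  qed
  have carrier_C: "carrier (corner_rep \<phi> (E Y) (E X)) = corner Y X"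
    by (simp add: corner_rep_def corner_def)
  have "s \<in> rep_hom ?K ?H (corner_rep \<phi> (E Y) (E X))"
    unfolding rep_hom_def carrier_C
  proof (intro CollectI conjI ballI allI funcsetI)
    fix k assume "k \<in> carrier ?H"
    then obtain x where x: "x \<in> corner Y X" "to_H0 x = k" by (rule to_H0_surj)
    show "s k \<in> corner Y X" using s x \<pi>_corner by metis
    show "s (vscale ?H c k) = vscale (corner_rep \<phi> (E Y) (E X)) c (s k)" for c
      using s[OF C_scale[OF x(1)], of c] s[OF x(1)] x(2)
      by (simp add: corner_rep_def to_H0_scale alg_linear_scale[OF \<pi>(1)])
    show "s (act ?H g k) = act (corner_rep \<phi> (E Y) (E X)) g (s k)" if "g \<in> ?K" for g
      using s[OF move_corner'[OF that x(1)]] s[OF x(1)] x(2) to_H0_act[OF that x(1)] \<pi>(4)[OF that]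
      by (simp add: corner_rep_def move_def)
    fix k' assume "k' \<in> carrier ?H"
    then obtain y where y: "y \<in> corner Y X" "to_H0 y = k'" by (rule to_H0_surj)
    show "s (vadd ?H k k') = vadd (corner_rep \<phi> (E Y) (E X)) (s k) (s k')"
      using s[OF C_add[OF x(1) y(1)]] s[OF x(1)] s[OF y(1)] x(2) y(2)
      by (simp add: corner_rep_def to_H0_add alg_linear_add[OF \<pi>(1)])
  qed
  moreover have "\<forall>v\<in>Q. to_H0 v \<in> carrier ?H \<and> s (to_H0 v) = v"
    using Q_corner to_H0_carrier s fixed by (metis subsetD)
  moreover have "carrier ?H \<subseteq> generated ?H (to_H0 ` Q)"
  proof
    fix k assume "k \<in> carrier ?H"
    then obtain x where x: "x \<in> corner Y X" "to_H0 x = k" by (rule to_H0_surj)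
    have "x \<in> alg_space.span (Q \<union> decomposables Y X)" using x Q_span by blast
    then have "to_H0 x \<in> generated ?H (to_H0 ` Q)"
    proof (induction rule: alg_space.span_induct_alt)
      case base
      show ?case unfolding to_H0_zero by (rule generated.zero)
    next
      case (step c v y)
      have "to_H0 v \<in> generated ?H (to_H0 ` Q)"
      proof (cases "v \<in> Q")
        case False
        then show ?thesis using step to_H0_decomposables generated.zero by fastforce
      qed (simp add: generated.base)
      then show ?case using step unfolding to_H0_add to_H0_scale by (intro generated.add generated.scale)
    qed
    then show "k \<in> generated ?H (to_H0 ` Q)" using x by simp
  qed
  moreover have "operator_space ?K ?H"
    unfolding operator_space_def
  proof (intro conjI ballI allI)
    show "vzero ?H \<in> carrier ?H"
      unfolding to_H0_zero[symmetric] by (intro to_H0_carrier alg_space.subspace_0 corner_subspace)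
    fix k assume "k \<in> carrier ?H"
    then obtain x where x: "x \<in> corner Y X" "to_H0 x = k" by (rule to_H0_surj)
    show "vscale ?H c k \<in> carrier ?H" for c
      unfolding x(2)[symmetric] to_H0_scale[symmetric] by (intro to_H0_carrier C_scale x)
    show "vscale ?H 0 k = vzero ?H"
      unfolding x(2)[symmetric] to_H0_scale[symmetric] by (simp add: to_H0_zero)
    show "act ?H g k \<in> carrier ?H" if "g \<in> ?K" for g
      unfolding x(2)[symmetric] to_H0_act[OF that x(1), symmetric] by (intro to_H0_carrier move_corner' that x)
    show "act ?H g (vscale ?H c k) = vscale ?H c (act ?H g k)" if "g \<in> ?K" for g c
      using to_H0_act[OF that C_scale[OF x(1), of c]] to_H0_act[OF that x(1)] x(2)
      by (simp add: to_H0_scale alg_linear_scale[OF move_linear])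
    fix k' assume "k' \<in> carrier ?H"
    then obtain y where y: "y \<in> corner Y X" "to_H0 y = k'" by (rule to_H0_surj)
    show "vadd ?H k k' \<in> carrier ?H"
      unfolding x(2)[symmetric] y(2)[symmetric] to_H0_add[symmetric] by (intro to_H0_carrier C_add x y)
    show "act ?H g (vadd ?H k k') = vadd ?H (act ?H g k) (act ?H g k')" if "g \<in> ?K" for g
      using to_H0_act[OF that C_add[OF x(1) y(1)]] to_H0_act[OF that x(1)] to_H0_act[OF that y(1)] x(2) y(2)
      by (simp add: to_H0_add alg_linear_add[OF move_linear])
  qed
  ultimately show ?thesis by (intro exI[of _ s] exI[of _ to_H0] conjI)
qed

end

end

section \<open>Quotients of free representations\<close>

definition lin_ext :: "('s \<Rightarrow> ('b::{finite, semigroup_mult}, 'k::field) semigroup_algebra) \<Rightarrow> ('s \<Rightarrow>\<^sub>0 'k) \<Rightarrow> ('b, 'k) semigroup_algebra" where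
  "lin_ext e = ksum (\<lambda>s a. alg_scale a (e s))"

lemma lin_ext_add: "lin_ext e (u + v) = lin_ext e u + lin_ext e v"
  and lin_ext_diff: "lin_ext e (u - v) = lin_ext e u - lin_ext e v"
  and lin_ext_scale: "lin_ext e (free_scale c u) = alg_scale c (lin_ext e u)"
  and lin_ext_single [simp]: "lin_ext e (Poly_Mapping.single s a) = alg_scale a (e s)"
  and lin_ext_0 [simp]: "lin_ext e 0 = 0"
proof -
  show "lin_ext e (free_scale c u) = alg_scale c (lin_ext e u)"
    unfolding lin_ext_def by (rule ksum_scale) (simp_all add: alg_space.scale_right_distrib)
qed (simp_all add: lin_ext_def ksum_add ksum_diff alg_space.scale_left_distrib ksum_single, simp add: ksum_def)

lemma lin_ext_sum: "lin_ext e (\<Sum>i\<in>I. f i) = (\<Sum>i\<in>I. lin_ext e (f i))"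
  by (induction I rule: infinite_finite_induct) (simp_all add: lin_ext_add)

text \<open>Tensor products and induced representations share this form: a free space on a set with
  operators, modulo the span of relations that the operators map into that span.\<close>

locale free_quotient =
  fixes S :: "'s set" and \<alpha> :: "'r \<Rightarrow> 's \<Rightarrow> 's" and R :: "('s \<Rightarrow>\<^sub>0 'k::field) set" and K :: "'r set"
  assumes act_S: "\<And>g s. g \<in> K \<Longrightarrow> s \<in> S \<Longrightarrow> \<alpha> g s \<in> S"
    and act_R: "\<And>g r. g \<in> K \<Longrightarrow> r \<in> R \<Longrightarrow> act (free_rep S \<alpha>) g r \<in> free_space.span R"
begin

abbreviation "Q \<equiv> quotient_rep (free_rep S \<alpha>) (free_space.span R)"
abbreviation "cls \<equiv> vcoset (free_rep S \<alpha> :: ('r, 'k, 's \<Rightarrow>\<^sub>0 'k) rep) (free_space.span R)"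

sublocale quotient_data "free_rep S \<alpha>" "free_space.span R"
  by (rule free_quotient_data) (simp_all add: free_rep_def)

lemma Q_vadd: "vadd Q (cls u) (cls v) = cls (u + v)"
  by (rule quotient_vadd)

lemma Q_vscale: "vscale Q c (cls u) = cls (free_scale c u)"
  by (subst quotient_vscale)
    (simp_all add: free_rep_def free_space.scale_right_diff_distrib free_space.span_scale)

lemma Q_act:
  assumes g: "g \<in> K"
  shows "act Q g (cls u) = cls (act (free_rep S \<alpha>) g u)"
proof (rule quotient_act)
  fix n assume n: "n \<in> free_space.span R"
  show "act (free_rep S \<alpha>) g n \<in> free_space.span R"
    by (rule linear_span_image[OF act_free_rep_add act_free_rep_scale n])
      (use act_R[OF g] in \<open>auto simp: act_free_rep ksum_def intro: free_space.span_zero free_space.span_add free_space.span_scale\<close>)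
qed (rule act_free_rep_diff)

lemma Q_vzero: "vzero Q = cls 0"
  by (simp add: quotient_rep_def free_rep_def)

lemma Q_carrier: "A \<in> carrier Q \<longleftrightarrow> (\<exists>u. A = cls u \<and> Poly_Mapping.keys u \<subseteq> S)"
  by (auto simp: carrier_quotient free_rep_def)

lemma keys_act:
  assumes "g \<in> K" "Poly_Mapping.keys u \<subseteq> S"
  shows "Poly_Mapping.keys (act (free_rep S \<alpha>) g u) \<subseteq> S"
proof -
  have "act (free_rep S \<alpha>) g u \<in> {v. Poly_Mapping.keys v \<subseteq> S}"
    unfolding act_free_rep ksum_def
    by (rule free_space.subspace_sum[OF keys_subspace]) (use assms act_S in auto)
  then show ?thesis by simp
qed

lemma Q_operator_space: "operator_space K Q"
  unfolding operator_space_def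
proof (intro conjI ballI allI)
  show "vzero Q \<in> carrier Q" unfolding Q_vzero Q_carrier by (rule exI[of _ 0]) simp
  fix A assume "A \<in> carrier Q"
  then obtain u where u: "A = cls u" "u \<in> {u. Poly_Mapping.keys u \<subseteq> S}" by (auto simp: Q_carrier)
  show "vscale Q c A \<in> carrier Q" for c
    using free_space.subspace_scale[OF keys_subspace u(2), of c] unfolding u(1) Q_vscale Q_carrier by blast
  show "vscale Q 0 A = vzero Q" unfolding u(1) Q_vscale Q_vzero by simp
  show "act Q g A \<in> carrier Q" if "g \<in> K" for g
    using keys_act[OF that, of u] u unfolding u(1) Q_act[OF that] Q_carrier by blast
  show "act Q g (vscale Q c A) = vscale Q c (act Q g A)" if "g \<in> K" for g c
    unfolding u(1) Q_act[OF that] Q_vscale by (simp add: act_free_rep_scale)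
  fix B assume "B \<in> carrier Q"
  then obtain v where v: "B = cls v" "v \<in> {u. Poly_Mapping.keys u \<subseteq> S}" by (auto simp: Q_carrier)
  show "vadd Q A B \<in> carrier Q"
    using free_space.subspace_add[OF keys_subspace u(2) v(2)] unfolding u(1) v(1) Q_vadd Q_carrier by blast
  show "act Q g (vadd Q A B) = vadd Q (act Q g A) (act Q g B)" if "g \<in> K" for g
    unfolding u(1) v(1) Q_act[OF that] Q_vadd by (simp add: act_free_rep_add)
qed

text \<open>The extension of \<open>e\<close> vanishes on the span of the relations, so its value
  does not depend on the representative that \<open>F\<close> picks.\<close>

lemma Q_lift:
  fixes e :: "'s \<Rightarrow> ('b::{finite, semigroup_mult}, 'k) semigroup_algebra"
  assumes "\<And>r. r \<in> R \<Longrightarrow> lin_ext e r = 0"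
  obtains F where "\<And>u. F (cls u) = lin_ext e u"
proof -
  have R0: "lin_ext e n = 0" if "n \<in> free_space.span R" for n
    using linear_span_image[where F = "lin_ext e" and U = "{0}", OF lin_ext_add lin_ext_scale that] assms by simp
  define F where "F A = lin_ext e (SOME u. A = cls u)" for A
  have "F (cls u) = lin_ext e u" for u
  proof -
    have "cls u = cls (SOME v. cls u = cls v)" by (rule someI[of _ u]) simp
    then have "u - (SOME v. cls u = cls v) \<in> free_space.span R" by (simp only: vcoset_eq_iff)
    from R0[OF this] show ?thesis unfolding F_def lin_ext_diff by simp
  qed
  then show ?thesis by (rule that)
qed

lemma Q_generated:
  assumes "\<And>s. s \<in> S \<Longrightarrow> cls (Poly_Mapping.single s 1) \<in> generated Q T"
  shows "carrier Q \<subseteq> generated Q T"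
proof
  fix A assume "A \<in> carrier Q"
  then obtain u where u: "A = cls u" "Poly_Mapping.keys u \<subseteq> S" by (auto simp: Q_carrier)
  have "cls u \<in> generated Q T"
    using keys_subset_span[OF u(2)]
  proof (induction rule: free_space.span_induct_alt)
    case base
    show ?case unfolding Q_vzero[symmetric] by (rule generated.zero)
  next
    case (step c x y)
    then show ?case unfolding Q_vadd[symmetric] Q_vscale[symmetric]
      using assms by (intro generated.add generated.scale) auto
  qed
  then show "A \<in> generated Q T" using u by simp
qed

end

lemma lin_ext_act:
  assumes "Poly_Mapping.keys u \<subseteq> S" "\<And>s. s \<in> S \<Longrightarrow> e (\<alpha> g s) = f (e s)" "alg_linear f"
  shows "lin_ext e (act (free_rep S \<alpha>) g u) = f (lin_ext e u)"
proof -
  have "lin_ext e (act (free_rep S \<alpha>) g u) = (\<Sum>s\<in>Poly_Mapping.keys u. alg_scale (Poly_Mapping.lookup u s) (e (\<alpha> g s)))"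
    unfolding act_free_rep ksum_def lin_ext_sum by simp
  also have "\<dots> = (\<Sum>s\<in>Poly_Mapping.keys u. f (alg_scale (Poly_Mapping.lookup u s) (e s)))"
    using assms by (intro sum.cong refl) (auto simp: alg_linear_scale)
  also have "\<dots> = f (lin_ext e u)" by (simp add: lin_ext_def ksum_def alg_linear_sum[OF assms(3)])
  finally show ?thesis .
qed


section \<open>Tensor products\<close>

lemma listset_iff: "xs \<in> listset As \<longleftrightarrow> length xs = length As \<and> (\<forall>i<length As. xs ! i \<in> As ! i)"
proof (induction As arbitrary: xs)
  case (Cons A As)
  then show ?case by (cases xs) (auto simp: set_Cons_def nth_Cons split: nat.splits)
qed simp

text \<open>Multilinear induction. For growing \<open>k\<close>, the first \<open>k\<close> entries
  range over the full carriers and the remaining ones over the spanning sets \<open>Ts\<close>;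
  freeing one more entry is an induction over \<open>generated\<close> in that slot.\<close>

lemma slot_induct:
  fixes Vs :: "('r, 'k::field, 'v) rep list" and Ts :: "'v set list"
  assumes len: "length Ts = length Vs"
    and op: "\<And>i. i < length Vs \<Longrightarrow> operator_space K (Vs ! i)"
    and Ts: "\<And>i. i < length Vs \<Longrightarrow> Ts ! i \<subseteq> carrier (Vs ! i)"
    and gen: "\<And>i. i < length Vs \<Longrightarrow> carrier (Vs ! i) \<subseteq> generated (Vs ! i) (Ts ! i)"
    and base: "\<And>xs. xs \<in> listset Ts \<Longrightarrow> P xs"
    and zero: "\<And>xs i. xs \<in> listset (map carrier Vs) \<Longrightarrow> i < length Vs \<Longrightarrow> P (xs[i := vzero (Vs ! i)])"
    and add: "\<And>xs i v w. xs \<in> listset (map carrier Vs) \<Longrightarrow> i < length Vs \<Longrightarrow> v \<in> carrier (Vs ! i) \<Longrightarrow>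
      w \<in> carrier (Vs ! i) \<Longrightarrow> P (xs[i := v]) \<Longrightarrow> P (xs[i := w]) \<Longrightarrow> P (xs[i := vadd (Vs ! i) v w])"
    and scale: "\<And>xs i c v. xs \<in> listset (map carrier Vs) \<Longrightarrow> i < length Vs \<Longrightarrow> v \<in> carrier (Vs ! i) \<Longrightarrow>
      P (xs[i := v]) \<Longrightarrow> P (xs[i := vscale (Vs ! i) c v])"
    and xs: "xs \<in> listset (map carrier Vs)"
  shows "P xs"
proof -
  have "k \<le> length Vs \<Longrightarrow> length xs = length Vs \<Longrightarrow>
      (\<And>i. i < length Vs \<Longrightarrow> xs ! i \<in> (if i < k then carrier (Vs ! i) else Ts ! i)) \<Longrightarrow> P xs" for k xs
  proof (induction k arbitrary: xs)
    case 0
    then show ?case by (intro base) (simp add: listset_iff len)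
  next
    case (Suc k)
    then have k: "k < length Vs" by simp
    have xs: "xs \<in> listset (map carrier Vs)"
      unfolding listset_iff using Suc.prems Ts by (force split: if_splits)
    have "v \<in> generated (Vs ! k) (Ts ! k) \<Longrightarrow> P (xs[k := v])" for v
    proof (induction v rule: generated.induct)
      case (base t)
      show ?case
      proof (rule Suc.IH)
        fix i assume i: "i < length Vs"
        then show "xs[k := t] ! i \<in> (if i < k then carrier (Vs ! i) else Ts ! i)"
          using Suc.prems(2) Suc.prems(3)[OF i] base by (cases "i = k") (auto split: if_splits)
      qed (use Suc.prems in simp_all)
    next
      case (add v w)
      then show ?case using assms(7)[OF xs k] generated_subset[OF op[OF k] Ts[OF k]] by blast
    next
      case (scale v c)
      then show ?case using assms(8)[OF xs k] generated_subset[OF op[OF k] Ts[OF k]] by blast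
    qed (rule zero[OF xs k])
    moreover have "xs ! k \<in> generated (Vs ! k) (Ts ! k)"
      using Suc.prems(3)[OF k] gen[OF k] by auto
    ultimately have "P (xs[k := xs ! k])" by blast
    then show ?case by simp
  qed
  from this[of "length Vs" xs] xs show ?thesis by (simp add: listset_iff)
qed

locale tensor_factors =
  fixes Vs :: "('r, 'k::field, 'v) rep list" and K :: "'r set"
  assumes op: "\<And>i. i < length Vs \<Longrightarrow> operator_space K (Vs ! i)"
begin

abbreviation "tensor_act \<equiv> \<lambda>g. map2 (\<lambda>V. act V g) Vs"

lemma tensor_act_update:
  "length xs = length Vs \<Longrightarrow> i < length Vs \<Longrightarrow> tensor_act g (xs[i := v]) = (tensor_act g xs)[i := act (Vs ! i) g v]"
  by (rule nth_equalityI) (auto simp: nth_list_update)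

lemma tensor_act_listset:
  "g \<in> K \<Longrightarrow> xs \<in> listset (map carrier Vs) \<Longrightarrow> tensor_act g xs \<in> listset (map carrier Vs)"
  using op by (auto simp: listset_iff operator_space_def)

sublocale tensor: free_quotient "listset (map carrier Vs)" tensor_act "tensor_relations Vs" K
proof
  fix g assume g: "g \<in> K"
  show "tensor_act g s \<in> listset (map carrier Vs)" if "s \<in> listset (map carrier Vs)" for s
    using tensor_act_listset g that .
  fix r assume "r \<in> tensor_relations Vs"
  then consider xs i v w where "r = Poly_Mapping.single (xs[i := vadd (Vs ! i) v w]) 1
        - Poly_Mapping.single (xs[i := v]) 1 - Poly_Mapping.single (xs[i := w]) 1"
      "xs \<in> listset (map carrier Vs)" "i < length Vs" "v \<in> carrier (Vs ! i)" "w \<in> carrier (Vs ! i)"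
    | xs i c v where "r = Poly_Mapping.single (xs[i := vscale (Vs ! i) c v]) 1 - Poly_Mapping.single (xs[i := v]) c"
      "xs \<in> listset (map carrier Vs)" "i < length Vs" "v \<in> carrier (Vs ! i)"
    unfolding tensor_relations_def by blast
  then have "act (free_rep (listset (map carrier Vs)) tensor_act) g r \<in> tensor_relations Vs"
  proof cases
    case 1
    have len: "length xs = length Vs" using 1 by (simp add: listset_iff)
    have lin: "act (Vs ! i) g (vadd (Vs ! i) v w) = vadd (Vs ! i) (act (Vs ! i) g v) (act (Vs ! i) g w)"
      "act (Vs ! i) g v \<in> carrier (Vs ! i)" "act (Vs ! i) g w \<in> carrier (Vs ! i)"
      using op[OF 1(3)] g 1(4,5) unfolding operator_space_def by blast+
    show ?thesis
      unfolding 1(1) act_free_rep_diff act_free_rep_single tensor_act_update[OF len 1(3)] lin(1) tensor_relations_def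
      using tensor_act_listset[OF g 1(2)] 1(3) lin(2,3) by blast
  next
    case 2
    have len: "length xs = length Vs" using 2 by (simp add: listset_iff)
    have lin: "act (Vs ! i) g (vscale (Vs ! i) c v) = vscale (Vs ! i) c (act (Vs ! i) g v)"
      "act (Vs ! i) g v \<in> carrier (Vs ! i)"
      using op[OF 2(3)] g 2(4) unfolding operator_space_def by blast+
    show ?thesis
      unfolding 2(1) act_free_rep_diff act_free_rep_single tensor_act_update[OF len 2(3)] lin(1) tensor_relations_def
      using tensor_act_listset[OF g 2(2)] 2(3) lin(2) by blast
  qed
  then show "act (free_rep (listset (map carrier Vs)) tensor_act) g r \<in> free_space.span (tensor_relations Vs)"
    by (rule free_space.span_base)
qed

lemma tensor_rep_eq: "tensor_rep Vs = tensor.Q"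
  by (simp add: tensor_rep_def)

abbreviation "pure xs \<equiv> tensor.cls (Poly_Mapping.single xs 1)"

lemma pure_add:
  assumes "xs \<in> listset (map carrier Vs)" "i < length Vs" "v \<in> carrier (Vs ! i)" "w \<in> carrier (Vs ! i)"
  shows "pure (xs[i := vadd (Vs ! i) v w]) = vadd (tensor_rep Vs) (pure (xs[i := v])) (pure (xs[i := w]))"
proof -
  have "Poly_Mapping.single (xs[i := vadd (Vs ! i) v w]) 1 - Poly_Mapping.single (xs[i := v]) 1
      - Poly_Mapping.single (xs[i := w]) 1 \<in> tensor_relations Vs"
    unfolding tensor_relations_def using assms by blast
  then have "Poly_Mapping.single (xs[i := vadd (Vs ! i) v w]) 1 -
      (Poly_Mapping.single (xs[i := v]) 1 + Poly_Mapping.single (xs[i := w]) 1) \<in> free_space.span (tensor_relations Vs)"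
    by (simp add: free_space.span_base diff_diff_eq)
  then show ?thesis unfolding tensor_rep_eq tensor.Q_vadd by (simp only: tensor.vcoset_eq_iff)
qed

lemma pure_scale:
  assumes "xs \<in> listset (map carrier Vs)" "i < length Vs" "v \<in> carrier (Vs ! i)"
  shows "pure (xs[i := vscale (Vs ! i) c v]) = vscale (tensor_rep Vs) c (pure (xs[i := v]))"
proof -
  have "Poly_Mapping.single (xs[i := vscale (Vs ! i) c v]) 1 - Poly_Mapping.single (xs[i := v]) c \<in> tensor_relations Vs"
    unfolding tensor_relations_def using assms by blast
  then have "Poly_Mapping.single (xs[i := vscale (Vs ! i) c v]) 1 -
      free_scale c (Poly_Mapping.single (xs[i := v]) 1) \<in> free_space.span (tensor_relations Vs)"
    by (simp add: free_space.span_base)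
  then show ?thesis unfolding tensor_rep_eq tensor.Q_vscale by (simp only: tensor.vcoset_eq_iff)
qed

lemma tensor_generated:
  assumes len: "length Ts = length Vs"
    and Ts: "\<And>i. i < length Vs \<Longrightarrow> Ts ! i \<subseteq> carrier (Vs ! i)"
    and gen: "\<And>i. i < length Vs \<Longrightarrow> carrier (Vs ! i) \<subseteq> generated (Vs ! i) (Ts ! i)"
  shows "carrier (tensor_rep Vs) \<subseteq> generated (tensor_rep Vs) (pure ` listset Ts)"
  unfolding tensor_rep_eq
proof (rule tensor.Q_generated, fold tensor_rep_eq)
  let ?gen = "generated (tensor_rep Vs) (pure ` listset Ts)"
  fix xs assume "xs \<in> listset (map carrier Vs)"
  then show "pure xs \<in> ?gen"
  proof (rule slot_induct[OF len op Ts gen, where P = "\<lambda>xs. pure xs \<in> ?gen", rotated -1])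
    show "pure ys \<in> ?gen" if "ys \<in> listset Ts" for ys using that by (intro generated.base imageI)
    \<comment> \<open>A zero entry is \<open>0\<close> times itself, and the scalar can be pulled
      out of the tensor.\<close>
    show "pure (ys[i := vzero (Vs ! i)]) \<in> ?gen" if ys: "ys \<in> listset (map carrier Vs)" and i: "i < length Vs" for ys i
    proof -
      have z: "vzero (Vs ! i) \<in> carrier (Vs ! i)" "vzero (Vs ! i) = vscale (Vs ! i) 0 (vzero (Vs ! i))"
        using op[OF i] unfolding operator_space_def by metis+
      have "pure (ys[i := vzero (Vs ! i)]) = vscale (tensor_rep Vs) 0 (pure (ys[i := vzero (Vs ! i)]))"
        using pure_scale[OF ys i z(1), of 0] z(2) by simp
      also have "\<dots> = vzero (tensor_rep Vs)" unfolding tensor_rep_eq tensor.Q_vscale tensor.Q_vzero by simp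
      finally show ?thesis by (simp add: generated.zero)
    qed
  qed (auto simp: pure_add pure_scale intro: generated.add generated.scale)
qed

lemma tensor_lift:
  fixes e :: "'v list \<Rightarrow> ('b::{finite, semigroup_mult}, 'k) semigroup_algebra"
  assumes add: "\<And>xs i v w. xs \<in> listset (map carrier Vs) \<Longrightarrow> i < length Vs \<Longrightarrow> v \<in> carrier (Vs ! i) \<Longrightarrow>
      w \<in> carrier (Vs ! i) \<Longrightarrow> e (xs[i := vadd (Vs ! i) v w]) = e (xs[i := v]) + e (xs[i := w])"
    and scale: "\<And>xs i c v. xs \<in> listset (map carrier Vs) \<Longrightarrow> i < length Vs \<Longrightarrow> v \<in> carrier (Vs ! i) \<Longrightarrow>
      e (xs[i := vscale (Vs ! i) c v]) = alg_scale c (e (xs[i := v]))"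
  obtains F where "\<And>u. F (tensor.cls u) = lin_ext e u"
proof (rule tensor.Q_lift[of e])
  fix r assume "r \<in> tensor_relations Vs"
  then show "lin_ext e r = 0"
    unfolding tensor_relations_def by (auto simp: lin_ext_diff add scale)
qed (rule that)

end


section \<open>Induced representations\<close>

lemma (in vector_space) span_image_finite:
  assumes I: "finite I" and u: "u \<in> span (f ` I)"
  shows "\<exists>c. u = (\<Sum>i\<in>I. scale (c i) (f i))"
  using u
proof (induction rule: span_induct_alt)
  case base
  show ?case by (rule exI[of _ "\<lambda>_. 0"]) simp
next
  case (step a x y)
  then obtain c i where c: "y = (\<Sum>i\<in>I. scale (c i) (f i))" and i: "i \<in> I" "x = f i" by blast
  have "(\<Sum>j\<in>I. scale (if j = i then a else 0) (f j)) = (\<Sum>j\<in>I. if j = i then scale a (f i) else 0)"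
    by (intro sum.cong) auto
  also have "\<dots> = scale a x" using I i by simp
  finally have "scale a x + y = (\<Sum>j\<in>I. scale ((if j = i then a else 0) + c j) (f j))"
    by (simp add: c scale_left_distrib sum.distrib)
  then show ?case by (rule exI[of _ "\<lambda>j. (if j = i then a else 0) + c j"])
qed

locale induction_data = group G for G :: "('g, 'm) monoid_scheme" +
  fixes H K :: "'g set" and V :: "('g, 'k::field, 'v) rep"
  assumes K: "subgroup K G" and HK: "H \<subseteq> K" and V: "operator_space H V"
begin

abbreviation "translate \<equiv> \<lambda>g (x, v). (g \<otimes>\<^bsub>G\<^esub> x, v :: 'v)"

lemma K_carrier: "x \<in> K \<Longrightarrow> x \<in> carrier G"
  by (rule subgroup.mem_carrier[OF K])

lemma K_mult: "x \<in> K \<Longrightarrow> y \<in> K \<Longrightarrow> x \<otimes>\<^bsub>G\<^esub> y \<in> K"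
  by (rule subgroup.m_closed[OF K])

sublocale ind: free_quotient "K \<times> carrier V" translate "induction_relations G H K V" K
proof
  fix g assume g: "g \<in> K"
  show "translate g s \<in> K \<times> carrier V" if "s \<in> K \<times> carrier V" for s
    using that K_mult g by auto
  fix r assume "r \<in> induction_relations G H K V"
  then consider x v w where "r = Poly_Mapping.single (x, vadd V v w) 1
        - Poly_Mapping.single (x, v) 1 - Poly_Mapping.single (x, w) 1" "x \<in> K" "v \<in> carrier V" "w \<in> carrier V"
    | x c v where "r = Poly_Mapping.single (x, vscale V c v) 1 - Poly_Mapping.single (x, v) c" "x \<in> K" "v \<in> carrier V"
    | x h v where "r = Poly_Mapping.single (x \<otimes>\<^bsub>G\<^esub> h, v) 1 - Poly_Mapping.single (x, act V h v) 1"
        "x \<in> K" "h \<in> H" "v \<in> carrier V"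
    unfolding induction_relations_def by blast
  then have "act (free_rep (K \<times> carrier V) translate) g r \<in> induction_relations G H K V"
  proof cases
    case 1
    show ?thesis unfolding 1(1) act_free_rep_diff act_free_rep_single induction_relations_def prod.case
      using K_mult[OF g 1(2)] 1(3,4) by blast
  next
    case 2
    show ?thesis unfolding 2(1) act_free_rep_diff act_free_rep_single induction_relations_def prod.case
      using K_mult[OF g 2(2)] 2(3) by blast
  next
    case 3
    have "g \<otimes>\<^bsub>G\<^esub> (x \<otimes>\<^bsub>G\<^esub> h) = g \<otimes>\<^bsub>G\<^esub> x \<otimes>\<^bsub>G\<^esub> h"
      using g 3 HK K_carrier by (intro m_assoc[symmetric]) auto
    then show ?thesis unfolding 3(1) act_free_rep_diff act_free_rep_single induction_relations_def prod.case
      using K_mult[OF g 3(2)] 3(3,4) by auto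
  qed
  then show "act (free_rep (K \<times> carrier V) translate) g r \<in> free_space.span (induction_relations G H K V)"
    by (rule free_space.span_base)
qed

lemma induced_rep_eq: "induced_rep G H K V = ind.Q"
  by (simp add: induced_rep_def)

text \<open>One direction of Frobenius reciprocity: the generator \<open>(x, v)\<close> goes to
  \<open>M x (F v)\<close>, and compatibility of \<open>F\<close> with \<open>H\<close> respects the
  relations that move an element of \<open>H\<close> across.\<close>

lemma induced_lift:
  fixes F :: "'v \<Rightarrow> ('b::{finite, semigroup_mult}, 'k) semigroup_algebra" and M :: "'g \<Rightarrow> _"
  assumes M: "\<And>x. x \<in> K \<Longrightarrow> alg_linear (M x)"
    and M_mult: "\<And>x h a. x \<in> K \<Longrightarrow> h \<in> K \<Longrightarrow> M (x \<otimes>\<^bsub>G\<^esub> h) a = M x (M h a)"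
    and add: "\<And>v w. v \<in> carrier V \<Longrightarrow> w \<in> carrier V \<Longrightarrow> F (vadd V v w) = F v + F w"
    and scale: "\<And>c v. v \<in> carrier V \<Longrightarrow> F (vscale V c v) = alg_scale c (F v)"
    and act: "\<And>h v. h \<in> H \<Longrightarrow> v \<in> carrier V \<Longrightarrow> F (act V h v) = M h (F v)"
  obtains F' where "\<And>u. F' (ind.cls u) = lin_ext (\<lambda>(x, v). M x (F v)) u"
proof (rule ind.Q_lift[of "\<lambda>(x, v). M x (F v)"])
  fix r assume "r \<in> induction_relations G H K V"
  then show "lin_ext (\<lambda>(x, v). M x (F v)) r = 0"
    unfolding induction_relations_def using HK
    by (auto simp: lin_ext_diff add scale act alg_linear_add[OF M] alg_linear_scale[OF M] M_mult subset_iff)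
qed (rule that)

text \<open>Writing \<open>x\<close> as \<open>t p\<close> times an element of \<open>H\<close>, the
  relations move that element into \<open>V\<close>, where the vector is expanded in the spanning
  family. Uniqueness of the coefficients is not claimed here.\<close>

lemma induced_normal_form:
  assumes I: "finite I" and T: "\<And>i. i \<in> I \<Longrightarrow> f i \<in> carrier V" and gen: "carrier V \<subseteq> generated V (f ` I)"
    and O: "finite P" and t: "\<And>x. x \<in> K \<Longrightarrow> \<exists>p\<in>P. \<exists>h\<in>H. x = t p \<otimes>\<^bsub>G\<^esub> h" and tK: "\<And>p. p \<in> P \<Longrightarrow> t p \<in> K"
    and A: "A \<in> carrier (induced_rep G H K V)"
  shows "\<exists>c. A = ind.cls (\<Sum>(p, i)\<in>P \<times> I. Poly_Mapping.single (t p, f i) (c (p, i)))"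
proof -
  let ?R = "induction_relations G H K V"
  define B where "B = (\<lambda>(p, i). Poly_Mapping.single (t p, f i) (1 :: 'k)) ` (P \<times> I)"
  \<comment> \<open>Membership in \<open>U\<close> means being a combination of the normal forms
    modulo the relations.\<close>
  define U where "U = free_space.span (?R \<union> B)"
  have subR: "r \<in> U" if "r \<in> ?R" for r unfolding U_def using that by (intro free_space.span_base) blast
  have slice: "Poly_Mapping.single (t p, v) 1 \<in> U" if p: "p \<in> P" and v: "v \<in> generated V (f ` I)" for p v
    using v
  proof (induction v rule: generated.induct)
    case zero
    have z: "vzero V \<in> carrier V" "vscale V 0 (vzero V) = vzero V"
      using V unfolding operator_space_def by blast+
    then have "Poly_Mapping.single (t p, vscale V 0 (vzero V)) 1 - Poly_Mapping.single (t p, vzero V) 0 \<in> ?R"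
      unfolding induction_relations_def using tK[OF p] by blast
    then show ?case using subR z by simp
  next
    case (base v)
    then show ?case unfolding U_def B_def using p by (intro free_space.span_base) auto
  next
    case (add v w)
    have vw: "v \<in> carrier V" "w \<in> carrier V"
      using add(1,2) generated_subset[OF V, of "f ` I"] T by blast+
    have "Poly_Mapping.single (t p, vadd V v w) 1 - Poly_Mapping.single (t p, v) 1 - Poly_Mapping.single (t p, w) 1 \<in> U"
      by (rule subR) (use vw tK[OF p] in \<open>unfold induction_relations_def, blast\<close>)
    then have "Poly_Mapping.single (t p, vadd V v w) 1 - Poly_Mapping.single (t p, v) 1 - Poly_Mapping.single (t p, w) 1
        + (Poly_Mapping.single (t p, w) 1 + Poly_Mapping.single (t p, v) 1) \<in> U"
      using add(3,4) unfolding U_def by (intro free_space.span_add)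
    then show ?case by simp
  next
    case (scale v c)
    have v: "v \<in> carrier V"
      using scale(1) generated_subset[OF V, of "f ` I"] T by blast
    have "Poly_Mapping.single (t p, vscale V c v) 1 - Poly_Mapping.single (t p, v) c \<in> U"
      by (rule subR) (use v tK[OF p] in \<open>unfold induction_relations_def, blast\<close>)
    moreover have "free_scale c (Poly_Mapping.single (t p, v) 1) \<in> U"
      using scale(2) unfolding U_def by (rule free_space.span_scale)
    ultimately have "Poly_Mapping.single (t p, vscale V c v) 1 - Poly_Mapping.single (t p, v) c
        + free_scale c (Poly_Mapping.single (t p, v) 1) \<in> U"
      unfolding U_def by (rule free_space.span_add)
    then show ?case by simp
  qed
  have single: "Poly_Mapping.single (x, v) 1 \<in> U" if xv: "x \<in> K" "v \<in> carrier V" for x v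
  proof -
    obtain p h where oh: "p \<in> P" "h \<in> H" "x = t p \<otimes>\<^bsub>G\<^esub> h" using t xv by blast
    have "act V h v \<in> carrier V" using V oh(2) xv(2) unfolding operator_space_def by blast
    then have 1: "Poly_Mapping.single (t p, act V h v) 1 \<in> U" using slice[OF oh(1)] gen by blast
    have "Poly_Mapping.single (t p \<otimes>\<^bsub>G\<^esub> h, v) 1 - Poly_Mapping.single (t p, act V h v) 1 \<in> U"
      by (rule subR) (use xv oh tK in \<open>unfold induction_relations_def, blast\<close>)
    then have "Poly_Mapping.single (t p \<otimes>\<^bsub>G\<^esub> h, v) 1 - Poly_Mapping.single (t p, act V h v) 1
        + Poly_Mapping.single (t p, act V h v) 1 \<in> U"
      using 1 unfolding U_def by (intro free_space.span_add)
    then show ?thesis using oh by simp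
  qed
  obtain u where u: "A = ind.cls u" "Poly_Mapping.keys u \<subseteq> K \<times> carrier V"
    using A unfolding induced_rep_eq ind.Q_carrier by blast
  have "(\<lambda>s. Poly_Mapping.single s 1) ` (K \<times> carrier V) \<subseteq> U" using single by auto
  then have "u \<in> U"
    using keys_subset_span[OF u(2)] free_space.span_minimal[of _ U] unfolding U_def by blast
  then obtain r y where ry: "r \<in> free_space.span ?R" "y \<in> free_space.span B" "u = r + y"
    unfolding U_def free_space.span_Un by blast
  obtain c where c: "y = (\<Sum>p\<in>P \<times> I. free_scale (c p) ((\<lambda>(p, i). Poly_Mapping.single (t p, f i) 1) p))"
    using free_space.span_image_finite[OF finite_cartesian_product[OF O I] ry(2)[unfolded B_def]] by blast
  then have y: "y = (\<Sum>(p, i)\<in>P \<times> I. Poly_Mapping.single (t p, f i) (c (p, i)))"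
    by (simp add: case_prod_unfold)
  have "A = ind.cls y" unfolding u(1) ind.vcoset_eq_iff using ry by simp
  then show ?thesis using y by blast
qed

end

section \<open>Products along chains\<close>

lemma length_steps [simp]: "length (steps F c) = length c - 1"
  by (simp add: steps_def)

lemma nth_steps [simp]: "i < length c - 1 \<Longrightarrow> steps F c ! i = F (c ! Suc i) (c ! i)"
  by (simp add: steps_def)

lemma steps_append:
  assumes "as \<noteq> []" "bs \<noteq> []"
  shows "steps F (as @ bs) = steps F as @ F (hd bs) (last as) # steps F bs"
  using assms
proof (induction as)
  case (Cons a as)
  then show ?case by (cases "as = []") (simp_all add: steps_Cons)
qed simp

lemma map_steps: "map f (steps F c) = steps (\<lambda>Z W. f (F Z W)) c"
  by (simp add: steps_def)

lemma listset_list_all2: "xs \<in> listset As \<longleftrightarrow> list_all2 (\<in>) xs As"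
  by (auto simp: listset_iff list_all2_conv_all_nth)

lemma listset_map2_image:
  assumes "length fs = length As"
  shows "listset (map2 (\<lambda>f A. f ` A) fs As) = map2 (\<lambda>f x. f x) fs ` listset As"
  using assms
proof (induction fs As rule: list_induct2)
  case (Cons f fs A As)
  show ?case
  proof (intro equalityI subsetI)
    fix ys assume "ys \<in> listset (map2 (\<lambda>f A. f ` A) (f # fs) (A # As))"
    then obtain x xs where "ys = f x # map2 (\<lambda>f x. f x) fs xs" "x \<in> A" "xs \<in> listset As"
      using Cons by (auto simp: set_Cons_def)
    then show "ys \<in> map2 (\<lambda>f x. f x) (f # fs) ` listset (A # As)"
      by (intro image_eqI[of _ _ "x # xs"]) (auto simp: set_Cons_def)
  next
    fix ys assume "ys \<in> map2 (\<lambda>f x. f x) (f # fs) ` listset (A # As)"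
    then show "ys \<in> listset (map2 (\<lambda>f A. f ` A) (f # fs) (A # As))"
      using Cons by (auto simp: set_Cons_def)
  qed
qed simp

lemma set_Cons_image: "set_Cons A X = (\<lambda>(x, xs). x # xs) ` (A \<times> X)"
  by (auto simp: set_Cons_def)

lemma card_listset: "card (listset As) = prod_list (map card As)"
proof (induction As)
  case (Cons A As)
  have "inj_on (\<lambda>(x, xs). x # xs) (A \<times> listset As)" by (auto simp: inj_on_def)
  then show ?case using Cons by (simp add: set_Cons_image card_image card_cartesian_product)
qed simp

lemma finite_listset: "(\<And>A. A \<in> set As \<Longrightarrow> finite A) \<Longrightarrow> finite (listset As)"
  by (induction As) (auto simp: set_Cons_image)

lemma fold_mult_linear: "alg_linear (fold (*) zs)"
proof (induction zs)
  case Nil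
  then show ?case using alg_linear_id by simp
next
  case (Cons z zs)
  have "fold (*) (z # zs) = (\<lambda>a. fold (*) zs (z * a))" by auto
  then show ?case using alg_linear_compose[OF Cons alg_linear_mult_left] by simp
qed

lemma fold_mult_update:
  assumes "i < length zs"
  shows "alg_linear (\<lambda>v. fold (*) (zs[i := v]) a)"
proof -
  have "(\<lambda>v. fold (*) (zs[i := v]) a) = (\<lambda>v. fold (*) (drop (Suc i) zs) (v * fold (*) (take i zs) a))"
    using assms by (simp add: upd_conv_take_nth_drop)
  then show ?thesis using alg_linear_compose[OF fold_mult_linear alg_linear_mult_right] by simp
qed

lemma support_chainsD:
  assumes c: "c \<in> support_chains X Y m"
  shows "length c = Suc m" "set c \<subseteq> supports" "c \<noteq> []" "hd c = X" "last c = Y" "X \<in> set c" "Y \<in> set c"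
proof -
  show *: "length c = Suc m" "set c \<subseteq> supports" "hd c = X" "last c = Y"
    using assms by (simp_all add: support_chains_def)
  then show "c \<noteq> []" by auto
  then show "X \<in> set c" "Y \<in> set c" using * hd_in_set last_in_set by blast+
qed

lemma support_chains_step:
  assumes c: "c \<in> support_chains X Y m" and i: "i < m"
  shows "c ! i \<in> supports" "c ! Suc i \<in> supports" "c ! i \<subset> c ! Suc i" "X \<subseteq> c ! i" "X \<subset> c ! Suc i" "c ! Suc i \<subseteq> Y"
    "c ! i \<in> set c" "c ! Suc i \<in> set c"
proof -
  have len: "length c = Suc m" and sup: "set c \<subseteq> supports" and sorted: "sorted_wrt (\<subset>) c"
    and hd: "c ! 0 = X" and last: "c ! m = Y"
    using c support_chainsD[OF c] hd_conv_nth[of c] last_conv_nth[of c] by (simp_all add: support_chains_def)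
  show "c ! i \<in> set c" "c ! Suc i \<in> set c" using len i by simp_all
  then show "c ! i \<in> supports" "c ! Suc i \<in> supports" using sup by blast+
  show step: "c ! i \<subset> c ! Suc i" using sorted_wrt_nth_less[OF sorted, of i "Suc i"] len i by simp
  show Xi: "X \<subseteq> c ! i" using sorted_wrt_nth_less[OF sorted, of 0 i] hd len i by (cases "i = 0") auto
  show "X \<subset> c ! Suc i" using Xi step by blast
  show "c ! Suc i \<subseteq> Y" using sorted_wrt_nth_less[OF sorted, of "Suc i" m] last len i by (cases "Suc i = m") auto
qed

context standard_idempotents
begin

lemma fold_corner:
  assumes "c \<noteq> []" "set c \<subseteq> supports" "zs \<in> listset (steps corner c)" "W \<in> supports" "a \<in> corner (hd c) W"
  shows "fold (*) zs a \<in> corner (last c) W"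
  using assms
proof (induction c arbitrary: zs a)
  case (Cons x c)
  show ?case
  proof (cases "c = []")
    case True
    then show ?thesis using Cons.prems by simp
  next
    case False
    then obtain z zs' where z: "zs = z # zs'" "z \<in> corner (hd c) x" "zs' \<in> listset (steps corner c)"
      using Cons.prems(3) by (auto simp: steps_Cons set_Cons_def)
    have "z * a \<in> corner (hd c) W"
      using corner_mult[OF Cons.prems(4) _ _ z(2), of a] Cons.prems False by (auto dest: hd_in_set)
    then show ?thesis using Cons.IH[OF False _ z(3) Cons.prems(4)] Cons.prems z(1) False by simp
  qed
qed simp

text \<open>Arbitrary corner elements are allowed as factors, not just arrows, so that the family
  contains the result of splitting one factor.\<close>

definition chain_products where
  "chain_products X Y m = {fold (*) zs (E X) | zs c. c \<in> support_chains X Y m \<and> zs \<in> listset (steps corner c)}"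

text \<open>Where the factor at step \<open>i\<close> splits through \<open>Z\<close>, inserting
  \<open>Z\<close> into the chain exhibits the same product along a chain with one more
  step.\<close>

lemma refine_chain:
  assumes c: "c \<in> support_chains X Y m" and i: "i < m" and Z: "Z \<in> supports" "c ! i \<subset> Z" "Z \<subset> c ! Suc i"
    and xs: "xs \<in> listset (steps corner c)" and xi: "xs ! i = y * z"
    and yz: "y \<in> corner (c ! Suc i) Z" "z \<in> corner Z (c ! i)"
  shows "fold (*) xs (E X) \<in> chain_products X Y (Suc m)"
proof -
  have len: "length c = Suc m" using support_chainsD(1)[OF c] .
  define as where "as = take (Suc i) c"
  define bs where "bs = drop (Suc i) c"
  have ab: "c = as @ bs" "as \<noteq> []" "bs \<noteq> []" using len i by (auto simp: as_def bs_def)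
  have las: "last as = c ! i" using len i by (simp add: as_def last_conv_nth take_Suc_conv_app_nth)
  have hbs: "hd bs = c ! Suc i" using len i by (simp add: bs_def hd_drop_conv_nth)
  have "list_all2 (\<in>) xs (steps corner as @ corner (hd bs) (last as) # steps corner bs)"
    using xs ab steps_append[OF ab(2,3), of corner] by (simp add: listset_list_all2)
  then obtain us v ws where xs': "xs = us @ v # ws" "list_all2 (\<in>) us (steps corner as)" "list_all2 (\<in>) ws (steps corner bs)"
    by (auto simp: list_all2_append2 list_all2_Cons2)
  have "length us = i" using list_all2_lengthD[OF xs'(2)] len i by (simp add: as_def)
  then have v: "v = y * z" using xi nth_append_length[of us v ws] by (simp add: xs'(1))
  let ?c = "as @ Z # bs"
  have "steps corner ?c = steps corner as @ corner Z (last as) # corner (hd bs) Z # steps corner bs"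
    using ab by (simp add: steps_append steps_Cons)
  then have "us @ z # y # ws \<in> listset (steps corner ?c)"
    using xs' yz las hbs by (auto simp: listset_list_all2 intro!: list_all2_appendI)
  moreover have "?c \<in> support_chains X Y (Suc m)"
  proof -
    have c': "set c \<subseteq> supports" "sorted_wrt (\<subset>) c" "hd c = X" "last c = Y" using c by (auto simp: support_chains_def)
    have sorted: "sorted_wrt (\<subset>) as" "sorted_wrt (\<subset>) bs" "\<And>a b. a \<in> set as \<Longrightarrow> b \<in> set bs \<Longrightarrow> a \<subset> b"
      using c'(2) ab(1) by (auto simp: sorted_wrt_append)
    have "a \<subset> Z" if "a \<in> set as" for a
    proof -
      have "a \<subseteq> last as"
      proof -
        obtain as' where as': "as = as' @ [last as]" using ab(2) by (metis append_butlast_last_id)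
        have "sorted_wrt (\<subset>) (as' @ [last as])" using sorted(1) as' by simp
        moreover have "a \<in> set as' \<or> a = last as" using that as' by (metis Un_iff set_append set_ConsD empty_iff empty_set)
        ultimately show ?thesis by (auto simp: sorted_wrt_append)
      qed
      then show ?thesis using Z las by blast
    qed
    moreover have "Z \<subset> b" if "b \<in> set bs" for b
    proof -
      have "hd bs \<subseteq> b" using sorted(2) that ab(3) by (cases bs) auto
      then show ?thesis using Z hbs by blast
    qed
    moreover have "a \<subset> b" if "a \<in> set as" "b \<in> set bs" for a b using sorted(3) that .
    ultimately have "sorted_wrt (\<subset>) ?c" using sorted(1,2) by (simp add: sorted_wrt_append)
    then show ?thesis using c' ab Z(1) len by (auto simp: support_chains_def)
  qed
  moreover have "fold (*) (us @ z # y # ws) (E X) = fold (*) xs (E X)" by (simp add: xs'(1) v mult.assoc)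
  ultimately show ?thesis unfolding chain_products_def by (metis (mono_tags, lifting) mem_Collect_eq)
qed

text \<open>Slot induction expands every factor in \<open>S\<close> and decomposables. A tuple with
  all entries in \<open>S\<close> gives a wanted product; a decomposable entry lengthens the chain
  by \<open>refine_chain\<close>.\<close>

lemma chain_products_step:
  assumes c: "c \<in> support_chains X Y m" and len: "length S = m"
    and S: "\<And>i. i < m \<Longrightarrow> S ! i \<subseteq> corner (c ! Suc i) (c ! i)"
    and span: "\<And>i. i < m \<Longrightarrow> corner (c ! Suc i) (c ! i) \<subseteq> alg_space.span (S ! i \<union> decomposables (c ! Suc i) (c ! i))"
    and zs: "zs \<in> listset (steps corner c)"
  shows "fold (*) zs (E X) \<in> alg_space.span ((\<lambda>zs. fold (*) zs (E X)) ` listset S \<union> chain_products X Y (Suc m))"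
    (is "_ \<in> ?U")
proof -
  have lc: "length c = Suc m" using support_chainsD(1)[OF c] .
  \<comment> \<open>The generators of the decomposables rather than their span, because
    \<open>refine_chain\<close> needs an entry that is literally a product.\<close>
  define D where "D Z W = {x * y | x y. \<exists>V\<in>supports. W \<subset> V \<and> V \<subset> Z \<and> x \<in> corner Z V \<and> y \<in> corner V W}" for Z W
  let ?rep = "\<lambda>Z W. regular_rep\<lparr>carrier := corner Z W\<rparr> :: (('b, 'k) semigroup_algebra, 'k, ('b, 'k) semigroup_algebra) rep"
  define Vs where "Vs = steps ?rep c"
  define Ts where "Ts = map (\<lambda>i. S ! i \<union> D (c ! Suc i) (c ! i)) [0..<m]"
  have lV: "length Vs = m" "map carrier Vs = steps corner c"
    using lc by (simp_all add: Vs_def map_steps)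
  have Vi: "Vs ! i = ?rep (c ! Suc i) (c ! i)" "Ts ! i = S ! i \<union> D (c ! Suc i) (c ! i)" if "i < m" for i
    using that lc by (simp_all add: Vs_def Ts_def)
  have DC: "D (c ! Suc i) (c ! i) \<subseteq> corner (c ! Suc i) (c ! i)" if i: "i < m" for i
    unfolding D_def using corner_mult support_chains_step(1,2)[OF c i] by blast
  show ?thesis
  proof (rule slot_induct[where Vs = Vs and Ts = Ts and K = "{}" and P = "\<lambda>zs. fold (*) zs (E X) \<in> ?U"])
    show "length Ts = length Vs" by (simp add: lV Ts_def)
    show "zs \<in> listset (map carrier Vs)" using zs lV by simp
    show "operator_space {} (Vs ! i)" if "i < length Vs" for i
      unfolding operator_space_def using that lV Vi
      by (auto simp: regular_rep_def intro: alg_space.subspace_add alg_space.subspace_scale alg_space.subspace_0 corner_subspace)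
    show "Ts ! i \<subseteq> carrier (Vs ! i)" if "i < length Vs" for i
      using that lV Vi S DC by simp
    show "carrier (Vs ! i) \<subseteq> generated (Vs ! i) (Ts ! i)" if "i < length Vs" for i
    proof -
      have i: "i < m" using that lV by simp
      let ?g = "generated (Vs ! i) (Ts ! i)"
      have add: "x + y \<in> ?g" if "x \<in> ?g" "y \<in> ?g" for x y
        using generated.add[OF that] Vi[OF i] by (simp add: regular_rep_def)
      have scale: "alg_scale a x \<in> ?g" if "x \<in> ?g" for a x
        using generated.scale[OF that, of a] Vi[OF i] by (simp add: regular_rep_def)
      have "0 \<in> ?g" using generated.zero[of "Vs ! i" "Ts ! i"] Vi[OF i] by (simp add: regular_rep_def)
      then have sub: "alg_space.subspace ?g" by (intro alg_space.subspaceI add scale)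
      have "S ! i \<subseteq> ?g" "D (c ! Suc i) (c ! i) \<subseteq> ?g"
        by (intro subsetI generated.base; simp add: Vi(2)[OF i])+
      then have "S ! i \<union> decomposables (c ! Suc i) (c ! i) \<subseteq> ?g"
        unfolding decomposables_def D_def[symmetric] by (intro Un_least alg_space.span_minimal[OF _ sub])
      then have "alg_space.span (S ! i \<union> decomposables (c ! Suc i) (c ! i)) \<subseteq> ?g"
        by (rule alg_space.span_minimal[OF _ sub])
      then show ?thesis using span[OF i] Vi(1)[OF i] by simp
    qed
    show "fold (*) xs (E X) \<in> ?U" if xs: "xs \<in> listset Ts" for xs
    proof (cases "xs \<in> listset S")
      case True
      then show ?thesis by (intro alg_space.span_base) blast
    next
      case False
      have lx: "length xs = m" using xs by (simp add: listset_iff Ts_def)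
      obtain i where i: "i < m" "xs ! i \<notin> S ! i" using False lx len by (auto simp: listset_iff)
      have xsi: "xs ! j \<in> S ! j \<union> D (c ! Suc j) (c ! j)" if "j < m" for j
        using xs Vi(2)[OF that] that by (auto simp: listset_iff Ts_def)
      have "xs ! j \<in> corner (c ! Suc j) (c ! j)" if "j < m" for j
        using xsi[OF that] S[OF that] DC[OF that] by blast
      then have xsc: "xs \<in> listset (steps corner c)" using lx lc by (simp add: listset_iff)
      from xsi[OF i(1)] i(2) obtain y z V where "xs ! i = y * z" "V \<in> supports" "c ! i \<subset> V" "V \<subset> c ! Suc i"
        "y \<in> corner (c ! Suc i) V" "z \<in> corner V (c ! i)" unfolding D_def by blast
      then have "fold (*) xs (E X) \<in> chain_products X Y (Suc m)"
        using refine_chain[OF c i(1) _ _ _ xsc] by blast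
      then show ?thesis by (intro alg_space.span_base) blast
    qed
  next
    fix xs i v w assume xs: "xs \<in> listset (map carrier Vs)" and i: "i < length Vs"
    have lin: "alg_linear (\<lambda>v. fold (*) (xs[i := v]) (E X))"
      by (rule fold_mult_update) (use xs i in \<open>simp add: listset_iff\<close>)
    have Vi': "Vs ! i = ?rep (c ! Suc i) (c ! i)" using Vi i lV by simp
    show "fold (*) (xs[i := vzero (Vs ! i)]) (E X) \<in> ?U"
      using alg_linear_0[OF lin] by (simp add: Vi' regular_rep_def alg_space.span_zero)
    show "fold (*) (xs[i := vscale (Vs ! i) a v]) (E X) \<in> ?U" if "fold (*) (xs[i := v]) (E X) \<in> ?U" for a
      using that alg_linear_scale[OF lin, of a v] by (simp add: Vi' regular_rep_def alg_space.span_scale)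
    show "fold (*) (xs[i := vadd (Vs ! i) v w]) (E X) \<in> ?U"
      if "fold (*) (xs[i := v]) (E X) \<in> ?U" "fold (*) (xs[i := w]) (E X) \<in> ?U"
      using that alg_linear_add[OF lin, of v w] by (simp add: Vi' regular_rep_def alg_space.span_add)
  qed
qed

text \<open>Replacing each factor of a product along a chain by its component in a complement of the
  decomposables changes the product only by products along longer chains; hence the
  complements may be chosen independently for every chain.\<close>

lemma corner_span_products:
  assumes X: "X \<in> supports" and Y: "Y \<in> supports" and XY: "X \<subset> Y"
    and len: "\<And>m c. c \<in> support_chains X Y m \<Longrightarrow> length (S c) = m"
    and S: "\<And>m c i. c \<in> support_chains X Y m \<Longrightarrow> i < m \<Longrightarrow> S c ! i \<subseteq> corner (c ! Suc i) (c ! i)"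
    and span: "\<And>m c i. c \<in> support_chains X Y m \<Longrightarrow> i < m \<Longrightarrow>
      corner (c ! Suc i) (c ! i) \<subseteq> alg_space.span (S c ! i \<union> decomposables (c ! Suc i) (c ! i))"
    and M: "M = card (supports :: 'b set set)"
  shows "corner Y X \<subseteq> alg_space.span (\<Union>m\<in>{1..M}. \<Union>c\<in>support_chains X Y m. (\<lambda>zs. fold (*) zs (E X)) ` listset (S c))"
    (is "_ \<subseteq> ?W")
proof -
  have "1 \<le> m \<Longrightarrow> chain_products X Y m \<subseteq> ?W" for m
  \<comment> \<open>Each replacement lengthens the chain, and no chain has \<open>M\<close> steps,
    so the process stops.\<close>
  proof (induction "M - m" arbitrary: m rule: less_induct)
    case less
    show ?case
    proof
      fix x assume "x \<in> chain_products X Y m"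
      then obtain zs c where x: "x = fold (*) zs (E X)" and c: "c \<in> support_chains X Y m"
        and zs: "zs \<in> listset (steps corner c)" unfolding chain_products_def by blast
      have m: "m < M" using support_chains_length[OF c] M by simp
      have "M - Suc m < M - m" using m by simp
      then have IH: "chain_products X Y (Suc m) \<subseteq> ?W" using less(1)[of "Suc m"] by simp
      have "m \<in> {1..M}" using m less(2) by simp
      have "(\<lambda>zs. fold (*) zs (E X)) ` listset (S c)
          \<subseteq> (\<Union>m\<in>{1..M}. \<Union>c\<in>support_chains X Y m. (\<lambda>zs. fold (*) zs (E X)) ` listset (S c))"
        by (rule subset_trans[OF _ UN_upper[OF \<open>m \<in> {1..M}\<close>]]) (rule UN_upper[OF c])
      then have "(\<lambda>zs. fold (*) zs (E X)) ` listset (S c) \<subseteq> ?W"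
        by (rule subset_trans[OF _ alg_space.span_superset])
      then have "alg_space.span ((\<lambda>zs. fold (*) zs (E X)) ` listset (S c) \<union> chain_products X Y (Suc m)) \<subseteq> ?W"
        using IH by (intro alg_space.span_minimal alg_space.subspace_span Un_least)
      then show "x \<in> ?W"
        unfolding x using chain_products_step[OF c len[OF c] S[OF c] span[OF c] zs] by (rule subsetD)
    qed
  qed
  then have sub: "chain_products X Y 1 \<subseteq> ?W" by simp
  show ?thesis
  proof
    fix x assume x: "x \<in> corner Y X"
    have "[X, Y] \<in> support_chains X Y 1" using X Y XY by (simp add: support_chains_def)
    moreover have "[x] \<in> listset (steps corner [X, Y])" using x by (simp add: steps_Cons set_Cons_def)
    moreover have "fold (*) [x] (E X) = x" using x X Y by (simp add: corner_iff)
    ultimately have "x \<in> chain_products X Y 1" unfolding chain_products_def by (metis (mono_tags, lifting) mem_Collect_eq)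
    then show "x \<in> ?W" using sub by blast
  qed
qed

end


section \<open>Orbits of chains\<close>

context equivariant_idempotents
begin

definition move_chain :: "'g \<Rightarrow> 'b set list \<Rightarrow> 'b set list" where
  "move_chain g = map (\<lambda>Z. \<phi> g ` Z)"

lemma move_chain_mult: "g \<in> carrier G \<Longrightarrow> h \<in> carrier G \<Longrightarrow> move_chain (g \<otimes>\<^bsub>G\<^esub> h) c = move_chain g (move_chain h c)"
  by (simp add: move_chain_def \<phi>_image_mult)

lemma move_chain_inv: "g \<in> carrier G \<Longrightarrow> move_chain (inv\<^bsub>G\<^esub> g) (move_chain g c) = c"
  by (simp add: move_chain_def \<phi>_image_inv comp_def)

lemma stab_pair_subgroup: "subgroup (stab G \<phi> X \<inter> stab G \<phi> Y) G"
  by (intro subgroups_Inter_pair stab_subgroup)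

lemma move_chain_support_chains:
  assumes g: "g \<in> stab G \<phi> X \<inter> stab G \<phi> Y" and c: "c \<in> support_chains X Y m"
  shows "move_chain g c \<in> support_chains X Y m"
proof -
  have gG: "g \<in> carrier G" "\<phi> g ` X = X" "\<phi> g ` Y = Y" using g by (auto simp: in_stab)
  have "sorted_wrt (\<subset>) (map (\<lambda>Z. \<phi> g ` Z) c)"
    using c \<phi>_psubset[OF gG(1)] by (simp add: support_chains_def sorted_wrt_map)
  moreover have "set (map (\<lambda>Z. \<phi> g ` Z) c) \<subseteq> supports"
    using support_chainsD(2)[OF c] \<phi>_supports[OF gG(1)] by auto
  ultimately show ?thesis
    using support_chainsD[OF c] gG by (simp add: support_chains_def move_chain_def hd_map last_map)
qed

lemma chain_orbits_eq:
  "chain_orbits G \<phi> X Y m = (\<lambda>c. {move_chain g c | g. g \<in> stab G \<phi> X \<inter> stab G \<phi> Y}) ` support_chains X Y m"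
  unfolding chain_orbits_def orbits_def orbit_def move_chain_def by auto

lemma chain_orbit_eq:
  assumes orb: "orb \<in> chain_orbits G \<phi> X Y m" and c: "c \<in> orb"
  shows "orb = {move_chain g c | g. g \<in> stab G \<phi> X \<inter> stab G \<phi> Y}"
proof -
  let ?K = "stab G \<phi> X \<inter> stab G \<phi> Y"
  have K: "subgroup ?K G" by (rule stab_pair_subgroup)
  have KG: "g \<in> carrier G" if "g \<in> ?K" for g using that by (simp add: in_stab)
  obtain d where d: "orb = {move_chain g d | g. g \<in> ?K}" using orb unfolding chain_orbits_eq by blast
  then obtain k where k: "k \<in> ?K" "c = move_chain k d" using c by blast
  show ?thesis unfolding d
  proof (intro equalityI subsetI)
    fix x assume "x \<in> {move_chain g d | g. g \<in> ?K}"
    then obtain g where g: "x = move_chain g d" "g \<in> ?K" by blast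
    have "d = move_chain (inv\<^bsub>G\<^esub> k) c" using k KG by (simp add: move_chain_inv)
    then have "x = move_chain (g \<otimes>\<^bsub>G\<^esub> inv\<^bsub>G\<^esub> k) c" using g(1) KG[OF g(2)] KG[OF k(1)] by (simp add: move_chain_mult)
    moreover have "g \<otimes>\<^bsub>G\<^esub> inv\<^bsub>G\<^esub> k \<in> ?K"
      by (rule subgroup.m_closed[OF K g(2) subgroup.m_inv_closed[OF K k(1)]])
    ultimately show "x \<in> {move_chain g c | g. g \<in> ?K}" by blast
  next
    fix x assume "x \<in> {move_chain g c | g. g \<in> ?K}"
    then obtain g where g: "x = move_chain g c" "g \<in> ?K" by blast
    then have "x = move_chain (g \<otimes>\<^bsub>G\<^esub> k) d" using k KG[OF g(2)] KG[OF k(1)] by (simp add: move_chain_mult)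
    moreover have "g \<otimes>\<^bsub>G\<^esub> k \<in> ?K" by (rule subgroup.m_closed[OF K g(2) k(1)])
    ultimately show "x \<in> {move_chain g d | g. g \<in> ?K}" by blast
  qed
qed

lemma chain_orbits_subset: "orb \<in> chain_orbits G \<phi> X Y m \<Longrightarrow> orb \<subseteq> support_chains X Y m"
  unfolding chain_orbits_eq using move_chain_support_chains by blast

lemma chain_orbit_of:
  assumes c: "c \<in> support_chains X Y m"
  shows "{move_chain g c | g. g \<in> stab G \<phi> X \<inter> stab G \<phi> Y} \<in> chain_orbits G \<phi> X Y m"
    "c \<in> {move_chain g c | g. g \<in> stab G \<phi> X \<inter> stab G \<phi> Y}"
proof -
  have "\<one>\<^bsub>G\<^esub> \<in> stab G \<phi> X \<inter> stab G \<phi> Y" by (rule subgroup.one_closed[OF stab_pair_subgroup])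
  moreover have "c = move_chain \<one>\<^bsub>G\<^esub> c" by (simp add: move_chain_def \<phi>_one)
  ultimately show "c \<in> {move_chain g c | g. g \<in> stab G \<phi> X \<inter> stab G \<phi> Y}" by blast
qed (use c in \<open>unfold chain_orbits_eq, blast\<close>)

lemma Union_chain_orbits: "\<Union>(chain_orbits G \<phi> X Y m) = support_chains X Y m"
proof
  show "\<Union>(chain_orbits G \<phi> X Y m) \<subseteq> support_chains X Y m"
    by (rule Union_least) (rule chain_orbits_subset)
  show "support_chains X Y m \<subseteq> \<Union>(chain_orbits G \<phi> X Y m)"
    by (rule subsetI, rule UnionI[OF chain_orbit_of(1) chain_orbit_of(2)])
qed

lemma chain_orbits_disjoint:
  assumes "orb \<in> chain_orbits G \<phi> X Y m" "orb' \<in> chain_orbits G \<phi> X Y m" "orb \<noteq> orb'"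
  shows "orb \<inter> orb' = {}"
proof (rule ccontr)
  assume "orb \<inter> orb' \<noteq> {}"
  then obtain c where c: "c \<in> orb" "c \<in> orb'" by blast
  have "orb = orb'"
    by (rule trans[OF chain_orbit_eq[OF assms(1) c(1)] chain_orbit_eq[OF assms(2) c(2), symmetric]])
  then show False using assms(3) by simp
qed

lemma finite_chain_orbits: "finite (chain_orbits G \<phi> X Y m)"
  unfolding chain_orbits_eq using finite_support_chains by blast

end

section \<open>The representation attached to a chain\<close>

lemma fold_mult_move:
  assumes "\<And>x y. f (x * y) = f x * f y"
  shows "f (fold (*) zs a) = fold (*) (map f zs) (f a)"
  by (induction zs arbitrary: a) (simp_all add: assms)

context equivariant_idempotents
begin

lemma carrier_corner_rep: "carrier (corner_rep \<phi> (E Y) (E X)) = corner Y X"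
  by (simp add: corner_rep_def corner_def)

lemma corner_rep_ops: "vadd (corner_rep \<phi> (E Y) (E X)) = (+)" "vscale (corner_rep \<phi> (E Y) (E X)) = alg_scale"
  "act (corner_rep \<phi> (E Y) (E X)) = move"
  by (simp_all add: corner_rep_def move_def fun_eq_iff)

context
  fixes X Y :: "'b set" and bz :: "'b set \<Rightarrow> 'b"
    and Q :: "'b set \<Rightarrow> 'b set \<Rightarrow> ('b, 'k) semigroup_algebra set"
    and s :: "'b set \<Rightarrow> 'b set \<Rightarrow> ('b list \<Rightarrow>\<^sub>0 'k) set \<Rightarrow> ('b, 'k) semigroup_algebra"
    and h :: "'b set \<Rightarrow> 'b set \<Rightarrow> ('b, 'k) semigroup_algebra \<Rightarrow> ('b list \<Rightarrow>\<^sub>0 'k) set"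
  assumes X: "X \<in> supports" and Y: "Y \<in> supports"
    and s_hom: "\<And>Z W. Z \<in> supports \<Longrightarrow> W \<in> supports \<Longrightarrow> X \<subseteq> W \<Longrightarrow> W \<subset> Z \<Longrightarrow> Z \<subseteq> Y \<Longrightarrow>
      s Z W \<in> rep_hom (stab G \<phi> W \<inter> stab G \<phi> Z) (H0_rep \<phi> (bz Z) W) (corner_rep \<phi> (E Z) (E W))"
    and h_Q: "\<And>Z W v. Z \<in> supports \<Longrightarrow> W \<in> supports \<Longrightarrow> X \<subseteq> W \<Longrightarrow> W \<subset> Z \<Longrightarrow> Z \<subseteq> Y \<Longrightarrow> v \<in> Q Z W \<Longrightarrow>
      h Z W v \<in> carrier (H0_rep \<phi> (bz Z) W :: ('g, 'k, ('b list \<Rightarrow>\<^sub>0 'k) set) rep) \<and> s Z W (h Z W v) = v"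
    and h_gen: "\<And>Z W. Z \<in> supports \<Longrightarrow> W \<in> supports \<Longrightarrow> X \<subseteq> W \<Longrightarrow> W \<subset> Z \<Longrightarrow> Z \<subseteq> Y \<Longrightarrow>
      carrier (H0_rep \<phi> (bz Z) W :: ('g, 'k, ('b list \<Rightarrow>\<^sub>0 'k) set) rep) \<subseteq> generated (H0_rep \<phi> (bz Z) W :: ('g, 'k, ('b list \<Rightarrow>\<^sub>0 'k) set) rep) (h Z W ` Q Z W)"
    and H0_op: "\<And>Z W. Z \<in> supports \<Longrightarrow> W \<in> supports \<Longrightarrow> X \<subseteq> W \<Longrightarrow> W \<subset> Z \<Longrightarrow> Z \<subseteq> Y \<Longrightarrow>
      operator_space (stab G \<phi> W \<inter> stab G \<phi> Z) (H0_rep \<phi> (bz Z) W :: ('g, 'k, ('b list \<Rightarrow>\<^sub>0 'k) set) rep)"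
    and Q_fin: "\<And>Z W. Z \<in> supports \<Longrightarrow> W \<in> supports \<Longrightarrow> finite (Q Z W)"
begin

abbreviation "KXY \<equiv> stab G \<phi> X \<inter> stab G \<phi> Y"

text \<open>On pure tensors the homomorphism lifts every homology class by \<open>s\<close>,
  multiplies the lifts along the chain and applies the group element. \<open>nf a\<close> combines
  coset representatives tensored with classes of arrows, with coefficients \<open>a\<close>. These
  elements are only shown to span; the explicit value of \<open>F\<close> on them later turns
  independence of the products into injectivity.\<close>

lemma chain_induced_basis:
  fixes t :: "'p \<Rightarrow> 'g"
  assumes c: "c \<in> support_chains X Y m" and P: "finite P"
    and t: "\<And>x. x \<in> KXY \<Longrightarrow> \<exists>p\<in>P. \<exists>k\<in>(\<Inter>Z\<in>set c. stab G \<phi> Z). x = t p \<otimes>\<^bsub>G\<^esub> k"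
    and tK: "\<And>p. p \<in> P \<Longrightarrow> t p \<in> KXY"
  shows "\<exists>F nf. F \<in> rep_hom KXY (chain_induced G \<phi> bz X Y c) (corner_rep \<phi> (E Y) (E X)) \<and>
    operator_space KXY (chain_induced G \<phi> bz X Y c :: ('g, 'k, _) rep) \<and>
    (\<forall>a. nf a \<in> carrier (chain_induced G \<phi> bz X Y c :: ('g, 'k, _) rep) \<and>
      F (nf a) = (\<Sum>(p, zs)\<in>P \<times> listset (steps Q c). alg_scale (a (p, zs)) (move (t p) (fold (*) zs (E X))))) \<and>
    (\<forall>A\<in>carrier (chain_induced G \<phi> bz X Y c :: ('g, 'k, _) rep). \<exists>a. A = nf a) \<and>
    (\<forall>a a'. (\<forall>i\<in>P \<times> listset (steps Q c). a i = a' i) \<longrightarrow> nf a = nf a')"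
proof -
  define H where "H = (\<Inter>Z\<in>set c. stab G \<phi> Z)"
  define Vs where "Vs = steps (\<lambda>Z W. H0_rep \<phi> (bz Z) W :: ('g, 'k, ('b list \<Rightarrow>\<^sub>0 'k) set) rep) c"
  define ss where "ss = steps s c"
  define hs where "hs = steps h c"
  define Qs where "Qs = steps Q c"
  have len: "length c = Suc m" using support_chainsD(1)[OF c] .
  have lens: "length Vs = m" "length ss = m" "length hs = m" "length Qs = m"
    using len by (simp_all add: Vs_def ss_def hs_def Qs_def)
  note step = support_chains_step[OF c]
  have HG: "g \<in> carrier G" if "g \<in> H" for g
    using that support_chainsD(6)[OF c] by (auto simp: H_def in_stab)
  have H_stab: "g \<in> stab G \<phi> (c ! i) \<inter> stab G \<phi> (c ! Suc i)" if "g \<in> H" "i < m" for g i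
    using that step(7,8)[OF that(2)] unfolding H_def by blast
  have HK: "H \<subseteq> KXY" using support_chainsD(6,7)[OF c] unfolding H_def by blast
  have Vi: "Vs ! i = H0_rep \<phi> (bz (c ! Suc i)) (c ! i)" "ss ! i = s (c ! Suc i) (c ! i)"
    "hs ! i = h (c ! Suc i) (c ! i)" "Qs ! i = Q (c ! Suc i) (c ! i)" if "i < m" for i
    using that len by (simp_all add: Vs_def ss_def hs_def Qs_def)
  have ss_hom: "ss ! i \<in> rep_hom (stab G \<phi> (c ! i) \<inter> stab G \<phi> (c ! Suc i)) (Vs ! i) (corner_rep \<phi> (E (c ! Suc i)) (E (c ! i)))"
    if i: "i < m" for i
    unfolding Vi[OF i] by (rule s_hom[OF step(2,1,4,3,6)[OF i]])
  have ss_corner: "(ss ! i) v \<in> corner (c ! Suc i) (c ! i)" if "i < m" "v \<in> carrier (Vs ! i)" for i v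
    using rep_homD(1)[OF ss_hom[OF that(1)] that(2)] by (simp add: carrier_corner_rep)
  have Vop: "operator_space H (Vs ! i)" if i: "i < length Vs" for i
  proof -
    have im: "i < m" using i lens by simp
    have "operator_space (stab G \<phi> (c ! i) \<inter> stab G \<phi> (c ! Suc i)) (Vs ! i)"
      unfolding Vi[OF im] by (rule H0_op[OF step(2,1,4,3,6)[OF im]])
    then show ?thesis using H_stab[OF _ im] unfolding operator_space_def by blast
  qed
  interpret tensor_factors Vs H by unfold_locales (rule Vop)
  let ?app = "map2 (\<lambda>f x. f x)"
  \<comment> \<open>The starting value \<open>E X\<close> is a right identity for the lowest factor,
    and the group elements stabilizing the chain fix it.\<close>
  define e where "e xs = fold (*) (?app ss xs) (E X)" for xs
  have app_update: "?app ss (xs[i := v]) = (?app ss xs)[i := (ss ! i) v]" if "length xs = m" "i < m" for xs i v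
    using that lens by (intro nth_equalityI) (auto simp: nth_list_update)
  have e_lin: "alg_linear (\<lambda>z. fold (*) ((?app ss xs)[i := z]) (E X))" if "length xs = m" "i < m" for xs i
    using that lens by (intro fold_mult_update) simp
  obtain FT where FT: "\<And>u. FT (tensor.cls u) = lin_ext e u"
  proof (rule tensor_lift[of e])
    fix xs i v w assume xs: "xs \<in> listset (map carrier Vs)" and i: "i < length Vs"
      and v: "v \<in> carrier (Vs ! i)" and w: "w \<in> carrier (Vs ! i)"
    have lx: "length xs = m" "i < m" using xs i lens by (simp_all add: listset_iff)
    show "e (xs[i := vadd (Vs ! i) v w]) = e (xs[i := v]) + e (xs[i := w])"
      using rep_homD(2)[OF ss_hom[OF lx(2)] v w] alg_linear_add[OF e_lin[OF lx]]
      by (simp add: e_def app_update[OF lx] corner_rep_ops)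
  next
    fix xs i a v assume xs: "xs \<in> listset (map carrier Vs)" and i: "i < length Vs" and v: "v \<in> carrier (Vs ! i)"
    have lx: "length xs = m" "i < m" using xs i lens by (simp_all add: listset_iff)
    show "e (xs[i := vscale (Vs ! i) a v]) = alg_scale a (e (xs[i := v]))"
      using rep_homD(3)[OF ss_hom[OF lx(2)] v, of a] alg_linear_scale[OF e_lin[OF lx]]
      by (simp add: e_def app_update[OF lx] corner_rep_ops)
  qed (rule that)
  let ?T = "tensor_rep Vs"
  have T_eq: "chain_tensor \<phi> bz c = ?T"
    by (simp add: chain_tensor_def Vs_def steps_def)
  have T_op: "operator_space H ?T" unfolding tensor_rep_eq by (rule tensor.Q_operator_space)
  have T_carrier: "\<exists>u. A = tensor.cls u \<and> Poly_Mapping.keys u \<subseteq> listset (map carrier Vs)" if "A \<in> carrier ?T" for A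
    using that unfolding tensor_rep_eq tensor.Q_carrier .
  have e_corner: "e xs \<in> corner Y X" if "xs \<in> listset (map carrier Vs)" for xs
  proof -
    have "?app ss xs \<in> listset (steps corner c)"
      using that ss_corner lens len by (auto simp: listset_iff)
    moreover have "E X \<in> corner (hd c) X" using support_chainsD[OF c] X by (simp add: corner_iff E_idem)
    ultimately show ?thesis
      using fold_corner[OF support_chainsD(3,2)[OF c] _ X, of "?app ss xs" "E X"] support_chainsD(5)[OF c] by (simp add: e_def)
  qed
  have FT_corner: "FT A \<in> corner Y X" if "A \<in> carrier ?T" for A
  proof -
    obtain u where u: "A = tensor.cls u" "Poly_Mapping.keys u \<subseteq> listset (map carrier Vs)" using T_carrier[OF \<open>A \<in> carrier ?T\<close>] by blast
    have "lin_ext e u \<in> corner Y X" unfolding lin_ext_def ksum_def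
      by (intro alg_space.subspace_sum alg_space.subspace_scale corner_subspace e_corner) (use u(2) in blast)
    then show ?thesis using u(1) FT by simp
  qed
  have FT_add: "FT (vadd ?T A B) = FT A + FT B" if "A \<in> carrier ?T" "B \<in> carrier ?T" for A B
  proof -
    obtain u v where "A = tensor.cls u" "B = tensor.cls v" using T_carrier \<open>A \<in> carrier ?T\<close> \<open>B \<in> carrier ?T\<close> by metis
    then show ?thesis by (simp add: tensor_rep_eq tensor.Q_vadd FT lin_ext_add)
  qed
  have FT_scale: "FT (vscale ?T a A) = alg_scale a (FT A)" if "A \<in> carrier ?T" for a A
  proof -
    obtain u where "A = tensor.cls u" using T_carrier \<open>A \<in> carrier ?T\<close> by metis
    then show ?thesis by (simp add: tensor_rep_eq tensor.Q_vscale FT lin_ext_scale)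
  qed
  have FT_act: "FT (act ?T g A) = move g (FT A)" if g: "g \<in> H" and A: "A \<in> carrier ?T" for g A
  proof -
    obtain u where u: "A = tensor.cls u" "Poly_Mapping.keys u \<subseteq> listset (map carrier Vs)" using T_carrier[OF A] by blast
    have e_act: "e (tensor_act g xs) = move g (e xs)" if xs: "xs \<in> listset (map carrier Vs)" for xs
    proof -
      have lx: "length xs = m" using xs lens by (simp add: listset_iff)
      have "?app ss (tensor_act g xs) = map (move g) (?app ss xs)"
      proof (rule nth_equalityI)
        fix i assume "i < length (?app ss (tensor_act g xs))"
        then have i: "i < m" using lens lx by simp
        have "xs ! i \<in> carrier (Vs ! i)" using xs i lens by (simp add: listset_iff)
        then have "(ss ! i) (act (Vs ! i) g (xs ! i)) = move g ((ss ! i) (xs ! i))"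
          using rep_homD(4)[OF ss_hom[OF i] H_stab[OF g i]] by (simp add: corner_rep_ops)
        then show "?app ss (tensor_act g xs) ! i = map (move g) (?app ss xs) ! i" using i lens lx by simp
      qed (use lens lx in simp)
      moreover have "move g (E X) = E X"
        using g HK X by (auto simp: in_stab move_E)
      ultimately show ?thesis
        unfolding e_def using fold_mult_move[of "move g" "?app ss xs" "E X"] move_times[OF HG[OF g]] by simp
    qed
    show ?thesis
      unfolding u(1) tensor_rep_eq tensor.Q_act[OF g] FT
      by (rule lin_ext_act[OF u(2) _ move_linear]) (rule e_act)
  qed
  interpret induction_data G H KXY ?T
    by (intro induction_data.intro induction_data_axioms.intro is_group stab_pair_subgroup HK T_op)
  let ?I = "chain_induced G \<phi> bz X Y c :: ('g, 'k, _) rep"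
  have I_eq: "?I = induced_rep G H KXY ?T" by (simp add: chain_induced_def T_eq H_def)
  have KG: "g \<in> carrier G" if "g \<in> KXY" for g using that by (simp add: in_stab)
  obtain F where F: "\<And>u. F (ind.cls u) = lin_ext (\<lambda>(x, v). move x (FT v)) u"
  proof (rule induced_lift[of move FT])
    show "move (x \<otimes>\<^bsub>G\<^esub> g) a = move x (move g a)" if "x \<in> KXY" "g \<in> KXY" for x g a
      using move_mult KG that by blast
  qed (rule move_linear FT_add FT_scale FT_act that; assumption)+
  have I_op: "operator_space KXY ?I" unfolding I_eq induced_rep_eq by (rule ind.Q_operator_space)
  have I_carrier: "\<exists>u. A = ind.cls u \<and> Poly_Mapping.keys u \<subseteq> KXY \<times> carrier ?T" if "A \<in> carrier ?I" for A
    using that unfolding I_eq induced_rep_eq ind.Q_carrier .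
  have move_corner': "move g x \<in> corner Y X" if "g \<in> KXY" "x \<in> corner Y X" for g x
    using move_corner[OF _ X Y that(2), of g] that(1) by (auto simp: in_stab)
  have "F \<in> rep_hom KXY ?I (corner_rep \<phi> (E Y) (E X))"
    unfolding rep_hom_def carrier_corner_rep corner_rep_ops
  proof (intro CollectI conjI ballI allI funcsetI)
    fix A assume "A \<in> carrier ?I"
    then obtain u where u: "A = ind.cls u" "Poly_Mapping.keys u \<subseteq> KXY \<times> carrier ?T" using I_carrier by blast
    show "F A \<in> corner Y X" unfolding u(1) F lin_ext_def ksum_def
      by (intro alg_space.subspace_sum alg_space.subspace_scale corner_subspace)
        (use u(2) move_corner' FT_corner in \<open>auto simp: subset_iff\<close>)
    show "F (vscale ?I a A) = alg_scale a (F A)" for a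
      unfolding u(1) I_eq induced_rep_eq ind.Q_vscale F by (rule lin_ext_scale)
    show "F (act ?I g A) = move g (F A)" if g: "g \<in> KXY" for g
      unfolding u(1) I_eq induced_rep_eq ind.Q_act[OF g] F
      by (rule lin_ext_act[OF u(2) _ move_linear]) (use move_mult KG g in auto)
    fix B assume "B \<in> carrier ?I"
    then obtain v where v: "B = ind.cls v" using I_carrier by blast
    show "F (vadd ?I A B) = F A + F B"
      unfolding u(1) v I_eq induced_rep_eq ind.Q_vadd F by (rule lin_ext_add)
  qed
  moreover
  \<comment> \<open>The pure tensor of the homology classes of the arrows \<open>zs\<close>; lifting
    returns the arrows, so the image is their product.\<close>
  define f where "f zs = pure (?app hs zs)" for zs
  let ?L = "listset Qs"
  have finL: "finite ?L"
    using Q_fin step(1,2) lens Vi(4) by (intro finite_listset) (auto simp: in_set_conv_nth)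
  have hs_Q: "(hs ! i) v \<in> carrier (Vs ! i) \<and> (ss ! i) ((hs ! i) v) = v" if "i < m" "v \<in> Qs ! i" for i v
    using h_Q[OF step(2,1,4,3,6)[OF that(1)]] that(2) unfolding Vi[OF that(1)] by blast
  have app_hs: "?app hs zs \<in> listset (map carrier Vs)" if "zs \<in> ?L" for zs
    using that hs_Q lens by (auto simp: listset_iff)
  have fT: "f zs \<in> carrier ?T" if "zs \<in> ?L" for zs
    unfolding f_def tensor_rep_eq tensor.Q_carrier
    by (rule exI[of _ "Poly_Mapping.single (?app hs zs) 1"]) (use app_hs[OF that] in simp)
  have FTf: "FT (f zs) = fold (*) zs (E X)" if "zs \<in> ?L" for zs
  proof -
    have "?app ss (?app hs zs) = zs"
      using that hs_Q lens by (intro nth_equalityI) (auto simp: listset_iff)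
    then show ?thesis by (simp add: f_def FT e_def)
  qed
  have genT: "carrier ?T \<subseteq> generated ?T (f ` ?L)"
  proof -
    let ?Ts = "map2 (\<lambda>f A. f ` A) hs Qs"
    have "carrier ?T \<subseteq> generated ?T (pure ` listset ?Ts)"
    proof (rule tensor_generated)
      show "length ?Ts = length Vs" using lens by simp
      show "?Ts ! i \<subseteq> carrier (Vs ! i)" if "i < length Vs" for i
        using that hs_Q lens by auto
      show "carrier (Vs ! i) \<subseteq> generated (Vs ! i) (?Ts ! i)" if "i < length Vs" for i
        using that h_gen[OF step(2,1,4,3,6)[of i]] lens Vi[of i] by simp
    qed
    also have "pure ` listset ?Ts = f ` ?L"
      using lens by (simp add: listset_map2_image image_image f_def)
    finally show ?thesis .
  qed
  define nf where "nf a = ind.cls (\<Sum>(p, zs)\<in>P \<times> ?L. Poly_Mapping.single (t p, f zs) (a (p, zs)))" for a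
  have nf_carrier: "nf a \<in> carrier ?I" for a
  proof -
    let ?u = "\<Sum>(p, zs)\<in>P \<times> ?L. Poly_Mapping.single (t p, f zs) (a (p, zs))"
    have "?u \<in> {u. Poly_Mapping.keys u \<subseteq> KXY \<times> carrier ?T}"
      by (rule free_space.subspace_sum[OF keys_subspace]) (use tK fT in \<open>auto split: if_splits\<close>)
    then have "Poly_Mapping.keys ?u \<subseteq> KXY \<times> carrier ?T" by simp
    then show ?thesis unfolding nf_def I_eq induced_rep_eq ind.Q_carrier by blast
  qed
  have F_nf: "F (nf a) = (\<Sum>(p, zs)\<in>P \<times> ?L. alg_scale (a (p, zs)) (move (t p) (fold (*) zs (E X))))" for a
    unfolding nf_def F lin_ext_sum by (intro sum.cong refl) (auto simp: FTf)
  have nf_surj: "\<exists>a. A = nf a" if "A \<in> carrier ?I" for A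
    unfolding nf_def
    by (rule induced_normal_form[OF finL fT genT P _ tK that[unfolded I_eq]]) (use t in \<open>simp_all add: H_def\<close>)
  have nf_cong: "nf a = nf a'" if "\<forall>i\<in>P \<times> ?L. a i = a' i" for a a'
  proof -
    have "(\<Sum>(p, zs)\<in>P \<times> ?L. Poly_Mapping.single (t p, f zs) (a (p, zs)))
        = (\<Sum>(p, zs)\<in>P \<times> ?L. Poly_Mapping.single (t p, f zs) (a' (p, zs)))"
      using that by (intro sum.cong refl) auto
    then show ?thesis by (simp add: nf_def)
  qed
  moreover have "\<forall>a. nf a \<in> carrier ?I \<and>
      F (nf a) = (\<Sum>(p, zs)\<in>P \<times> ?L. alg_scale (a (p, zs)) (move (t p) (fold (*) zs (E X))))"
    by (intro allI conjI nf_carrier F_nf)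
  moreover have "\<forall>A\<in>carrier ?I. \<exists>a. A = nf a" by (intro ballI nf_surj)
  moreover have "\<forall>a a'. (\<forall>i\<in>P \<times> ?L. a i = a' i) \<longrightarrow> nf a = nf a'" by (intro allI impI) (rule nf_cong)
  ultimately show ?thesis
    unfolding Qs_def[symmetric]
    by (intro exI[of _ F] exI[of _ nf] conjI I_op)
qed

end

end

section \<open>The decomposition\<close>

text \<open>The homomorphism is built out of the direct sum, where the universal properties of
  tensor products and induction apply, so the isomorphism asked for is its inverse.\<close>

lemma rep_iso_inverse:
  assumes F: "F \<in> rep_hom K W V" and bij: "bij_betw F (carrier W) (carrier V)" and W: "operator_space K W"
  shows "rep_iso K V W"
  unfolding rep_iso_def
proof (rule bexI)
  let ?f = "inv_into (carrier W) F"
  have F_f: "F (?f x) = x" and f_W: "?f x \<in> carrier W" if "x \<in> carrier V" for x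
    using bij that by (auto simp: bij_betw_def f_inv_into_f inv_into_into)
  have f_F: "?f (F y) = y" if "y \<in> carrier W" for y
    using bij that by (simp add: bij_betw_def)
  show "bij_betw ?f (carrier V) (carrier W)" using bij by (rule bij_betw_inv_into)
  show "?f \<in> rep_hom K V W"
    unfolding rep_hom_def
  proof (intro CollectI conjI ballI allI funcsetI f_W)
    fix x assume x: "x \<in> carrier V"
    show "?f (vscale V c x) = vscale W c (?f x)" for c
    proof -
      have "vscale W c (?f x) \<in> carrier W" using W f_W[OF x] by (simp add: operator_space_def)
      moreover have "F (vscale W c (?f x)) = vscale V c x" using rep_homD(3)[OF F f_W[OF x]] F_f[OF x] by simp
      ultimately show ?thesis using f_F by metis
    qed
    show "?f (act V g x) = act W g (?f x)" if "g \<in> K" for g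
    proof -
      have "act W g (?f x) \<in> carrier W" using W f_W[OF x] that by (simp add: operator_space_def)
      moreover have "F (act W g (?f x)) = act V g x" using rep_homD(4)[OF F that f_W[OF x]] F_f[OF x] by simp
      ultimately show ?thesis using f_F by metis
    qed
    fix y assume y: "y \<in> carrier V"
    show "?f (vadd V x y) = vadd W (?f x) (?f y)"
    proof -
      have "vadd W (?f x) (?f y) \<in> carrier W" using W f_W[OF x] f_W[OF y] by (simp add: operator_space_def)
      moreover have "F (vadd W (?f x) (?f y)) = vadd V x y"
        using rep_homD(2)[OF F f_W[OF x] f_W[OF y]] F_f[OF x] F_f[OF y] by simp
      ultimately show ?thesis using f_F by metis
    qed
  qed
qed

text \<open>When all but finitely many summands are zero, finiteness of support is automatic. This
  applies to the outer sum over \<open>m\<close>, where long chains do not exist.\<close>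

lemma carrier_direct_sum:
  assumes "finite {i\<in>I. carrier (V i) \<noteq> {vzero (V i)}}"
  shows "carrier (direct_sum I V) = (\<Pi>\<^sub>E i\<in>I. carrier (V i))"
proof -
  have "finite {i\<in>I. x i \<noteq> vzero (V i)}" if "x \<in> (\<Pi>\<^sub>E i\<in>I. carrier (V i))" for x
    by (rule finite_subset[OF _ assms]) (use that in \<open>auto simp: PiE_iff\<close>)
  then show ?thesis by (auto simp: direct_sum_def)
qed

lemma operator_space_direct_sum:
  assumes "finite {i\<in>I. carrier (V i) \<noteq> {vzero (V i)}}" and "\<And>i. i \<in> I \<Longrightarrow> operator_space K (V i)"
  shows "operator_space K (direct_sum I V)"
  unfolding operator_space_def carrier_direct_sum[OF assms(1)]
  using assms(2) unfolding operator_space_def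
  by (auto simp: direct_sum_def PiE_iff fun_eq_iff)

lemma direct_sum_ops:
  "i \<in> I \<Longrightarrow> vadd (direct_sum I V) x y i = vadd (V i) (x i) (y i)"
  "i \<in> I \<Longrightarrow> vscale (direct_sum I V) c x i = vscale (V i) c (x i)"
  "i \<in> I \<Longrightarrow> act (direct_sum I V) g x i = act (V i) g (x i)"
  by (simp_all add: direct_sum_def)

lemma prod_list_mono_nat: "list_all2 (\<le>) xs ys \<Longrightarrow> prod_list xs \<le> prod_list (ys :: nat list)"
  by (induction rule: list_all2_induct) (simp_all add: mult_mono)

context equivariant_idempotents
begin

lemma corner_decomposition:
  fixes X Y :: "'b set" and bz :: "'b set \<Rightarrow> 'b" and r :: "'b set list set \<Rightarrow> 'b set list"
  assumes hered: "hereditary_algebra TYPE('b) TYPE('k)"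
    and X: "X \<in> supports" and Y: "Y \<in> supports" and XY: "X \<subset> Y"
    and bz: "\<And>Z. Z \<in> supports \<Longrightarrow> X \<subset> Z \<Longrightarrow> Z \<subseteq> Y \<Longrightarrow> supp (bz Z) = Z"
    and r: "\<And>m orb. m \<ge> 1 \<Longrightarrow> orb \<in> chain_orbits G \<phi> X Y m \<Longrightarrow> r orb \<in> orb"
  shows "rep_iso (stab G \<phi> X \<inter> stab G \<phi> Y) (corner_rep \<phi> (E Y) (E X))
    (direct_sum {1..} (\<lambda>m. direct_sum (chain_orbits G \<phi> X Y m) (\<lambda>orb. chain_induced G \<phi> bz X Y (r orb))))"
proof -
  interpret hereditary_idempotents E by unfold_locales (rule hered)
  let ?K = "stab G \<phi> X \<inter> stab G \<phi> Y"
  let ?C = "corner_rep \<phi> (E Y) (E X) :: ('g, 'k, ('b, 'k) semigroup_algebra) rep"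
  let ?O = "chain_orbits G \<phi> X Y"
  have KG: "g \<in> carrier G" if "g \<in> ?K" for g using that by (simp add: in_stab)
  have K_inv: "inv\<^bsub>G\<^esub> g \<in> ?K" if "g \<in> ?K" for g by (rule subgroup.m_inv_closed[OF stab_pair_subgroup that])
  have K_mult: "g \<otimes>\<^bsub>G\<^esub> k \<in> ?K" if "g \<in> ?K" "k \<in> ?K" for g k by (rule subgroup.m_closed[OF stab_pair_subgroup that])

  \<comment> \<open>One choice yields both components, since the arrows must be fixed by the
    projection that goes with them.\<close>
  define split where "split Z W p \<longleftrightarrow> splitting Z W (fst p) \<and> arrows Z W (snd p) \<and> (\<forall>v\<in>snd p. fst p v = v)" for Z W p
  define \<pi> where "\<pi> Z W = fst (SOME p. split Z W p)" for Z W
  define Q where "Q Z W = snd (SOME p. split Z W p)" for Z W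
  have \<pi>Q: "splitting Z W (\<pi> Z W)" "arrows Z W (Q Z W)" "\<And>v. v \<in> Q Z W \<Longrightarrow> \<pi> Z W v = v"
    if "Z \<in> supports" "W \<in> supports" for Z W
  proof -
    obtain p q where "splitting Z W p" "arrows Z W q" "\<forall>v\<in>q. p v = v"
      using ex_splitting[OF \<open>W \<in> supports\<close> \<open>Z \<in> supports\<close>] by blast
    then have "split Z W (p, q)" by (simp add: split_def)
    then have "split Z W (SOME p. split Z W p)" by (rule someI)
    then show "splitting Z W (\<pi> Z W)" "arrows Z W (Q Z W)" "\<And>v. v \<in> Q Z W \<Longrightarrow> \<pi> Z W v = v"
      by (simp_all add: split_def \<pi>_def Q_def)
  qed

  let ?H = "\<lambda>Z W. H0_rep \<phi> (bz Z) W :: ('g, 'k, ('b list \<Rightarrow>\<^sub>0 'k) set) rep"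
  define sect where "sect Z W p \<longleftrightarrow>
      fst p \<in> rep_hom (stab G \<phi> W \<inter> stab G \<phi> Z) (?H Z W) (corner_rep \<phi> (E Z) (E W)) \<and>
      (\<forall>v\<in>Q Z W. snd p v \<in> carrier (?H Z W) \<and> fst p (snd p v) = v) \<and>
      carrier (?H Z W) \<subseteq> generated (?H Z W) (snd p ` Q Z W) \<and>
      operator_space (stab G \<phi> W \<inter> stab G \<phi> Z) (?H Z W)" for Z W p
  define s where "s Z W = fst (SOME p. sect Z W p)" for Z W
  define h where "h Z W = snd (SOME p. sect Z W p)" for Z W
  have sect: "sect Z W (s Z W, h Z W)"
    if "Z \<in> supports" "W \<in> supports" "X \<subseteq> W" "W \<subset> Z" "Z \<subseteq> Y" for Z W
  proof -
    have "supp (bz Z) = Z" using bz that by blast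
    from to_H0_section[OF that(2) this that(4) \<pi>Q[OF that(1,2)]]
    obtain a b where "sect Z W (a, b)" unfolding sect_def by auto
    then have "sect Z W (SOME p. sect Z W p)" by (rule someI)
    then show ?thesis by (simp add: s_def h_def)
  qed
  note basis = chain_induced_basis[where bz = bz and Q = Q and s = s and h = h, OF X Y]

  \<comment> \<open>The chains of an orbit correspond to the cosets of the stabilizer of the
    representative \<open>r orb\<close>. So the orbit itself serves as the index set of the coset
    representatives \<open>t orb c\<close>.\<close>
  define t where "t orb c = (SOME g. g \<in> ?K \<and> move_chain g (r orb) = c)" for orb c
  have rorb: "r orb \<in> orb" "c \<in> orb \<longleftrightarrow> (\<exists>g. g \<in> ?K \<and> move_chain g (r orb) = c)" "r orb \<in> support_chains X Y m"
    if "m \<ge> 1" "orb \<in> ?O m" for m orb c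
  proof -
    show "r orb \<in> orb" using r that .
    then have "orb = {move_chain g (r orb) | g. g \<in> ?K}" by (rule chain_orbit_eq[OF that(2)])
    then have "c \<in> orb \<longleftrightarrow> c \<in> {move_chain g (r orb) | g. g \<in> ?K}" by (rule arg_cong)
    then show "c \<in> orb \<longleftrightarrow> (\<exists>g. g \<in> ?K \<and> move_chain g (r orb) = c)" by blast
    show "r orb \<in> support_chains X Y m" using \<open>r orb \<in> orb\<close> chain_orbits_subset[OF that(2)] by blast
  qed
  have t: "t orb c \<in> ?K" "move_chain (t orb c) (r orb) = c" if "m \<ge> 1" "orb \<in> ?O m" "c \<in> orb" for m orb c
  proof -
    have "\<exists>g. g \<in> ?K \<and> move_chain g (r orb) = c" using that(3) unfolding rorb(2)[OF that(1,2)] .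
    from someI_ex[OF this] show "t orb c \<in> ?K" "move_chain (t orb c) (r orb) = c" by (simp_all add: t_def)
  qed

  let ?I = "\<lambda>orb. chain_induced G \<phi> bz X Y (r orb) :: ('g, 'k, _) rep"
  let ?L = "\<lambda>orb. listset (steps Q (r orb))"
  define gd where "gd orb p \<longleftrightarrow> fst p \<in> rep_hom ?K (?I orb) ?C \<and> operator_space ?K (?I orb) \<and>
    (\<forall>a. snd p a \<in> carrier (?I orb) \<and>
      fst p (snd p a) = (\<Sum>(c, zs)\<in>orb \<times> ?L orb. alg_scale (a (c, zs)) (move (t orb c) (fold (*) zs (E X))))) \<and>
    (\<forall>A\<in>carrier (?I orb). \<exists>a. A = snd p a) \<and>
    (\<forall>a a'. (\<forall>i\<in>orb \<times> ?L orb. a i = a' i) \<longrightarrow> snd p a = snd p a')" for orb p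
  define F where "F orb = fst (SOME p. gd orb p)" for orb
  define nf where "nf orb = snd (SOME p. gd orb p)" for orb
  have gd: "gd orb (F orb, nf orb)" if m: "m \<ge> 1" and orb: "orb \<in> ?O m" for m orb
  proof -
    have "\<exists>a b. gd orb (a, b)" unfolding gd_def fst_conv snd_conv
    proof (rule basis[OF _ _ _ _ _ rorb(3)[OF m orb]])
      show "finite orb" by (rule finite_subset[OF chain_orbits_subset[OF orb] finite_support_chains])
      show "t orb c \<in> ?K" if "c \<in> orb" for c using t(1)[OF m orb that] .
      show "\<exists>c\<in>orb. \<exists>k\<in>\<Inter>Z\<in>set (r orb). stab G \<phi> Z. x = t orb c \<otimes>\<^bsub>G\<^esub> k" if x: "x \<in> ?K" for x
      proof -
        define c where "c = move_chain x (r orb)"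
        have c: "c \<in> orb" unfolding rorb(2)[OF m orb] c_def using x by blast
        note g = t[OF m orb c]
        \<comment> \<open>Both \<open>t orb c\<close> and \<open>x\<close> carry the representative
          to \<open>c\<close>, so \<open>?k\<close> fixes the representative entry by entry and lies
          in the intersection of the stabilizers.\<close>
        let ?k = "inv\<^bsub>G\<^esub> (t orb c) \<otimes>\<^bsub>G\<^esub> x"
        have "move_chain ?k (r orb) = move_chain (inv\<^bsub>G\<^esub> (t orb c)) c"
          using KG[OF g(1)] KG[OF x] by (simp add: move_chain_mult c_def)
        also have "\<dots> = move_chain (inv\<^bsub>G\<^esub> (t orb c)) (move_chain (t orb c) (r orb))" by (simp only: g(2))
        also have "\<dots> = r orb" by (rule move_chain_inv[OF KG[OF g(1)]])
        finally have "map (\<lambda>Z. \<phi> ?k ` Z) (r orb) = map (\<lambda>Z. Z) (r orb)" by (simp add: move_chain_def)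
        then have "\<phi> ?k ` Z = Z" if "Z \<in> set (r orb)" for Z using that by (simp only: map_eq_conv)
        then have "?k \<in> (\<Inter>Z\<in>set (r orb). stab G \<phi> Z)" using KG[OF g(1)] KG[OF x] by (simp add: in_stab)
        moreover have "x = t orb c \<otimes>\<^bsub>G\<^esub> ?k" using KG[OF g(1)] KG[OF x] by (simp flip: m_assoc)
        ultimately show ?thesis using c by blast
      qed
    qed (use sect \<pi>Q in \<open>simp_all add: sect_def arrows_def\<close>)
    then obtain a b where "gd orb (a, b)" by blast
    then have "gd orb (SOME p. gd orb p)" by (rule someI)
    then show ?thesis by (simp add: F_def nf_def)
  qed
  have F_hom: "F orb \<in> rep_hom ?K (?I orb) ?C" and I_op: "operator_space ?K (?I orb)"
    and nf_carrier: "nf orb a \<in> carrier (?I orb)"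
    and F_nf: "F orb (nf orb a) = (\<Sum>(c, zs)\<in>orb \<times> ?L orb. alg_scale (a (c, zs)) (move (t orb c) (fold (*) zs (E X))))"
    and nf_surj: "A \<in> carrier (?I orb) \<Longrightarrow> \<exists>a. A = nf orb a"
    and nf_cong: "(\<And>i. i \<in> orb \<times> ?L orb \<Longrightarrow> a i = a' i) \<Longrightarrow> nf orb a = nf orb a'"
    if "m \<ge> 1" "orb \<in> ?O m" for m orb a a' A
  proof -
    note g = gd[OF that, unfolded gd_def fst_conv snd_conv]
    show "F orb \<in> rep_hom ?K (?I orb) ?C" by (rule g[THEN conjunct1])
    note g = g[THEN conjunct2]
    show "operator_space ?K (?I orb)" by (rule g[THEN conjunct1])
    note g = g[THEN conjunct2]
    show "nf orb a \<in> carrier (?I orb)" by (rule g[THEN conjunct1, THEN spec, THEN conjunct1])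
    show "F orb (nf orb a) = (\<Sum>(c, zs)\<in>orb \<times> ?L orb. alg_scale (a (c, zs)) (move (t orb c) (fold (*) zs (E X))))"
      by (rule g[THEN conjunct1, THEN spec, THEN conjunct2])
    note g = g[THEN conjunct2]
    show "\<exists>a. A = nf orb a" if "A \<in> carrier (?I orb)" by (rule g[THEN conjunct1, THEN bspec, OF that])
    note g = g[THEN conjunct2, THEN spec, THEN spec, THEN mp]
    show "nf orb a = nf orb a'" if "\<And>i. i \<in> orb \<times> ?L orb \<Longrightarrow> a i = a' i" by (rule g, rule ballI, rule that)
  qed

  \<comment> \<open>A strict chain of supports has fewer than \<open>M\<close> steps, so the
    summands beyond \<open>M\<close> are zero.\<close>
  define M where "M = card (supports :: 'b set set)"
  have O_empty: "?O m = {}" if "m > M" for m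
  proof -
    have "support_chains X Y m = {}" using support_chains_length[of _ X Y m] that unfolding M_def by fastforce
    then show ?thesis by (simp add: chain_orbits_eq)
  qed
  let ?D = "\<lambda>m. direct_sum (?O m) ?I"
  let ?W = "direct_sum {1..} ?D"
  have fin_in: "finite {orb \<in> ?O m. carrier (?I orb) \<noteq> {vzero (?I orb)}}" for m
    by (rule finite_subset[OF _ finite_chain_orbits]) blast
  have D_carrier: "carrier (?D m) = (\<Pi>\<^sub>E orb\<in>?O m. carrier (?I orb))" for m
    by (rule carrier_direct_sum[OF fin_in])
  have fin_out: "finite {m\<in>{1..}. carrier (?D m) \<noteq> {vzero (?D m)}}"
  proof (rule finite_subset[of _ "{1..M}"])
    have "carrier (?D m) = {vzero (?D m)}" if "m > M" for m
      unfolding D_carrier using O_empty[OF that] by (simp add: direct_sum_def restrict_def)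
    then show "{m\<in>{1..}. carrier (?D m) \<noteq> {vzero (?D m)}} \<subseteq> {1..M}" by (auto simp: not_le[symmetric])
  qed simp
  have W_carrier: "carrier ?W = (\<Pi>\<^sub>E m\<in>{1..}. carrier (?D m))" by (rule carrier_direct_sum[OF fin_out])
  have D_op: "operator_space ?K (?D m)" if "m \<ge> 1" for m
    using I_op[OF that] by (rule operator_space_direct_sum[OF fin_in])
  have W_op: "operator_space ?K ?W"
    by (rule operator_space_direct_sum[OF fin_out]) (use D_op in simp)
  have W_in: "w m orb \<in> carrier (?I orb)" if "w \<in> carrier ?W" "m \<ge> 1" "orb \<in> ?O m" for w m orb
  proof -
    have "w m \<in> carrier (?D m)" using that(1,2) unfolding W_carrier by (auto simp: PiE_iff)
    then show ?thesis using that(3) unfolding D_carrier by (auto simp: PiE_iff)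
  qed

  \<comment> \<open>An index is a chain \<open>c\<close>, recorded with its length and orbit, and a
    tuple \<open>zs\<close> of arrows along the representative of that orbit; the family
    \<open>P\<close> moves the product of the tuple to \<open>c\<close>.\<close>
  define Idx where "Idx = Sigma {1..M} (\<lambda>m. Sigma (?O m) (\<lambda>orb. orb \<times> ?L orb))"
  define P where "P = (\<lambda>(m :: nat, orb, c, zs). move (t orb c) (fold (*) zs (E X)))"
  have fin_orb: "finite orb" if "orb \<in> ?O m" for m orb
    by (rule finite_subset[OF chain_orbits_subset[OF that] finite_support_chains])
  have fin_L: "finite (?L orb)" if mo: "m \<ge> 1" "orb \<in> ?O m" for m orb
  proof (rule finite_listset)
    fix A assume "A \<in> set (steps Q (r orb))"
    then obtain i where i: "i < m" "A = Q (r orb ! Suc i) (r orb ! i)"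
      using support_chainsD(1)[OF rorb(3)[OF mo]] by (auto simp: in_set_conv_nth)
    then show "finite A"
      using \<pi>Q(2)[OF support_chains_step(2,1)[OF rorb(3)[OF mo] i(1)]] by (simp add: arrows_def)
  qed
  have fin_Idx: "finite Idx"
    unfolding Idx_def using finite_chain_orbits fin_orb fin_L by (intro finite_SigmaI finite_cartesian_product) auto
  have sum_Idx: "(\<Sum>m\<in>{1..M}. \<Sum>orb\<in>?O m. \<Sum>(c, zs)\<in>orb \<times> ?L orb. f (m, orb, c, zs)) = (\<Sum>i\<in>Idx. f i)"
    for f :: "_ \<Rightarrow> 'z::comm_monoid_add"
  proof -
    have "(\<Sum>i\<in>Idx. f i) = (\<Sum>m\<in>{1..M}. \<Sum>j\<in>Sigma (?O m) (\<lambda>orb. orb \<times> ?L orb). f (m, j))"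
      unfolding Idx_def using finite_chain_orbits fin_orb fin_L
      by (subst sum.Sigma) (auto simp: case_prod_unfold intro!: finite_SigmaI)
    also have "\<dots> = (\<Sum>m\<in>{1..M}. \<Sum>orb\<in>?O m. \<Sum>q\<in>orb \<times> ?L orb. f (m, orb, q))"
      using finite_chain_orbits fin_orb fin_L
      by (intro sum.cong refl, subst sum.Sigma) (auto simp: case_prod_unfold)
    finally show ?thesis by (simp add: case_prod_unfold)
  qed

  define Ft where "Ft w = (\<Sum>m\<in>{1..M}. \<Sum>orb\<in>?O m. F orb (w m orb))" for w
  have Ft_nf: "Ft w = (\<Sum>i\<in>Idx. alg_scale (a i) (P i))"
    if "\<And>m orb. m \<ge> 1 \<Longrightarrow> orb \<in> ?O m \<Longrightarrow> w m orb = nf orb (\<lambda>q. a (m, orb, q))" for w a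
  proof -
    have "Ft w = (\<Sum>m\<in>{1..M}. \<Sum>orb\<in>?O m. \<Sum>(c, zs)\<in>orb \<times> ?L orb.
        alg_scale (a (m, orb, c, zs)) (P (m, orb, c, zs)))"
      unfolding Ft_def
    proof (intro sum.cong refl)
      fix m orb assume "m \<in> {1..M}" and orb: "orb \<in> ?O m"
      then have m: "m \<ge> 1" by simp
      show "F orb (w m orb) = (\<Sum>(c, zs)\<in>orb \<times> ?L orb. alg_scale (a (m, orb, c, zs)) (P (m, orb, c, zs)))"
        unfolding that[OF m orb] F_nf[OF m orb] by (simp add: P_def case_prod_unfold)
    qed
    then show ?thesis by (simp only: sum_Idx[of "\<lambda>i. alg_scale (a i) (P i)"])
  qed

  have P_corner: "P ` Idx \<subseteq> corner Y X"
  proof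
    fix x assume "x \<in> P ` Idx"
    then obtain m orb c zs where x: "x = move (t orb c) (fold (*) zs (E X))"
      and m: "m \<ge> 1" and orb: "orb \<in> ?O m" and c: "c \<in> orb" and zs: "zs \<in> ?L orb"
      unfolding Idx_def P_def by auto
    note rc = rorb(3)[OF m orb]
    have "zs \<in> listset (steps corner (r orb))"
      unfolding listset_iff
    proof (intro conjI allI impI)
      show "length zs = length (steps corner (r orb))" using zs by (simp add: listset_iff)
      fix i assume "i < length (steps corner (r orb))"
      then have i: "i < m" "i < length (r orb) - 1" using support_chainsD(1)[OF rc] by simp_all
      then have "zs ! i \<in> Q (r orb ! Suc i) (r orb ! i)" using zs by (simp add: listset_iff)
      then show "zs ! i \<in> steps corner (r orb) ! i"
        using \<pi>Q(2)[OF support_chains_step(2,1)[OF rc i(1)]] i by (auto simp: arrows_def)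
    qed
    then have "fold (*) zs (E X) \<in> corner Y X"
      using fold_corner[OF support_chainsD(3,2)[OF rc] _ X, of zs "E X"] support_chainsD(4,5)[OF rc] X
      by (simp add: corner_iff E_idem)
    then show "x \<in> corner Y X"
      unfolding x using move_corner[OF _ X Y, of "t orb c" "fold (*) zs (E X)"] t(1)[OF m orb c] by (auto simp: in_stab)
  qed

  define orbit where "orbit c = {move_chain g c | g. g \<in> ?K}" for c
  \<comment> \<open>For a step of \<open>c\<close>, the arrows of the representative moved to
    \<open>c\<close>; they need not be the arrows chosen for that pair, which
    \<open>corner_span_products\<close> allows.\<close>
  define S where "S c = map (\<lambda>A. move (t (orbit c) c) ` A) (steps Q (r (orbit c)))" for c
  have orbit: "orbit c \<in> ?O m" "c \<in> orbit c" if "c \<in> support_chains X Y m" for m c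
    using chain_orbit_of[OF that] by (simp_all add: orbit_def)
  have pos: "m \<ge> 1" if "c \<in> support_chains X Y m" for m c
  proof (rule ccontr)
    assume "\<not> m \<ge> 1"
    then have "m = 0" by simp
    then show False using that XY X by (simp add: support_chains_0 split: if_splits)
  qed
  have c_nth: "c ! i = \<phi> (t (orbit c) c) ` (r (orbit c) ! i)" if c: "c \<in> support_chains X Y m" and i: "i \<le> m" for m c i
  proof -
    have "c ! i = move_chain (t (orbit c) c) (r (orbit c)) ! i"
      using t(2)[OF pos[OF c] orbit[OF c]] by simp
    then show ?thesis
      using i support_chainsD(1)[OF rorb(3)[OF pos[OF c] orbit(1)[OF c]]] by (simp add: move_chain_def)
  qed
  have S_nth: "S c ! i = move (t (orbit c) c) ` Q (r (orbit c) ! Suc i) (r (orbit c) ! i)"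
    if c: "c \<in> support_chains X Y m" and i: "i < m" for m c i
    using i support_chainsD(1)[OF rorb(3)[OF pos[OF c] orbit(1)[OF c]]] by (simp add: S_def)
  have span_P: "corner Y X \<subseteq> alg_space.span (P ` Idx)"
  proof -
    let ?B = "\<Union>m\<in>{1..M}. \<Union>c\<in>support_chains X Y m. (\<lambda>zs. fold (*) zs (E X)) ` listset (S c)"
    have "corner Y X \<subseteq> alg_space.span ?B"
    proof (rule corner_span_products[OF X Y XY _ _ _ M_def])
      fix m c assume c: "c \<in> support_chains X Y m"
      note m = pos[OF c] and orb = orbit[OF c]
      note rc = rorb(3)[OF m orb(1)]
      show "length (S c) = m" using support_chainsD(1)[OF rc] by (simp add: S_def)
      let ?g = "t (orbit c) c"
      have g: "?g \<in> ?K" using t(1)[OF m orb] .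
      fix i assume i: "i < m"
      let ?Z = "r (orbit c) ! Suc i" and ?V = "r (orbit c) ! i"
      have ZV: "?Z \<in> supports" "?V \<in> supports" using support_chains_step[OF rc i] by blast+
      have cZ: "c ! Suc i = \<phi> ?g ` ?Z" "c ! i = \<phi> ?g ` ?V" using c_nth[OF c] i by simp_all
      have arr: "Q ?Z ?V \<subseteq> corner ?Z ?V" "corner ?Z ?V \<subseteq> alg_space.span (Q ?Z ?V \<union> decomposables ?Z ?V)"
        using \<pi>Q(2)[OF ZV] unfolding arrows_def by blast+
      show "S c ! i \<subseteq> corner (c ! Suc i) (c ! i)"
        unfolding S_nth[OF c i] cZ using move_corner[OF KG[OF g] ZV(2,1)] arr(1) by blast
      show "corner (c ! Suc i) (c ! i) \<subseteq> alg_space.span (S c ! i \<union> decomposables (c ! Suc i) (c ! i))"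
      proof
        fix x assume x: "x \<in> corner (c ! Suc i) (c ! i)"
        have "move (inv\<^bsub>G\<^esub> ?g) x \<in> corner (\<phi> (inv\<^bsub>G\<^esub> ?g) ` c ! Suc i) (\<phi> (inv\<^bsub>G\<^esub> ?g) ` c ! i)"
          by (rule move_corner[OF inv_closed[OF KG[OF g]] support_chains_step(1,2)[OF c i] x])
        then have "move (inv\<^bsub>G\<^esub> ?g) x \<in> corner ?Z ?V" by (simp only: cZ \<phi>_image_inv[OF KG[OF g]])
        then have y: "move (inv\<^bsub>G\<^esub> ?g) x \<in> alg_space.span (Q ?Z ?V \<union> decomposables ?Z ?V)" using arr(2) by blast
        have "move ?g (move (inv\<^bsub>G\<^esub> ?g) x) \<in> alg_space.span (S c ! i \<union> decomposables (c ! Suc i) (c ! i))"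
        proof (rule alg_linear_span_subset[OF move_linear alg_space.subspace_span _ y])
          fix v assume "v \<in> Q ?Z ?V \<union> decomposables ?Z ?V"
          then have "move ?g v \<in> S c ! i \<union> decomposables (c ! Suc i) (c ! i)"
            using move_decomposables[OF KG[OF g] ZV(2,1)] unfolding S_nth[OF c i] cZ by blast
          then show "move ?g v \<in> alg_space.span (S c ! i \<union> decomposables (c ! Suc i) (c ! i))"
            by (rule alg_space.span_base)
        qed
        then show "x \<in> alg_space.span (S c ! i \<union> decomposables (c ! Suc i) (c ! i))"
          by (simp only: move_inv'[OF KG[OF g]])
      qed
    qed
    also have "?B \<subseteq> P ` Idx"
    proof
      fix x assume "x \<in> ?B"
      then obtain m c ys where m: "m \<in> {1..M}" and c: "c \<in> support_chains X Y m"
        and ys: "ys \<in> listset (S c)" and x: "x = fold (*) ys (E X)" by blast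
      note orb = orbit[OF c]
      let ?g = "t (orbit c) c"
      have g: "?g \<in> ?K" using t(1)[OF pos[OF c] orb] .
      have "S c = map2 (\<lambda>f A. f ` A) (map (\<lambda>_. move ?g) (steps Q (r (orbit c)))) (steps Q (r (orbit c)))"
        by (intro nth_equalityI) (simp_all add: S_def)
      then have "ys \<in> map2 (\<lambda>f x. f x) (map (\<lambda>_. move ?g) (steps Q (r (orbit c)))) ` ?L (orbit c)"
        using ys listset_map2_image[of "map (\<lambda>_. move ?g) (steps Q (r (orbit c)))" "steps Q (r (orbit c))"] by simp
      then obtain zs where zs: "zs \<in> ?L (orbit c)" "ys = map2 (\<lambda>f x. f x) (map (\<lambda>_. move ?g) (steps Q (r (orbit c)))) zs"
        by blast
      then have "ys = map (move ?g) zs" by (intro nth_equalityI) (simp_all add: listset_iff)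
      moreover have "move ?g (E X) = E X" using g X by (simp add: in_stab move_E)
      ultimately have "x = move ?g (fold (*) zs (E X))"
        using x fold_mult_move[of "move ?g" zs "E X"] move_times[OF KG[OF g]] by simp
      then have "x = P (m, orbit c, c, zs)" by (simp add: P_def)
      moreover have "(m, orbit c, c, zs) \<in> Idx" unfolding Idx_def using m orb zs by auto
      ultimately show "x \<in> P ` Idx" by blast
    qed
    then have "alg_space.span ?B \<subseteq> alg_space.span (P ` Idx)" by (rule alg_space.span_mono)
    finally show ?thesis .
  qed

  \<comment> \<open>By \<open>card_arrows_le\<close>, moving the representative to \<open>c\<close>
    does not lower the number of arrows of any step, so there are at most as many tuples along the
    representative as paths along \<open>c\<close>. Orbits partition the chains, so the total is at
    most the number of paths, which \<open>sum_chains_le_dim\<close> bounds.\<close>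
  have card_Idx: "card Idx \<le> alg_space.dim (corner Y X)"
  proof -
    let ?w = "\<lambda>c. prod_list (steps (\<lambda>Z W. card (Q Z W)) c)"
    have le: "card (?L orb) \<le> ?w c" if m: "m \<ge> 1" and orb: "orb \<in> ?O m" and c: "c \<in> orb" for m orb c
    proof -
      note rc = rorb(3)[OF m orb]
      have cc: "c \<in> support_chains X Y m" using chain_orbits_subset[OF orb] c by blast
      have g: "t orb c \<in> carrier G" using KG t(1)[OF m orb c] by blast
      have "list_all2 (\<le>) (map card (steps Q (r orb))) (steps (\<lambda>Z W. card (Q Z W)) c)"
        unfolding map_steps list_all2_conv_all_nth
      proof (intro conjI allI impI)
        show "length (steps (\<lambda>Z W. card (Q Z W)) (r orb)) = length (steps (\<lambda>Z W. card (Q Z W)) c)"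
          using support_chainsD(1)[OF rc] support_chainsD(1)[OF cc] by simp
        fix i assume "i < length (steps (\<lambda>Z W. card (Q Z W)) (r orb))"
        then have i: "i < m" "i < length (r orb) - 1" "i < length c - 1"
          using support_chainsD(1)[OF rc] support_chainsD(1)[OF cc] by simp_all
        note ZV = support_chains_step(1,2)[OF rc i(1)]
        have "c = map (\<lambda>Z. \<phi> (t orb c) ` Z) (r orb)" using t(2)[OF m orb c] by (simp add: move_chain_def)
        then have eq: "c ! Suc i = \<phi> (t orb c) ` (r orb ! Suc i)" "c ! i = \<phi> (t orb c) ` (r orb ! i)"
          using i support_chainsD(1)[OF rc] nth_map[of "Suc i" "r orb" "\<lambda>Z. \<phi> (t orb c) ` Z"]
            nth_map[of i "r orb" "\<lambda>Z. \<phi> (t orb c) ` Z"] by simp_all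
        have "card (Q (r orb ! Suc i) (r orb ! i)) \<le> card (Q (c ! Suc i) (c ! i))"
          unfolding eq
          by (rule card_arrows_le[OF g ZV \<pi>Q(2)[OF ZV(2,1)]
                \<pi>Q(2,1)[OF \<phi>_supports[OF g ZV(2)] \<phi>_supports[OF g ZV(1)]]
                \<pi>Q(3)[OF \<phi>_supports[OF g ZV(2)] \<phi>_supports[OF g ZV(1)]]])
        then show "steps (\<lambda>Z W. card (Q Z W)) (r orb) ! i \<le> steps (\<lambda>Z W. card (Q Z W)) c ! i"
          using i by simp
      qed
      then show ?thesis unfolding card_listset by (rule prod_list_mono_nat)
    qed
    have "card Idx = (\<Sum>i\<in>Idx. 1)" by simp
    also have "\<dots> = (\<Sum>m\<in>{1..M}. \<Sum>orb\<in>?O m. \<Sum>(c, zs)\<in>orb \<times> ?L orb. 1)"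
      by (rule sum_Idx[symmetric])
    also have "\<dots> = (\<Sum>m\<in>{1..M}. \<Sum>orb\<in>?O m. \<Sum>c\<in>orb. card (?L orb))"
      by (simp add: case_prod_unfold card_cartesian_product)
    also have "\<dots> \<le> (\<Sum>m\<in>{1..M}. \<Sum>orb\<in>?O m. \<Sum>c\<in>orb. ?w c)"
      by (intro sum_mono le) auto
    also have "\<dots> = (\<Sum>m\<in>{1..M}. \<Sum>c\<in>support_chains X Y m. ?w c)"
    proof (rule sum.cong[OF refl])
      fix m
      have "(\<Sum>c\<in>\<Union>(?O m). ?w c) = (\<Sum>orb\<in>?O m. \<Sum>c\<in>orb. ?w c)"
        by (subst sum.Union_disjoint) (use fin_orb chain_orbits_disjoint in \<open>auto simp: comp_def\<close>)
      then show "(\<Sum>orb\<in>?O m. \<Sum>c\<in>orb. ?w c) = (\<Sum>c\<in>support_chains X Y m. ?w c)"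
        by (simp add: Union_chain_orbits)
    qed
    also have "\<dots> \<le> (\<Sum>m\<le>M. \<Sum>c\<in>support_chains X Y m. ?w c)"
      by (rule sum_mono2) auto
    also have "\<dots> \<le> alg_space.dim (corner Y X)"
      by (rule sum_chains_le_dim[OF _ X Y]) (rule \<pi>Q(2))
    finally show ?thesis .
  qed

  have Ft_hom: "Ft \<in> rep_hom ?K ?W ?C"
    unfolding rep_hom_def carrier_corner_rep corner_rep_ops
  proof (intro CollectI conjI ballI allI funcsetI)
    fix w assume w: "w \<in> carrier ?W"
    note w_in = W_in[OF w]
    have F_in: "F orb (w m orb) \<in> corner Y X" if "m \<ge> 1" "orb \<in> ?O m" for m orb
      using rep_homD(1)[OF F_hom[OF that] w_in[OF that]] by (simp only: carrier_corner_rep)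
    show "Ft w \<in> corner Y X"
      unfolding Ft_def by (intro alg_space.subspace_sum corner_subspace F_in) auto
    show "Ft (vscale ?W a w) = alg_scale a (Ft w)" for a
      unfolding Ft_def alg_space.scale_sum_right
    proof (intro sum.cong refl)
      fix m orb assume "m \<in> {1..M}" and orb: "orb \<in> ?O m"
      then have m: "m \<ge> 1" by simp
      show "F orb (vscale ?W a w m orb) = alg_scale a (F orb (w m orb))"
        using rep_homD(3)[OF F_hom[OF m orb] w_in[OF m orb], of a] m orb
        by (simp add: direct_sum_ops corner_rep_ops)
    qed
    show "Ft (act ?W g w) = move g (Ft w)" if g: "g \<in> ?K" for g
      unfolding Ft_def alg_linear_sum[OF move_linear]
    proof (intro sum.cong refl)
      fix m orb assume "m \<in> {1..M}" and orb: "orb \<in> ?O m"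
      then have m: "m \<ge> 1" by simp
      show "F orb (act ?W g w m orb) = move g (F orb (w m orb))"
        using rep_homD(4)[OF F_hom[OF m orb] g w_in[OF m orb]] m orb
        by (simp add: direct_sum_ops corner_rep_ops)
    qed
    fix w' assume w': "w' \<in> carrier ?W"
    show "Ft (vadd ?W w w') = Ft w + Ft w'"
      unfolding Ft_def sum.distrib[symmetric]
    proof (intro sum.cong refl)
      fix m orb assume "m \<in> {1..M}" and orb: "orb \<in> ?O m"
      then have m: "m \<ge> 1" by simp
      show "F orb (vadd ?W w w' m orb) = F orb (w m orb) + F orb (w' m orb)"
        using rep_homD(2)[OF F_hom[OF m orb] w_in[OF m orb] W_in[OF w' m orb]] m orb
        by (simp add: direct_sum_ops corner_rep_ops)
    qed
  qed

  \<comment> \<open>The coefficients from all summands are collected in one function on the indices,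
    so that images become combinations of the single family \<open>P\<close>.\<close>
  have coords: "\<exists>a. \<forall>m orb. m \<ge> 1 \<longrightarrow> orb \<in> ?O m \<longrightarrow> w m orb = nf orb (\<lambda>q. a (m, orb, q))"
    if w: "w \<in> carrier ?W" for w
  proof -
    define a where "a = (\<lambda>(m, orb, q). (SOME a. w m orb = nf orb a) q)"
    have "w m orb = nf orb (\<lambda>q. a (m, orb, q))" if "m \<ge> 1" "orb \<in> ?O m" for m orb
      using someI_ex[OF nf_surj[OF that W_in[OF w that]]] by (simp add: a_def)
    then show ?thesis by blast
  qed
  \<comment> \<open>\<open>P\<close> spans the corner and is independent by
    \<open>spanning_family_independent\<close>. Equal images thus have equal coefficients on
    \<open>Idx\<close>, and \<open>nf_cong\<close> gives equal elements.\<close>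
  have "bij_betw Ft (carrier ?W) (carrier ?C)"
    unfolding bij_betw_def carrier_corner_rep
  proof
    show "inj_on Ft (carrier ?W)"
    proof (rule inj_onI)
      fix w w' assume w: "w \<in> carrier ?W" and w': "w' \<in> carrier ?W" and eq: "Ft w = Ft w'"
      obtain a where a: "\<And>m orb. m \<ge> 1 \<Longrightarrow> orb \<in> ?O m \<Longrightarrow> w m orb = nf orb (\<lambda>q. a (m, orb, q))"
        using coords[OF w] by blast
      obtain a' where a': "\<And>m orb. m \<ge> 1 \<Longrightarrow> orb \<in> ?O m \<Longrightarrow> w' m orb = nf orb (\<lambda>q. a' (m, orb, q))"
        using coords[OF w'] by blast
      have "(\<Sum>i\<in>Idx. alg_scale (a i) (P i)) = (\<Sum>i\<in>Idx. alg_scale (a' i) (P i))"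
        using eq by (simp only: Ft_nf[OF a] Ft_nf[OF a'])
      then have aa': "a i = a' i" if "i \<in> Idx" for i
        using spanning_family_independent[OF fin_Idx span_P P_corner card_Idx _ that] by blast
      have "w m orb = w' m orb" if m: "m \<ge> 1" and orb: "orb \<in> ?O m" for m orb
      proof -
        have "m \<le> M" using O_empty[of m] orb by (cases "m > M") auto
        then have "nf orb (\<lambda>q. a (m, orb, q)) = nf orb (\<lambda>q. a' (m, orb, q))"
          by (intro nf_cong[OF m orb] aa') (use m orb in \<open>auto simp: Idx_def\<close>)
        then show ?thesis by (simp only: a[OF m orb] a'[OF m orb])
      qed
      then have "w m = w' m" if "m \<ge> 1" for m
        using w w' that unfolding W_carrier D_carrier by (intro PiE_ext[of "w m" "?O m" _ "w' m"]) (auto simp: PiE_iff)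
      then show "w = w'" using w w' unfolding W_carrier by (intro PiE_ext[of w "{1..}" _ w']) auto
    qed
    show "Ft ` carrier ?W = corner Y X"
    proof (intro equalityI subsetI)
      fix x assume "x \<in> Ft ` carrier ?W"
      then show "x \<in> corner Y X" using rep_homD(1)[OF Ft_hom] by (auto simp: carrier_corner_rep)
    next
      fix x assume "x \<in> corner Y X"
      then obtain a where x: "x = (\<Sum>i\<in>Idx. alg_scale (a i) (P i))"
        using alg_space.span_image_finite[OF fin_Idx] span_P by blast
      define w where "w = (\<lambda>m\<in>{1..}. \<lambda>orb\<in>?O m. nf orb (\<lambda>q. a (m, orb, q)))"
      have "w \<in> carrier ?W"
        unfolding W_carrier D_carrier w_def using nf_carrier by auto
      moreover have "Ft w = x" unfolding x by (rule Ft_nf) (simp add: w_def)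
      ultimately show "x \<in> Ft ` carrier ?W" by blast
    qed
  qed
  then show ?thesis by (rule rep_iso_inverse[OF Ft_hom _ W_op])
qed

end

theorem theorem7p6:
  fixes G :: "('g, 'm) monoid_scheme"
    and \<phi> :: "'g \<Rightarrow> 'b::left_regular_band \<Rightarrow> 'b"
    and E :: "'b set \<Rightarrow> ('b, 'k::field) semigroup_algebra"
    and X Y :: "'b set"
    and bz :: "'b set \<Rightarrow> 'b"
    and r :: "'b set list set \<Rightarrow> 'b set list"
  assumes "group G" and "finite (carrier G)"
    and "lrb_action G \<phi>"
    and "\<not> CHAR('k) dvd order G"
    and "hereditary_lrb TYPE('b) TYPE('k)"
    and "cfpoi supports E" and "standardly_indexed E" and "invariant_family G \<phi> E"
    and "X \<in> supports" and "Y \<in> supports" and "X \<subset> Y"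
    and "\<And>Z. Z \<in> supports \<Longrightarrow> X \<subset> Z \<Longrightarrow> Z \<subseteq> Y \<Longrightarrow> supp (bz Z) = Z"
    and "\<And>m orb. m \<ge> 1 \<Longrightarrow> orb \<in> chain_orbits G \<phi> X Y m \<Longrightarrow> r orb \<in> orb"
  shows "rep_iso (stab G \<phi> X \<inter> stab G \<phi> Y)
    (corner_rep \<phi> (E Y) (E X))
    (direct_sum {1..} (\<lambda>m. direct_sum (chain_orbits G \<phi> X Y m) (\<lambda>orb. chain_induced G \<phi> bz X Y (r orb))))"
proof -
  \<comment> \<open>The conditions on the idempotents enter as duality with the characters and
    equivariance, the characteristic through averaging; heredity enters below through the freeness
    of the arrows.\<close>
  interpret equivariant_idempotents E G \<phi>
    by (intro equivariant_idempotents.intro equivariant_idempotents_axioms.intro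
        standard_idempotents_cfpoi assms)
  show ?thesis
    using assms(5) by (intro corner_decomposition assms) (simp_all add: hereditary_lrb_def)
qed

end
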